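(* Let $N\ge1$, let $a_1<b_1<\cdots<a_N<b_N$ be real, let $\alpha_1,\dots,\alpha_{N-1}\in\mathbb R$ and $n\in\mathbb Z$. Define, for $z\in\mathbb C\setminus\mathbb R$, $$M(z)=\begin{pmatrix} v_1^{(1)}(z)& v_2^{(1)}(z)\\ -v_1^{(2)}(z)& v_2^{(2)}(z)\end{pmatrix}\ \text{ if } \operatorname{Im}z>0,\qquad M(z)=\begin{pmatrix} v_1^{(1)}(z)& -v_2^{(1)}(z)\\ v_1^{(2)}(z)& v_2^{(2)}(z)\end{pmatrix}\ \text{ if } \operatorname{Im}z<0,$$ where $v_j^{(\nu)}=\exp(u_j^{(\nu)})$ are the exponentials of the Abelian integrals $u_j^{(\nu)}$ defined in the context. Then $M$ (extended by continuity across $(-\infty,a_1)\cup(b_N,\infty)$) satisfies the model Riemann-Hilbert problem: (a) $M:\mathbb C\setminus[a_1,b_N]\to\mathbb C^{2\times2}$ is analytic; (b) $M_+(x)=M_-(x)J_M(x)$, where $J_M(x)=\begin{pmatrix}0&1\\-1&0\end{pmatrix}$ for $x\in(a_k,b_k)$, $k=1,\dots,N$, and $J_M(x)=\begin{pmatrix}e^{-2\pi i n\alpha_k}&0\\0&e^{2\pi i n\alpha_k}\end{pmatrix}$ for $x\in(b_k,a_{k+1})$, $k=1,\dots,N-1$; (c) $M(z)=I+O(1/z)$ as $z\to\infty$; (d) $M$ has at most fourth-root singularities at the endpoints, i.e. its entries are $O(|z-c|^{-1/4})$ as $z\to c$ for every $c\in\{a_1,b_1,\dots,a_N,b_N\}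$.
   Context: $M_\pm(x)$ denote the limits of $M(z)$ as $z\to x\in\mathbb R$ from the upper ($+$) or lower ($-$) half-plane. Riemann surface: $\mathcal R$ is the compact Riemann surface of genus $N-1$ for $w^2=\prod_{k=1}^N(z-a_k)(z-b_k)$, obtained by gluing two copies (the first and second sheet) of $\overline{\mathbb C}\setminus\bigcup_{k=1}^N[a_k,b_k]$ crosswise along the cuts $[a_k,b_k]$ (the upper side of a cut on one sheet is glued to the lower side on the other sheet). $\infty_1,\infty_2$ are the points at infinity on sheets 1 and 2. $\Gamma_j=\{(z,w)\in\mathcal R: b_j\le z\le a_{j+1}\}$, $j=1,\dots,N-1$. Cycles: $B_j$ is a closed curve on the first sheet, symmetric with respect to the real axis, encircling $[a_1,b_j]$ once counterclockwise and crossing the real line only in $(-\infty,a_1)$ and $(b_j,a_{j+1})$. $A_j$ is the closed curve that goes from a point over $(a_j,b_j)$ through the open upper half-plane of the first sheet to a point over $(a_{j+1},b_{j+1})$, passes there to the second sheet, and returns through the open lower half-plane of the second sheet; it is disjoint from $\Gamma_j$. Differential: for $P_j\in\Gamma_j$ ($j=1,\dots,N-1$) and $\nu\in\{1,2\}$, $\omega_P^{(\nu)}$ is the unique meromorphic differential on $\mathcal R$ with at most simple poles, with residue $-\tfrac12$ at each $a_k$ and $b_k$, residue $1$ at each $P_j$, residue $1$ at $\infty_2$ (if $\nu=1$) or at $\infty_1$ (if $\nu=2$), holomorphic elsewhere, and with $\int_{A_j}\omega_P^{(\nu)}=0$ for all $j$. (If $P_j$ is a branch point, the prescribed residues there are added,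 giving $\tfrac12$.) Choice of points: for $\nu=1,2$, $(P_1^{(\nu)},\dots,P_{N-1}^{(\nu)})\in\Gamma_1\times\cdots\times\Gamma_{N-1}$ is the (existing and unique) tuple for which the corresponding differential $\omega_P^{(\nu)}$ satisfies $\frac1{2\pi i}\int_{B_k}\omega_P^{(\nu)}\equiv n\alpha_k \pmod{\mathbb Z}$ for $k=1,\dots,N-1$ (if the pole $P_k^{(\nu)}$ lies on $B_k$, deform $B_k$ slightly to avoid it; the class modulo $\mathbb Z$ does not depend on the deformation). From now on $\omega_P^{(\nu)}$ is the differential for these points. Abelian integrals: for $z\in\mathbb C\setminus\mathbb R$ and $j,\nu\in\{1,2\}$, $u_j^{(\nu)}(z)=\int_{\infty_\nu}^{z}\omega_P^{(\nu)}$ with $z$ viewed as a point on the $j$th sheet and the following path. If $j=\nu$: the path stays on the $j$th sheet and does not meet the real line except at its initial point $\infty_\nu$. If $j\ne\nu$: for $\operatorname{Im}z>0$ (resp. $<0$) the path starts at $\infty_\nu$, runs in the lower (resp. upper) half-plane of the $\nu$th sheet, passes to the $j$th sheet through some open cut $(a_k,b_k)$, and then stays in the upper (resp. lower) half-plane of the $j$th sheet; the value does not depend on which cut is used. Finally $v_j^{(\nu)}(z)=\exp(u_j^{(\nu)}(z))$. *)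

theory Defs
  imports "HOL-Complex_Analysis.Complex_Analysis" "HOL-Library.Landau_Symbols"
begin

section \<open>The hyperelliptic surface\<close>

definition curve_poly :: "nat \<Rightarrow> (nat \<Rightarrow> real) \<Rightarrow> (nat \<Rightarrow> real) \<Rightarrow> complex \<Rightarrow> complex" where
  "curve_poly N a b z = (\<Prod>k=1..N. (z - of_real (a k)) * (z - of_real (b k)))"

definition affine_curve :: "nat \<Rightarrow> (nat \<Rightarrow> real) \<Rightarrow> (nat \<Rightarrow> real) \<Rightarrow> (complex \<times> complex) set" where
  "affine_curve N a b = {(z, w). w\<^sup>2 = curve_poly N a b z}"

definition cuts :: "nat \<Rightarrow> (nat \<Rightarrow> real) \<Rightarrow> (nat \<Rightarrow> real) \<Rightarrow> complex set" where
  "cuts N a b = (\<Union>k\<in>{1..N}. of_real ` {a k..b k})"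

text \<open>
  The branch of the square root of \<^const>\<open>curve_poly\<close> that is holomorphic off the cuts and
  asymptotic to \<open>z ^ N\<close> at infinity.  Since \<^const>\<open>csqrt\<close> is the principal root, the sign
  changes of the two factors for index \<open>k\<close> cancel to the left of \<open>a k\<close>.
\<close>
definition sheet_root :: "nat \<Rightarrow> (nat \<Rightarrow> real) \<Rightarrow> (nat \<Rightarrow> real) \<Rightarrow> complex \<Rightarrow> complex" where
  "sheet_root N a b z = (\<Prod>k=1..N. csqrt (z - of_real (a k)) * csqrt (z - of_real (b k)))"

text \<open>
  The point over \<open>z\<close> on sheet \<open>j\<close> (\<open>j = 1, 2\<close>).  The two lifts of the cut plane
  are glued crosswise inside the curve, because \<^const>\<open>sheet_root\<close> changes sign across each cut.
\<close>
definition sheet_pt ::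
  "nat \<Rightarrow> (nat \<Rightarrow> real) \<Rightarrow> (nat \<Rightarrow> real) \<Rightarrow> nat \<Rightarrow> complex \<Rightarrow> complex \<times> complex" where
  "sheet_pt N a b j z = (z, if j = 1 then sheet_root N a b z else - sheet_root N a b z)"

definition sheet :: "nat \<Rightarrow> (nat \<Rightarrow> real) \<Rightarrow> (nat \<Rightarrow> real) \<Rightarrow> nat \<Rightarrow> (complex \<times> complex) set" where
  "sheet N a b j = sheet_pt N a b j ` (- cuts N a b)"

datatype surface_point = Aff "complex \<times> complex" | Infty nat

definition surface :: "nat \<Rightarrow> (nat \<Rightarrow> real) \<Rightarrow> (nat \<Rightarrow> real) \<Rightarrow> surface_point set" where
  "surface N a b = Aff ` affine_curve N a b \<union> {Infty 1, Infty 2}"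

definition branch_points :: "nat \<Rightarrow> (nat \<Rightarrow> real) \<Rightarrow> (nat \<Rightarrow> real) \<Rightarrow> surface_point set" where
  "branch_points N a b = (\<Union>k\<in>{1..N}. {Aff (of_real (a k), 0), Aff (of_real (b k), 0)})"

definition gap_circle ::
  "nat \<Rightarrow> (nat \<Rightarrow> real) \<Rightarrow> (nat \<Rightarrow> real) \<Rightarrow> nat \<Rightarrow> (complex \<times> complex) set" where
  "gap_circle N a b j = {(z, w) \<in> affine_curve N a b. z \<in> of_real ` {b j..a (j + 1)}}"

text \<open>
  \<open>\<phi>\<close> is a holomorphic parametrization of a neighbourhood of the given point by a disc
  about \<open>0\<close>, the point itself corresponding to parameter \<open>0\<close> (so \<open>\<phi>\<close> is the inverse of a
  chart).  The affine curve is smooth, so an injective holomorphic map of a disc into it is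
  biholomorphic onto its image.  At the points at infinity the value \<open>\<phi> 0\<close> is irrelevant.
\<close>
fun local_param ::
  "nat \<Rightarrow> (nat \<Rightarrow> real) \<Rightarrow> (nat \<Rightarrow> real) \<Rightarrow> surface_point \<Rightarrow> (complex \<Rightarrow> complex \<times> complex) \<Rightarrow> bool" where
  "local_param N a b (Aff x) \<phi> \<longleftrightarrow>
     \<phi> 0 = x \<and>
     (\<exists>r>0. (fst \<circ> \<phi>) holomorphic_on ball 0 r \<and> (snd \<circ> \<phi>) holomorphic_on ball 0 r \<and>
            inj_on \<phi> (ball 0 r) \<and> \<phi> ` ball 0 r \<subseteq> affine_curve N a b)"
| "local_param N a b (Infty j) \<phi> \<longleftrightarrow>
     filterlim (fst \<circ> \<phi>) at_infinity (at 0) \<and>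
     (\<exists>r>0. (fst \<circ> \<phi>) holomorphic_on (ball 0 r - {0}) \<and> (snd \<circ> \<phi>) holomorphic_on (ball 0 r - {0}) \<and>
            inj_on \<phi> (ball 0 r - {0}) \<and> \<phi> ` (ball 0 r - {0}) \<subseteq> sheet N a b j)"


section \<open>Meromorphic differentials\<close>

text \<open>
  A meromorphic differential is given by its coefficient \<open>f\<close> with respect to \<open>dz\<close>, a function
  on the affine curve; its values at poles and at branch points (where \<open>dz\<close> vanishes) carry
  no meaning.  Its pullback along a local parametrization \<open>\<phi>\<close> is \<open>pullback f \<phi> t dt\<close>.
\<close>
definition pullback ::
  "(complex \<times> complex \<Rightarrow> complex) \<Rightarrow> (complex \<Rightarrow> complex \<times> complex) \<Rightarrow> complex \<Rightarrow> complex" where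
  "pullback f \<phi> t = f (\<phi> t) * deriv (fst \<circ> \<phi>) t"

text \<open>\<open>f dz\<close> has at most a simple pole at \<open>p\<close>, with residue \<open>r\<close> (possibly \<open>0\<close>).\<close>
definition simple_residue_at ::
  "nat \<Rightarrow> (nat \<Rightarrow> real) \<Rightarrow> (nat \<Rightarrow> real) \<Rightarrow> (complex \<times> complex \<Rightarrow> complex) \<Rightarrow> surface_point \<Rightarrow>
   complex \<Rightarrow> bool" where
  "simple_residue_at N a b f p r \<longleftrightarrow>
     (\<forall>\<phi>. local_param N a b p \<phi> \<longrightarrow>
        (\<exists>h. h analytic_on {0} \<and> (\<forall>\<^sub>F t in at 0. pullback f \<phi> t = r / t + h t)))"

text \<open>
  \<open>f dz\<close> is holomorphic at \<open>p\<close>.  At affine points that are not branch points \<open>dz\<close> does not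
  vanish, and the value of \<open>f\<close> at \<open>p\<close> itself must be the right one.
\<close>
definition holomorphic_diff_at ::
  "nat \<Rightarrow> (nat \<Rightarrow> real) \<Rightarrow> (nat \<Rightarrow> real) \<Rightarrow> (complex \<times> complex \<Rightarrow> complex) \<Rightarrow> surface_point \<Rightarrow> bool" where
  "holomorphic_diff_at N a b f p \<longleftrightarrow>
     (\<forall>\<phi>. local_param N a b p \<phi> \<longrightarrow>
        (\<exists>h. h analytic_on {0} \<and> (\<forall>\<^sub>F t in at 0. pullback f \<phi> t = h t) \<and>
             (p \<in> range Aff - branch_points N a b \<longrightarrow> pullback f \<phi> 0 = h 0)))"


section \<open>Integration along curves on the surface\<close>

definition surface_path ::
  "nat \<Rightarrow> (nat \<Rightarrow> real) \<Rightarrow> (nat \<Rightarrow> real) \<Rightarrow> (real \<Rightarrow> complex \<times> complex) \<Rightarrow> bool" where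
  "surface_path N a b \<gamma> \<longleftrightarrow>
     path \<gamma> \<and> path_image \<gamma> \<subseteq> affine_curve N a b \<and> valid_path (fst \<circ> \<gamma>)"

definition has_surface_integral ::
  "(complex \<times> complex \<Rightarrow> complex) \<Rightarrow> complex \<Rightarrow> (real \<Rightarrow> complex \<times> complex) \<Rightarrow> bool" where
  "has_surface_integral f I \<gamma> \<longleftrightarrow>
     ((\<lambda>t. f (\<gamma> t) * vector_derivative (fst \<circ> \<gamma>) (at t within {0..1})) has_integral I) {0..1}"

text \<open>
  For a curve defined on \<open>(0, 1]\<close> that tends to a point at infinity as the parameter tends
  to \<open>0\<close>.
\<close>
definition has_surface_integral_from_infty ::
  "(complex \<times> complex \<Rightarrow> complex) \<Rightarrow> complex \<Rightarrow> (real \<Rightarrow> complex \<times> complex) \<Rightarrow> bool" where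
  "has_surface_integral_from_infty f I \<gamma> \<longleftrightarrow>
     (\<exists>J. (\<forall>\<epsilon>\<in>{0<..<1}. has_surface_integral f (J \<epsilon>) (subpath \<epsilon> 1 \<gamma>)) \<and> (J \<longlongrightarrow> I) (at_right 0))"

definition A_cycle ::
  "nat \<Rightarrow> (nat \<Rightarrow> real) \<Rightarrow> (nat \<Rightarrow> real) \<Rightarrow> nat \<Rightarrow> (real \<Rightarrow> complex \<times> complex) \<Rightarrow> bool" where
  "A_cycle N a b j \<gamma> \<longleftrightarrow>
     surface_path N a b \<gamma> \<and> pathfinish \<gamma> = pathstart \<gamma> \<and>
     fst (\<gamma> 0) \<in> of_real ` {a j<..<b j} \<and>
     (\<exists>s\<in>{0<..<1}.
        (\<forall>t\<in>{0<..<s}. \<gamma> t \<in> sheet N a b 1 \<and> Im (fst (\<gamma> t)) > 0) \<and>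
        fst (\<gamma> s) \<in> of_real ` {a (j + 1)<..<b (j + 1)} \<and>
        (\<forall>t\<in>{s<..<1}. \<gamma> t \<in> sheet N a b 2 \<and> Im (fst (\<gamma> t)) < 0))"

text \<open>
  \<open>\<gamma>\<close> is the projection of the cycle to the plane; the cycle itself is the lift
  \<open>sheet_pt N a b 1 \<circ> \<gamma>\<close> to the first sheet.
\<close>
definition B_cycle ::
  "(nat \<Rightarrow> real) \<Rightarrow> (nat \<Rightarrow> real) \<Rightarrow> nat \<Rightarrow> (real \<Rightarrow> complex) \<Rightarrow> bool" where
  "B_cycle a b k \<gamma> \<longleftrightarrow>
     valid_path \<gamma> \<and> simple_path \<gamma> \<and> pathfinish \<gamma> = pathstart \<gamma> \<and>
     cnj ` path_image \<gamma> = path_image \<gamma> \<and>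
     path_image \<gamma> \<inter> \<real> \<subseteq> of_real ` ({..<a 1} \<union> {b k<..<a (k + 1)}) \<and>
     (\<forall>x\<in>{a 1..b k}. winding_number \<gamma> (of_real x) = 1)"


section \<open>The differentials and their Abelian integrals\<close>

text \<open>Prescriptions at coinciding points add up; \<open>Infty (3 - \<nu>)\<close> is the point at infinity with index other than \<open>\<nu>\<close>.\<close>
definition prescribed_residue ::
  "nat \<Rightarrow> (nat \<Rightarrow> real) \<Rightarrow> (nat \<Rightarrow> real) \<Rightarrow> nat \<Rightarrow> (nat \<Rightarrow> complex \<times> complex) \<Rightarrow> surface_point \<Rightarrow> complex" where
  "prescribed_residue N a b \<nu> P p =
     (if p \<in> branch_points N a b then - 1 / 2 else 0)
     + (\<Sum>j\<in>{1..<N}. if p = Aff (P j) then 1 else 0)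
     + (if p = Infty (3 - \<nu>) then 1 else 0)"

definition is_omega ::
  "nat \<Rightarrow> (nat \<Rightarrow> real) \<Rightarrow> (nat \<Rightarrow> real) \<Rightarrow> nat \<Rightarrow> (nat \<Rightarrow> complex \<times> complex) \<Rightarrow>
   (complex \<times> complex \<Rightarrow> complex) \<Rightarrow> bool" where
  "is_omega N a b \<nu> P f \<longleftrightarrow>
     (\<forall>p\<in>surface N a b. simple_residue_at N a b f p (prescribed_residue N a b \<nu> P p)) \<and>
     (\<forall>p\<in>surface N a b. prescribed_residue N a b \<nu> P p = 0 \<longrightarrow> holomorphic_diff_at N a b f p) \<and>
     (\<forall>j\<in>{1..<N}. \<forall>\<gamma>. A_cycle N a b j \<gamma> \<longrightarrow> has_surface_integral f 0 \<gamma>)"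

text \<open>
  The normalized period of \<open>f dz\<close> over the \<open>k\<close>-th B-cycle is congruent to \<open>c\<close> modulo the
  integers, for every representative of the cycle that does not pass through the pole \<open>P k\<close>.
\<close>
definition B_period_cong ::
  "nat \<Rightarrow> (nat \<Rightarrow> real) \<Rightarrow> (nat \<Rightarrow> real) \<Rightarrow> (nat \<Rightarrow> complex \<times> complex) \<Rightarrow>
   (complex \<times> complex \<Rightarrow> complex) \<Rightarrow> nat \<Rightarrow> real \<Rightarrow> bool" where
  "B_period_cong N a b P f k c \<longleftrightarrow>
     (\<forall>\<gamma>. B_cycle a b k \<gamma> \<and> P k \<notin> sheet_pt N a b 1 ` path_image \<gamma> \<longrightarrow>
        (\<exists>I. has_surface_integral f I (sheet_pt N a b 1 \<circ> \<gamma>) \<and>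
             (\<exists>m::int. 1 / (2 * of_real pi * \<i>) * I = of_real c + of_int m)))"

text \<open>
  Admissible paths from the point at infinity \<open>\<nu>\<close> to the point over \<open>z\<close> on sheet \<open>j\<close>.
  A product \<open>Im x * Im z\<close> is positive (negative) iff \<open>x\<close> lies in the same (opposite)
  open half-plane as \<open>z\<close>.
\<close>
definition abelian_path ::
  "nat \<Rightarrow> (nat \<Rightarrow> real) \<Rightarrow> (nat \<Rightarrow> real) \<Rightarrow> nat \<Rightarrow> nat \<Rightarrow> complex \<Rightarrow> (real \<Rightarrow> complex \<times> complex) \<Rightarrow> bool" where
  "abelian_path N a b \<nu> j z \<gamma> \<longleftrightarrow>
     (\<forall>\<epsilon>\<in>{0<..<1}. surface_path N a b (subpath \<epsilon> 1 \<gamma>)) \<and>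
     filterlim (fst \<circ> \<gamma>) at_infinity (at_right 0) \<and>
     \<gamma> 1 = sheet_pt N a b j z \<and>
     (if j = \<nu> then
        \<forall>t\<in>{0<..1}. \<gamma> t \<in> sheet N a b \<nu> \<and> Im (fst (\<gamma> t)) \<noteq> 0
      else
        \<exists>s\<in>{0<..<1}. \<exists>k\<in>{1..N}.
          (\<forall>t\<in>{0<..<s}. \<gamma> t \<in> sheet N a b \<nu> \<and> Im (fst (\<gamma> t)) * Im z < 0) \<and>
          fst (\<gamma> s) \<in> of_real ` {a k<..<b k} \<and>
          (\<forall>t\<in>{s<..1}. \<gamma> t \<in> sheet N a b j \<and> Im (fst (\<gamma> t)) * Im z > 0))"

definition abelian_u ::
  "nat \<Rightarrow> (nat \<Rightarrow> real) \<Rightarrow> (nat \<Rightarrow> real) \<Rightarrow> (complex \<times> complex \<Rightarrow> complex) \<Rightarrow> nat \<Rightarrow> nat \<Rightarrow> complex \<Rightarrow> complex" where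
  "abelian_u N a b f \<nu> j z =
     (THE I. \<exists>\<gamma>. abelian_path N a b \<nu> j z \<gamma> \<and> has_surface_integral_from_infty f I \<gamma>)"

definition abelian_v ::
  "nat \<Rightarrow> (nat \<Rightarrow> real) \<Rightarrow> (nat \<Rightarrow> real) \<Rightarrow> (complex \<times> complex \<Rightarrow> complex) \<Rightarrow> nat \<Rightarrow> nat \<Rightarrow> complex \<Rightarrow> complex" where
  "abelian_v N a b f \<nu> j z = exp (abelian_u N a b f \<nu> j z)"


section \<open>The model Riemann-Hilbert problem\<close>

definition M_nonreal ::
  "nat \<Rightarrow> (nat \<Rightarrow> real) \<Rightarrow> (nat \<Rightarrow> real) \<Rightarrow> (nat \<Rightarrow> complex \<times> complex \<Rightarrow> complex) \<Rightarrow> complex \<Rightarrow> complex^2^2" where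
  "M_nonreal N a b \<omega> z =
     (let v = (\<lambda>\<nu> j. abelian_v N a b (\<omega> \<nu>) \<nu> j z) in
      if Im z > 0 then vector [vector [v 1 1, v 1 2], vector [- v 2 1, v 2 2]]
      else vector [vector [v 1 1, - v 1 2], vector [v 2 1, v 2 2]])"

definition M_model ::
  "nat \<Rightarrow> (nat \<Rightarrow> real) \<Rightarrow> (nat \<Rightarrow> real) \<Rightarrow> (nat \<Rightarrow> complex \<times> complex \<Rightarrow> complex) \<Rightarrow> complex \<Rightarrow> complex^2^2" where
  "M_model N a b \<omega> z =
     (if Im z \<noteq> 0 then M_nonreal N a b \<omega> z
      else Lim (at z within {y. Im y \<noteq> 0}) (M_nonreal N a b \<omega>))"

definition has_jump :: "(complex \<Rightarrow> complex^2^2) \<Rightarrow> real \<Rightarrow> complex^2^2 \<Rightarrow> bool" where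
  "has_jump M x J \<longleftrightarrow>
     (\<exists>Mp Mm. (M \<longlongrightarrow> Mp) (at (of_real x) within {z. Im z > 0}) \<and>
              (M \<longlongrightarrow> Mm) (at (of_real x) within {z. Im z < 0}) \<and>
              Mp = Mm ** J)"

definition J_cut :: "complex^2^2" where
  "J_cut = vector [vector [0, 1], vector [-1, 0]]"

definition J_gap :: "int \<Rightarrow> real \<Rightarrow> complex^2^2" where
  "J_gap n \<alpha> =
     vector [vector [exp (- (2 * of_real pi * \<i> * of_int n * of_real \<alpha>)), 0],
             vector [0, exp (2 * of_real pi * \<i> * of_int n * of_real \<alpha>)]]"

definition model_RHP ::
  "nat \<Rightarrow> (nat \<Rightarrow> real) \<Rightarrow> (nat \<Rightarrow> real) \<Rightarrow> (nat \<Rightarrow> real) \<Rightarrow> int \<Rightarrow> (complex \<Rightarrow> complex^2^2) \<Rightarrow> bool" where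
  "model_RHP N a b \<alpha> n M \<longleftrightarrow>
     (\<forall>i j. (\<lambda>z. M z $ i $ j) analytic_on (- of_real ` {a 1..b N})) \<and>
     (\<forall>k\<in>{1..N}. \<forall>x\<in>{a k<..<b k}. has_jump M x J_cut) \<and>
     (\<forall>k\<in>{1..<N}. \<forall>x\<in>{b k<..<a (k + 1)}. has_jump M x (J_gap n (\<alpha> k))) \<and>
     (\<forall>i j. (\<lambda>z. M z $ i $ j - mat 1 $ i $ j) \<in> O[at_infinity](\<lambda>z. 1 / z)) \<and>
     (\<forall>c\<in>a ` {1..N} \<union> b ` {1..N}. \<forall>i j.
        (\<lambda>z. cmod (M z $ i $ j)) \<in>
          O[at (of_real c) within (- of_real ` {a 1..b N})](\<lambda>z. cmod (z - of_real c) powr (- 1 / 4)))"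

end

theory Submission
  imports Defs
begin

text \<open>
  Let \<open>r\<close> be the root on the first sheet and \<open>f_\<sigma>(z) = f(z, \<sigma> r(z))\<close>, \<open>\<sigma> = 1, -1\<close>, the coefficient of
  the differential on the two sheets.  Its primitives live on slit planes, the two open
  half-planes joined through one interval of the real axis; a branch of the root is continued
  through a cut or a gap, and the primitive of \<open>f\<close> along this branch carries the jump relation there.
  All Abelian integrals come from one primitive, which vanishes at infinity on the sheet where
  the path starts, by continuation through the cuts; the vanishing of the A-periods says that the
  continuation does not depend on the cut.  The A-cycles cover only one of the two orientations.
  The other one, and the jumps on the second sheet, follow from the sum \<open>f_1 + f_{-1}\<close>, which
  descends to the plane: by Liouville's theorem it is \<open>- 1/2 \<Sum> 1/(z - c) + \<Sum> 1/(z - p_j)\<close>, with \<open>c\<close>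
  over the branch points and \<open>p_j\<close> the projected poles.  Hence the product of the two
  exponentials is a constant multiple of \<open>\<Prod> (z - p_j) / r\<close>, with opposite constants in the two
  half-planes.  The B-periods, evaluated on circles, give the jump on the first sheet.  Near a branch
  point the integral is \<open>\<rho> log t + O(1)\<close> with \<open>z = c + t^2\<close> and \<open>\<rho> \<ge> -1/2\<close>.
\<close>

section \<open>Slit planes and half-planes\<close>

text \<open>Admissible paths are arbitrary, but no homotopy enters: a function continuous along the
  path, with the right derivative off the crossing, gives the integral by its end value. So
  everything reduces to primitives on half-planes and to constants by which they match across one
  interval. A pole over a gap makes the integral logarithmic. Its residue is 1, so the exponential
  only acquires a simple zero there; jumps on gaps are therefore stated for exponentials, and
  boundary values of the integral itself are used only next to a point chosen off the pole. The
  signs in the matrix have one source: passing a cut exchanges the two factors in the product of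
  exponentials and reverses the root, so the constant of the product changes sign. Consequently the
  exponential off the starting sheet, reached from the opposite half-plane, has opposite signs above
  and below the outer rays, and the minus signs in the matrix undo this. The same product gives the
  decay of the off-diagonal entries: \<open>N - 1\<close> pole factors stand over a root of degree
  \<open>N\<close>.\<close>

definition slit :: "real \<Rightarrow> real \<Rightarrow> complex set" where
  "slit l r = {z. Im z \<noteq> 0 \<or> (l < Re z \<and> Re z < r)}"

lemma open_slit: "open (slit l r)"
proof -
  have "slit l r = {z. Im z < 0} \<union> {z. Im z > 0} \<union> ({z. Re z > l} \<inter> {z. Re z < r})"
    by (auto simp: slit_def)
  then show ?thesis
    by (simp add: open_Un open_Int open_halfspace_Im_lt open_halfspace_Im_gt
        open_halfspace_Re_gt open_halfspace_Re_lt)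
qed

text \<open>The slit plane is not convex, so a primitive has to come from star-shapedness. A segment
  from a point of the open interval to a nonreal point leaves the real axis at once; to a real point
  of the set it stays in the interval.\<close>

lemma starlike_slit:
  assumes "l < r"
  shows "starlike (slit l r)"
proof -
  define m where "m = (l + r) / 2"
  have m: "l < m" "m < r" using assms by (auto simp: m_def)
  have "closed_segment (of_real m) z \<subseteq> slit l r" if "z \<in> slit l r" for z
  proof
    fix w assume "w \<in> closed_segment (of_real m) z"
    then obtain u where u: "0 \<le> u" "u \<le> 1" and w: "w = (1 - u) *\<^sub>R of_real m + u *\<^sub>R z"
      by (auto simp: in_segment)
    show "w \<in> slit l r"
    proof (cases "u = 0 \<or> Im z = 0")
      case True
      have "l < (1 - u) * m + u * Re z \<and> (1 - u) * m + u * Re z < r" if "Im z = 0"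
      proof -
        have z: "l < Re z" "Re z < r" using that \<open>z \<in> slit l r\<close> by (auto simp: slit_def)
        have "0 < (1 - u) * (m - l) + u * (Re z - l)" "0 < (1 - u) * (r - m) + u * (r - Re z)"
          using u z m by (cases "u = 0"; simp add: add_nonneg_pos)+
        then show ?thesis by (simp add: algebra_simps)
      qed
      then show ?thesis using True m by (auto simp: w slit_def)
    next
      case False
      then show ?thesis by (auto simp: w slit_def)
    qed
  qed
  moreover have "complex_of_real m \<in> slit l r"
    using m by (auto simp: slit_def)
  ultimately show ?thesis unfolding starlike_def by blast
qed

lemma slit_primitive:
  assumes "l < r" "g holomorphic_on slit l r"
  obtains F where "F holomorphic_on slit l r"
    "\<And>z. z \<in> slit l r \<Longrightarrow> (F has_field_derivative g z) (at z)"
proof -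
  have "\<exists>F. \<forall>z\<in>slit l r. (F has_field_derivative g z) (at z)"
    using assms open_slit
    by (intro holomorphic_starlike_primitive[where k = "{}"] starlike_slit)
       (auto intro: holomorphic_on_imp_continuous_on holomorphic_on_imp_differentiable_at)
  then obtain F where "\<forall>z\<in>slit l r. (F has_field_derivative g z) (at z)" by blast
  moreover from this have "F holomorphic_on slit l r"
    by (intro holomorphic_onI) (auto simp: field_differentiable_def intro: has_field_derivative_at_within)
  ultimately show ?thesis using that by blast
qed

lemma isCont_slit:
  assumes "F holomorphic_on slit l r" "z \<in> slit l r"
  shows "isCont F z"
  using assms by (meson open_slit holomorphic_on_imp_continuous_on continuous_on_eq_continuous_at)

lemma tendsto_slit:
  assumes "F holomorphic_on slit l r" "z \<in> slit l r"
  shows "(F \<longlongrightarrow> F z) (at z within S)"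
  using isCont_slit[OF assms] unfolding isCont_def by (rule tendsto_within_subset) simp

text \<open>Both half-planes are treated at once: \<open>s = 1\<close> is the upper and \<open>s = -1\<close> the lower one.\<close>

definition hp :: "real \<Rightarrow> complex set" where
  "hp s = {z. s * Im z > 0}"

lemma hp_1: "hp 1 = {z. Im z > 0}" and hp_m1: "hp (-1) = {z. Im z < 0}"
  by (auto simp: hp_def)

lemma open_hp: "open (hp s)"
  unfolding hp_def by (intro open_Collect_less continuous_intros)

lemma convex_hp: "convex (hp s)"
proof -
  have "hp s = {z. inner (Complex 0 s) z > 0}" by (auto simp: hp_def inner_complex_def)
  then show ?thesis by (simp add: convex_halfspace_gt)
qed

lemma hp_subset_slit: "hp s \<subseteq> slit l r"
  by (auto simp: hp_def slit_def)

lemma at_within_hp_neq_bot: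
  assumes "s \<noteq> 0"
  shows "at (of_real x) within hp s \<noteq> bot"
proof -
  have "of_real x islimpt hp s"
  proof (rule islimptI)
    fix T assume "complex_of_real x \<in> T" "open T"
    then obtain e where e: "e > 0" "ball (of_real x) e \<subseteq> T" by (meson openE)
    define y where "y = complex_of_real x + \<i> * of_real (sgn s * (e / 2))"
    have "dist (of_real x) y = e / 2"
      using e assms by (simp add: y_def dist_norm norm_mult norm_divide abs_mult abs_sgn_eq)
    then have "y \<in> T" using e by (intro subsetD[OF e(2)]) simp
    moreover have "y \<in> hp s" using e assms by (simp add: y_def hp_def flip: mult.assoc abs_sgn)
    moreover have "y \<noteq> of_real x" using e assms by (simp add: y_def sgn_zero_iff)
    ultimately show "\<exists>y\<in>hp s. y \<in> T \<and> y \<noteq> of_real x" by blast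
  qed
  then show ?thesis by (simp add: trivial_limit_within)
qed

lemma DERIV_eq_on_hp:
  assumes "\<And>z. z \<in> hp s \<Longrightarrow> (F has_field_derivative g z) (at z)"
    and "\<And>z. z \<in> hp s \<Longrightarrow> (G has_field_derivative g z) (at z)"
  obtains c where "\<And>z. z \<in> hp s \<Longrightarrow> F z = G z + c"
proof -
  have "\<exists>c. \<forall>z\<in>hp s. F z - G z = c"
  proof (rule has_field_derivative_zero_constant)
    show "((\<lambda>z. F z - G z) has_field_derivative 0) (at z within hp s)" if "z \<in> hp s" for z
      using DERIV_diff[OF assms[OF that]] by (auto intro: has_field_derivative_at_within)
  qed (rule convex_hp)
  then obtain c where "\<And>z. z \<in> hp s \<Longrightarrow> F z = G z + c" by (metis diff_eq_eq add.commute)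
  then show ?thesis using that by blast
qed

text \<open>Residue conditions describe a coefficient only on punctured neighbourhoods.
  \<open>remove_sings\<close> repairs the value at the point without a choice of the local regular
  part \<open>h\<close>.\<close>

lemma analytic_removable:
  fixes F :: "complex \<Rightarrow> complex"
  assumes "h analytic_on {z0}" "\<forall>\<^sub>F z in at z0. F z = h z"
  shows "remove_sings F analytic_on {z0}" "remove_sings F z0 = h z0"
proof -
  have lim: "F \<midarrow>z0\<rightarrow> h z0"
    using analytic_at_imp_isCont[OF assms(1)] tendsto_cong[OF assms(2)] by (simp add: isCont_def)
  show "remove_sings F z0 = h z0" using lim by (rule remove_sings_eqI)
  have "isolated_singularity_at h z0"
    using assms(1) isolated_singularity_at_analytic by blast
  then have "isolated_singularity_at F z0"
    using isolated_singularity_at_cong[OF assms(2)] by simp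
  then show "remove_sings F analytic_on {z0}" using lim by (rule remove_sings_analytic_at)
qed

text \<open>\<open>U\<close> is a pair of primitives, one on each open half-plane, with no relation
  between them across the real axis. Each half of the circle contributes the difference of its
  one-sided boundary values. The circle starts at \<open>c + \<rho>\<close> and its first half lies
  in \<open>hp \<rho>\<close>, for either sign of \<open>\<rho>\<close>.\<close>

lemma circlepath_integral_halves:
  fixes U g :: "complex \<Rightarrow> complex"
  assumes "\<rho> \<noteq> 0"
    and der: "\<And>z. Im z \<noteq> 0 \<Longrightarrow> (U has_field_derivative g z) (at z)"
    and r1: "(U \<longlongrightarrow> r1) (at (of_real (c + \<rho>)) within hp \<rho>)"
    and r2: "(U \<longlongrightarrow> r2) (at (of_real (c + \<rho>)) within hp (-\<rho>))"
    and l1: "(U \<longlongrightarrow> l1) (at (of_real (c - \<rho>)) within hp \<rho>)"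
    and l2: "(U \<longlongrightarrow> l2) (at (of_real (c - \<rho>)) within hp (-\<rho>))"
  shows "(g has_contour_integral ((l1 - r1) + (r2 - l2))) (circlepath (of_real c) \<rho>)"
proof -
  define \<gamma> where "\<gamma> = circlepath (complex_of_real c) \<rho>"
  have \<gamma>_eq: "\<gamma> t = of_real c + of_real \<rho> * cis (2 * pi * t)" for t
    by (simp add: \<gamma>_def circlepath cis_conv_exp algebra_simps)
  have Im\<gamma>: "Im (\<gamma> t) = \<rho> * sin (2 * pi * t)" for t
    by (simp add: \<gamma>_eq)
  have \<rho>\<rho>: "\<rho> * \<rho> > 0" using \<open>\<rho> \<noteq> 0\<close> by (metis not_real_square_gt_zero)
  have cont: "continuous_on A \<gamma>" for A
    unfolding \<gamma>_eq[abs_def] by (intro continuous_intros)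
  have vd: "(\<gamma> has_vector_derivative vector_derivative \<gamma> (at t)) (at t)" for t
      unfolding \<gamma>_def by (metis has_vector_derivative_circlepath vector_derivative_circlepath)
  have half: "((\<lambda>t. g (\<gamma> t) * vector_derivative \<gamma> (at t)) has_integral (v2 - v1)) {t1..t2}"
    if t: "t1 < t2" and inside: "\<And>t. t1 < t \<Longrightarrow> t < t2 \<Longrightarrow> \<gamma> t \<in> hp s"
      and v1: "(U \<longlongrightarrow> v1) (at (\<gamma> t1) within hp s)" and v2: "(U \<longlongrightarrow> v2) (at (\<gamma> t2) within hp s)"
      and s: "s \<noteq> 0" and Im0: "Im (\<gamma> t1) = 0" "Im (\<gamma> t2) = 0"
    for t1 t2 s v1 v2
  proof -
    \<comment> \<open>\<open>E\<close> is \<open>U\<close> along the arc, completed by the one-sided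
      limits at its two real end points. The interior form of the fundamental theorem then asks for
      the derivative only where the arc is off the axis.\<close>
    define E where "E t = (if t = t1 then v1 else if t = t2 then v2 else U (\<gamma> t))" for t
    have "((\<lambda>t. g (\<gamma> t) * vector_derivative \<gamma> (at t)) has_integral (E t2 - E t1)) {t1..t2}"
    proof (rule fundamental_theorem_of_calculus_interior_strong[where S = "{}"])
      fix t assume t: "t \<in> {t1<..<t2} - {}"
      have "Im (\<gamma> t) \<noteq> 0" using inside[of t] t by (auto simp: hp_def)
      then have "((U \<circ> \<gamma>) has_vector_derivative g (\<gamma> t) * vector_derivative \<gamma> (at t)) (at t)"
        using field_vector_diff_chain_at[OF vd der] by (simp add: mult.commute)
      then show "(E has_vector_derivative g (\<gamma> t) * vector_derivative \<gamma> (at t)) (at t)"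
        by (rule has_vector_derivative_transform_within_open[where S = "{t1<..<t2}"])
           (use t in \<open>auto simp: E_def\<close>)
    next
      have tend: "((\<lambda>u. U (\<gamma> u)) \<longlongrightarrow> v) (at t within {t1<..<t2})"
        if "(U \<longlongrightarrow> v) (at (\<gamma> t) within hp s)" "Im (\<gamma> t) = 0" for t v
      proof (rule filterlim_compose[OF that(1)])
        show "filterlim \<gamma> (at (\<gamma> t) within hp s) (at t within {t1<..<t2})"
          unfolding filterlim_at
        proof
          have "(\<gamma> \<longlongrightarrow> \<gamma> t) (at t)"
            using cont[of UNIV] by (simp add: continuous_on_eq_continuous_at isCont_def)
          then show "(\<gamma> \<longlongrightarrow> \<gamma> t) (at t within {t1<..<t2})" by (rule tendsto_within_subset) simp
          have "\<gamma> u \<in> hp s \<and> \<gamma> u \<noteq> \<gamma> t" if "u \<in> {t1<..<t2}" for u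
            using inside[of u] that \<open>Im (\<gamma> t) = 0\<close> by (auto simp: hp_def)
          then show "\<forall>\<^sub>F u in at t within {t1<..<t2}. \<gamma> u \<in> hp s \<and> \<gamma> u \<noteq> \<gamma> t"
            by (auto simp: eventually_at_filter)
        qed
      qed
      have "continuous (at t within {t1..t2}) E" if "t \<in> {t1..t2}" for t
      proof (cases "t = t1 \<or> t = t2")
        case False
        then have "Im (\<gamma> t) \<noteq> 0" using inside[of t] that by (auto simp: hp_def)
        then have "isCont U (\<gamma> t)" using der DERIV_isCont by blast
        then have "isCont (\<lambda>t. U (\<gamma> t)) t"
          using cont[of UNIV] by (auto simp: continuous_on_eq_continuous_at intro: isCont_o2)
        moreover have "\<forall>\<^sub>F u in nhds t. E u = U (\<gamma> u)"
          using False that by (intro eventually_nhds_in_open[of "{t1<..<t2}", THEN eventually_mono])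
            (auto simp: E_def)
        ultimately have "isCont E t" using isCont_cong by fastforce
        then show ?thesis by (simp add: continuous_at_imp_continuous_at_within)
      next
        case True
        have "(E \<longlongrightarrow> E t) (at t within {t1<..<t2})"
        proof (rule Lim_transform_eventually)
          show "((\<lambda>u. U (\<gamma> u)) \<longlongrightarrow> E t) (at t within {t1<..<t2})"
            using True tend v1 v2 Im0 t by (auto simp: E_def)
          show "\<forall>\<^sub>F u in at t within {t1<..<t2}. U (\<gamma> u) = E u"
            by (auto simp: eventually_at_filter E_def)
        qed
        \<comment> \<open>At an end point the closed and the open interval have the same punctured
          neighbourhoods once the other end point is cut away.\<close>
        moreover have "at t within {t1..t2} = at t within {t1<..<t2}"
          using True t
          by (intro at_within_nhd[of _ "if t = t1 then {..<t2} else {t1<..}"]) auto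
        ultimately show ?thesis by (simp add: continuous_within)
      qed
      then show "continuous_on {t1..t2} E" by (simp add: continuous_on_eq_continuous_within)
    qed (use t in auto)
    moreover have "E t2 = v2" "E t1 = v1" using t by (auto simp: E_def)
    ultimately show ?thesis by simp
  qed
  have \<gamma>0: "\<gamma> 0 = of_real (c + \<rho>)" and \<gamma>1: "\<gamma> 1 = of_real (c + \<rho>)" and \<gamma>h: "\<gamma> (1/2) = of_real (c - \<rho>)"
    by (simp_all add: \<gamma>_eq)
  have "((\<lambda>t. g (\<gamma> t) * vector_derivative \<gamma> (at t)) has_integral (l1 - r1)) {0..1/2}"
  proof (rule half[where s = \<rho>])
    fix t :: real assume "0 < t" "t < 1/2"
    then have "sin (2 * pi * t) > 0" by (intro sin_gt_zero) auto
    then show "\<gamma> t \<in> hp \<rho>" using \<rho>\<rho>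
      by (simp add: hp_def Im\<gamma> flip: mult.assoc)
  qed (use assms \<gamma>0 \<gamma>h in auto)
  moreover have "((\<lambda>t. g (\<gamma> t) * vector_derivative \<gamma> (at t)) has_integral (r2 - l2)) {1/2..1}"
  proof (rule half[where s = "-\<rho>"])
    fix t :: real assume "1/2 < t" "t < 1"
    then have "sin (2 * pi * t) < 0" by (intro sin_lt_zero) auto
    then show "\<gamma> t \<in> hp (-\<rho>)" using \<rho>\<rho>
      by (simp add: hp_def Im\<gamma> mult_pos_neg flip: mult.assoc)
  qed (use assms \<gamma>1 \<gamma>h in auto)
  ultimately have "((\<lambda>t. g (\<gamma> t) * vector_derivative \<gamma> (at t)) has_integral (l1 - r1 + (r2 - l2))) {0..1}"
    by (rule has_integral_combine[rotated 2]) auto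
  then show ?thesis
    by (simp add: has_contour_integral flip: \<gamma>_def)
qed


section \<open>Branches of the root\<close>

text \<open>The principal root takes its value on the negative axis from above; hence the negative
  axis is included here, while \<open>csqrt_lower\<close> is stated on the open half-plane.\<close>

lemma csqrt_upper: "Im z \<ge> 0 \<Longrightarrow> Im z > 0 \<or> Re z \<le> 0 \<Longrightarrow> csqrt z = \<i> * csqrt (- z)"
  using csqrt_minus[of "- z"] by force

lemma csqrt_lower: "Im z < 0 \<Longrightarrow> csqrt z = - (\<i> * csqrt (- z))"
proof -
  assume "Im z < 0"
  then have "csqrt (- z) = \<i> * csqrt z" by (intro csqrt_minus) auto
  then have "\<i> * csqrt (- z) = (\<i> * \<i>) * csqrt z" by (simp only: mult.assoc)
  then show ?thesis by simp
qed

section \<open>The order of the end points, and branches of the root across one interval\<close>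

locale cut_system =
  fixes N :: nat and a b :: "nat \<Rightarrow> real"
  assumes N: "N \<ge> 1"
    and ab: "\<And>k. k \<in> {1..N} \<Longrightarrow> a k < b k"
    and ba: "\<And>k. k \<in> {1..<N} \<Longrightarrow> b k < a (k + 1)"
begin

lemma b_less_a: "1 \<le> i \<Longrightarrow> i < j \<Longrightarrow> j \<le> N \<Longrightarrow> b i < a j"
proof (induction j rule: less_induct)
  case (less j)
  show ?case
  proof (cases "j = i + 1")
    case True
    then show ?thesis using ba[of i] less.prems by auto
  next
    case False
    then have "b i < a (j - 1)" using less.prems by (intro less.IH) auto
    also have "\<dots> < b (j - 1)" using less.prems by (intro ab) auto
    also have "j - 1 \<in> {1..<N}" using less.prems by auto
    from ba[OF this] have "b (j - 1) < a j" using less.prems by simp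
    finally show ?thesis .
  qed
qed

definition ends :: "real set" where
  "ends = a ` {1..N} \<union> b ` {1..N}"

lemma ends_in_cut: "c \<in> ends \<Longrightarrow> \<exists>k\<in>{1..N}. c \<in> {a k..b k}"
  unfolding ends_def using ab by (fastforce intro: less_imp_le)

lemma finite_ends: "finite ends"
  by (simp add: ends_def)

lemma inj_a: "inj_on a {1..N}"
proof (rule linorder_inj_onI)
  fix i j assume "i < j" "i \<in> {1..N}" "j \<in> {1..N}"
  then show "a i \<noteq> a j" using ab[of i] b_less_a[of i j] by auto
qed auto

lemma inj_b: "inj_on b {1..N}"
proof (rule linorder_inj_onI)
  fix i j assume "i < j" "i \<in> {1..N}" "j \<in> {1..N}"
  then show "b i \<noteq> b j" using ab[of j] b_less_a[of i j] by auto
qed auto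

lemma a_neq_b: "i \<in> {1..N} \<Longrightarrow> j \<in> {1..N} \<Longrightarrow> a i \<noteq> b j"
  using ab[of i] ab[of j] b_less_a[of i j] b_less_a[of j i]
  by (cases i j rule: linorder_cases) auto

lemma prod_ends:
  fixes g :: "real \<Rightarrow> 'x::comm_monoid_mult"
  shows "(\<Prod>c\<in>ends. g c) = (\<Prod>k=1..N. g (a k) * g (b k))"
proof -
  have "(\<Prod>c\<in>ends. g c) = (\<Prod>c\<in>a ` {1..N}. g c) * (\<Prod>c\<in>b ` {1..N}. g c)"
    unfolding ends_def
  proof (rule prod.union_disjoint)
    show "a ` {1..N} \<inter> b ` {1..N} = {}" using a_neq_b by blast
  qed auto
  then show ?thesis by (simp add: prod.reindex[OF inj_a] prod.reindex[OF inj_b] prod.distrib del: One_nat_def)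
qed

lemma curve_poly_ends: "curve_poly N a b z = (\<Prod>c\<in>ends. z - of_real c)"
  by (simp add: curve_poly_def prod_ends)

lemma sheet_root_ends: "sheet_root N a b z = (\<Prod>c\<in>ends. csqrt (z - of_real c))"
  by (simp add: sheet_root_def prod_ends)

lemma curve_poly_eq_0_iff: "curve_poly N a b z = 0 \<longleftrightarrow> z \<in> of_real ` ends"
  by (auto simp: curve_poly_ends finite_ends)

definition seg :: "complex set" where
  "seg = of_real ` {a 1..b N}"

lemma ends_bounds:
  assumes "c \<in> ends"
  shows "a 1 \<le> c \<and> c \<le> b N"
proof -
  obtain k where k: "k \<in> {1..N}" "c = a k \<or> c = b k" using assms by (auto simp: ends_def)
  have "a 1 \<le> a k" using k ab[of 1] b_less_a[of 1 k] by (cases "k = 1") auto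
  moreover have "b k \<le> b N" using k ab[of N] b_less_a[of k N] by (cases "k = N") auto
  ultimately show ?thesis using k ab[of k] by auto
qed

lemma a1_bN: "a 1 < b N"
  using ends_bounds[of "b 1"] ab[of 1] N by (auto simp: ends_def)

lemma notin_seg_iff: "z \<notin> seg \<longleftrightarrow> Im z \<noteq> 0 \<or> Re z < a 1 \<or> b N < Re z"
  by (auto simp: seg_def image_iff complex_eq_iff not_le intro!: bexI[of _ "Re z"])

lemma closed_seg: "closed seg"
  unfolding seg_def by (intro compact_imp_closed compact_continuous_image continuous_intros) auto

lemma cuts_subset_seg: "cuts N a b \<subseteq> seg"
proof
  fix z assume "z \<in> cuts N a b"
  then obtain k x where k: "k \<in> {1..N}" "a k \<le> x" "x \<le> b k" "z = of_real x"
    by (auto simp: cuts_def)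
  have "a k \<in> ends" "b k \<in> ends" using k by (auto simp: ends_def)
  then show "z \<in> seg" using k ends_bounds[of "a k"] ends_bounds[of "b k"]
    by (auto simp: seg_def)
qed

lemma ends_cut: "k \<in> {1..N} \<Longrightarrow> {a k<..<b k} \<inter> ends = {}"
proof -
  have "\<not> (a k < a i \<and> a i < b k) \<and> \<not> (a k < b i \<and> b i < b k)" if "i \<in> {1..N}" "k \<in> {1..N}" for i
    using that ab[of k] ab[of i] b_less_a[of i k] b_less_a[of k i]
    by (cases i k rule: linorder_cases) auto
  then show "k \<in> {1..N} \<Longrightarrow> ?thesis" by (auto simp: ends_def)
qed

lemma ends_gap: "k \<in> {1..<N} \<Longrightarrow> {b k<..<a (k + 1)} \<inter> ends = {}"
proof -
  have "\<not> (b k < a i \<and> a i < a (k + 1)) \<and> \<not> (b k < b i \<and> b i < a (k + 1))"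
    if "i \<in> {1..N}" "k \<in> {1..<N}" for i
  proof (cases "i \<le> k")
    case True
    then have "a i < b k \<and> b i \<le> b k" using that ab[of i] ab[of k] b_less_a[of i k]
      by (cases "i = k") auto
    then show ?thesis by auto
  next
    case False
    then have "a (k + 1) \<le> a i \<and> a i < b i"
      using that ab[of i] ab[of "k+1"] b_less_a[of "k + 1" i] by (cases "i = k + 1") auto
    then show ?thesis by auto
  qed
  then show "k \<in> {1..<N} \<Longrightarrow> ?thesis" by (auto simp: ends_def)
qed

text \<open>The branch of the square root of the polynomial on the upper half-plane, continued
  analytically across the real axis through the point \<open>x0\<close>.\<close>

definition through_root :: "real \<Rightarrow> complex \<Rightarrow> complex" where
  "through_root x0 z = (\<Prod>c\<in>ends. if c < x0 then csqrt (z - of_real c) else \<i> * csqrt (of_real c - z))"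

text \<open>In the lower half-plane \<open>csqrt (z - c) = - (\<i> * csqrt (c - z))\<close>, so each
  factor of \<open>through_root\<close> whose \<open>c\<close> is not to the left of
  \<open>x0\<close> differs by -1 from the principal factor. The product of these signs compares the
  two branches below the axis.\<close>

definition crossing_sign :: "real \<Rightarrow> complex" where
  "crossing_sign x0 = (\<Prod>c\<in>ends. if c < x0 then 1 else -1)"

lemma through_root_sq: "(through_root x0 z)\<^sup>2 = curve_poly N a b z"
  unfolding through_root_def curve_poly_ends prod_power_distrib
  by (rule prod.cong) (auto simp: power_mult_distrib)

lemma sheet_root_sq: "(sheet_root N a b z)\<^sup>2 = curve_poly N a b z"
  unfolding sheet_root_ends curve_poly_ends prod_power_distrib
  by (rule prod.cong) auto

lemma through_root_upper: "Im z > 0 \<Longrightarrow> through_root x0 z = sheet_root N a b z"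
  unfolding through_root_def sheet_root_ends
  by (rule prod.cong) (auto simp: csqrt_upper[of "z - of_real _"])

lemma through_root_lower: "Im z < 0 \<Longrightarrow> through_root x0 z = crossing_sign x0 * sheet_root N a b z"
  unfolding through_root_def sheet_root_ends crossing_sign_def prod.distrib[symmetric]
  by (rule prod.cong) (auto simp: csqrt_lower[of "z - of_real _"])

text \<open>The principal roots take their real values from above, where the two branches coincide.
  As no end point separates \<open>x\<close> from \<open>x0\<close>, every end point to the right of
  \<open>x0\<close> is also to the right of \<open>x\<close>, and its factor can be rewritten by
  \<open>csqrt_upper\<close>.\<close>

lemma through_root_real:
  assumes "x \<notin> ends" "{min x0 x..max x0 x} \<inter> ends = {}"
  shows "through_root x0 (of_real x) = sheet_root N a b (of_real x)"
  unfolding through_root_def sheet_root_ends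
proof (rule prod.cong)
  fix c assume c: "c \<in> ends"
  show "(if c < x0 then csqrt (of_real x - of_real c) else \<i> * csqrt (of_real c - of_real x))
      = csqrt (of_real x - of_real c)"
  proof (cases "c < x0")
    case False
    have "x \<le> c"
    proof (rule ccontr)
      assume "\<not> x \<le> c"
      then have "c \<in> {min x0 x..max x0 x}" using False by auto
      then show False using assms c by blast
    qed
    then show ?thesis using False csqrt_upper[of "of_real x - of_real c"] by simp
  qed auto
qed auto

lemma through_root_holomorphic:
  assumes "l < x0" "x0 < r" "{l<..<r} \<inter> ends = {}"
  shows "through_root x0 holomorphic_on slit l r"
proof -
  have "(\<lambda>z. if c < x0 then csqrt (z - of_real c) else \<i> * csqrt (of_real c - z)) holomorphic_on slit l r"
    if c: "c \<in> ends" for c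
  proof -
    have "c \<notin> {l<..<r}" using assms c by blast
    then have "c \<le> l \<or> c \<ge> r" by auto
    then show ?thesis
      using assms(1,2)
      by (cases "c < x0")
         (auto intro!: holomorphic_intros simp: slit_def complex_nonpos_Reals_iff)
  qed
  then show ?thesis unfolding through_root_def by (intro holomorphic_intros) auto
qed

text \<open>A cut lying on one side of \<open>x\<close> contributes an even number of signs. Only
  the cut containing \<open>x\<close> is split, with \<open>b k\<close> alone on its right.\<close>

lemma crossing_sign_cut:
  assumes "k \<in> {1..N}" "a k < x" "x < b k"
  shows "crossing_sign x = -1"
proof -
  have "crossing_sign x = (\<Prod>i=1..N. if i = k then -1 else 1)"
    unfolding crossing_sign_def prod_ends
  proof (rule prod.cong)
    fix i assume i: "i \<in> {1..N}"
    then show "(if a i < x then 1 else - 1) * (if b i < x then 1 else - 1) = (if i = k then -1 else (1::complex))"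
      using assms ab[of i] b_less_a[of i k] b_less_a[of k i]
      by (cases i k rule: linorder_cases) auto
  qed auto
  then show ?thesis using assms by (simp add: prod.If_cases)
qed

lemma crossing_sign_gap:
  assumes "\<And>k. k \<in> {1..N} \<Longrightarrow> x \<notin> {a k..b k}"
  shows "crossing_sign x = 1"
  unfolding crossing_sign_def prod_ends
proof (rule prod.neutral, rule ballI)
  fix i assume i: "i \<in> {1..N}"
  then show "(if a i < x then 1 else - 1) * (if b i < x then 1 else - 1) = (1::complex)"
    using assms[of i] ab[of i] by auto
qed

lemma gap_notin_cut:
  assumes "k \<in> {1..<N}" "b k < x" "x < a (k + 1)" "i \<in> {1..N}"
  shows "x \<notin> {a i..b i}"
proof (cases "i \<le> k")
  case True
  then have "b i \<le> b k" using assms ab[of k] b_less_a[of i k] by (cases "i = k") auto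
  then show ?thesis using assms by auto
next
  case False
  then have "a (k + 1) \<le> a i"
    using assms ab[of "k + 1"] b_less_a[of "k + 1" i] by (cases "i = k + 1") auto
  then show ?thesis using assms by auto
qed

lemma outside_notin_cut:
  assumes "x < a 1 \<or> b N < x" "i \<in> {1..N}"
  shows "x \<notin> {a i..b i}"
  using assms ends_bounds[of "a i"] ends_bounds[of "b i"] by (auto simp: ends_def)

lemma nonreal_notin_cuts: "Im z \<noteq> 0 \<Longrightarrow> z \<notin> cuts N a b"
  by (auto simp: cuts_def)

lemma interval_free:
  assumes "\<And>x k. l < x \<Longrightarrow> x < r \<Longrightarrow> k \<in> {1..N} \<Longrightarrow> x \<notin> {a k..b k}"
  shows "{l<..<r} \<inter> ends = {}"
proof -
  have "x \<notin> ends" if "l < x" "x < r" for x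
    using ends_in_cut[of x] assms[OF that] by blast
  then show ?thesis by auto
qed

text \<open>Over a gap the sheets do not mix: the crossing sign is 1, so the continued branch is the
  principal one on the whole slit plane, the interval included.\<close>

lemma through_root_gap:
  assumes "l < x0" "x0 < r" "\<And>x k. l < x \<Longrightarrow> x < r \<Longrightarrow> k \<in> {1..N} \<Longrightarrow> x \<notin> {a k..b k}" "z \<in> slit l r"
  shows "through_root x0 z = sheet_root N a b z"
proof -
  have ends: "{l<..<r} \<inter> ends = {}" using interval_free assms(3) by blast
  consider "Im z > 0" | "Im z < 0" | "Im z = 0" by linarith
  then show ?thesis
  proof cases
    case 3
    then obtain x where x: "z = of_real x" "l < x" "x < r"
      using assms(4) by (intro that[of "Re z"]) (auto simp: complex_eq_iff slit_def)
    have sub: "{min x0 x..max x0 x} \<subseteq> {l<..<r}" using assms(1,2) x(2,3) by auto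
    show ?thesis unfolding x(1)
    proof (rule through_root_real)
      show "{min x0 x..max x0 x} \<inter> ends = {}" using sub ends by blast
      have "x \<in> {l<..<r}" using x(2,3) by simp
      then show "x \<notin> ends" using ends by blast
    qed
  next
    case 2
    have "crossing_sign x0 = 1" by (rule crossing_sign_gap) (rule assms(3)[OF assms(1,2)])
    then show ?thesis using 2 by (simp add: through_root_lower)
  qed (simp add: through_root_upper)
qed

lemma sheet_root_holomorphic_gap:
  assumes "l < r" "\<And>x k. l < x \<Longrightarrow> x < r \<Longrightarrow> k \<in> {1..N} \<Longrightarrow> x \<notin> {a k..b k}"
  shows "sheet_root N a b holomorphic_on slit l r"
proof -
  obtain x0 where x0: "l < x0" "x0 < r" using dense[OF assms(1)] by blast
  have "{l<..<r} \<inter> ends = {}" using interval_free assms(2) by blast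
  then have "through_root x0 holomorphic_on slit l r"
    using x0 by (intro through_root_holomorphic)
  then show ?thesis
    by (rule holomorphic_transform) (use through_root_gap[OF x0 assms(2)] in auto)
qed

text \<open>Holomorphy is local: every point off the segment lies in a slit plane whose real
  interval is beyond one end of the segment, and there the result for intervals free of cuts
  applies.\<close>

lemma sheet_root_holomorphic: "sheet_root N a b holomorphic_on - seg"
proof -
  have "sheet_root N a b field_differentiable (at z)" if zs: "z \<notin> seg" for z
  proof -
    obtain l r where "l < r" "l > b N \<or> r < a 1" "z \<in> slit l r"
    proof (cases "Im z = 0 \<and> Re z < a 1")
      case True
      then obtain r where "Re z < r" "r < a 1" using dense by blast
      then show ?thesis using True by (intro that[of "Re z - 1" r]) (auto simp: slit_def)
    next
      case False
      show ?thesis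
      proof (cases "Im z = 0")
        case True
        then have "b N < Re z" using False zs by (auto simp: notin_seg_iff)
        then obtain l where "l < Re z" "b N < l" using dense by blast
        then show ?thesis by (intro that[of l "Re z + 1"]) (auto simp: slit_def)
      qed (auto intro: that[of "b N + 1" "b N + 2"] simp: slit_def)
    qed
    then show ?thesis
      using holomorphic_on_imp_differentiable_at[OF sheet_root_holomorphic_gap open_slit]
        outside_notin_cut by auto
  qed
  then show ?thesis by (intro holomorphic_onI) (auto intro: field_differentiable_at_within)
qed

lemma sheet_root_eq_0: "z \<notin> of_real ` ends \<Longrightarrow> sheet_root N a b z \<noteq> 0"
  using sheet_root_sq[of z] curve_poly_eq_0_iff[of z] by auto

lemma through_root_eq_0: "z \<notin> of_real ` ends \<Longrightarrow> through_root x z \<noteq> 0"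
  using through_root_sq[of x z] curve_poly_eq_0_iff[of z] by auto

end


section \<open>Local forms of the differential\<close>

lemma Im_one_divide: "Im (1 / w) = 0 \<longleftrightarrow> Im w = 0" for w :: complex
  by (cases "Im w = 0") (auto simp: Im_divide sum_power2_eq_zero_iff)

locale cut_differential = cut_system +
  fixes \<nu> :: nat and P :: "nat \<Rightarrow> complex \<times> complex" and f :: "complex \<times> complex \<Rightarrow> complex"
  assumes \<nu>: "\<nu> = 1 \<or> \<nu> = 2"
    and P: "\<And>j. j \<in> {1..<N} \<Longrightarrow> P j \<in> gap_circle N a b j"
    and omega: "is_omega N a b \<nu> P f"
begin

abbreviation "sr \<equiv> sheet_root N a b"
abbreviation "presc \<equiv> prescribed_residue N a b \<nu> P"

definition pole :: "nat \<Rightarrow> real" where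
  "pole j = Re (fst (P j))"

lemma P_eq:
  assumes "j \<in> {1..<N}"
  shows "fst (P j) = of_real (pole j)" "b j \<le> pole j" "pole j \<le> a (j + 1)"
    "(snd (P j))\<^sup>2 = curve_poly N a b (of_real (pole j))"
  using P[OF assms] by (auto simp: gap_circle_def affine_curve_def pole_def)

lemma residue_at:
  assumes "w\<^sup>2 = curve_poly N a b z"
  shows "simple_residue_at N a b f (Aff (z, w)) (presc (Aff (z, w)))"
    "presc (Aff (z, w)) = 0 \<Longrightarrow> holomorphic_diff_at N a b f (Aff (z, w))"
proof -
  have "Aff (z, w) \<in> surface N a b" using assms by (auto simp: surface_def affine_curve_def)
  then show "simple_residue_at N a b f (Aff (z, w)) (presc (Aff (z, w)))"
    "presc (Aff (z, w)) = 0 \<Longrightarrow> holomorphic_diff_at N a b f (Aff (z, w))"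
    using omega unfolding is_omega_def by blast+
qed

lemma branch_points_iff: "Aff (z, w) \<in> branch_points N a b \<longleftrightarrow> z \<in> of_real ` ends \<and> w = 0"
  by (auto simp: branch_points_def ends_def)

lemma presc_Aff:
  "presc (Aff (z, w)) = (if z \<in> of_real ` ends \<and> w = 0 then - 1 / 2 else 0)
     + (\<Sum>j\<in>{1..<N}. if P j = (z, w) then 1 else 0)"
  unfolding prescribed_residue_def branch_points_iff by (simp add: eq_commute[of "(z, w)"])

lemma presc_off:
  assumes "z \<notin> of_real ` ends" "\<And>j. j \<in> {1..<N} \<Longrightarrow> z \<noteq> of_real (pole j)"
  shows "presc (Aff (z, w)) = 0"
proof -
  have "P j \<noteq> (z, w)" if "j \<in> {1..<N}" for j
    using assms(2)[OF that] P_eq(1)[OF that] by auto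
  then show ?thesis using assms(1) by (simp add: presc_Aff)
qed

lemma presc_off_seg: "z \<notin> seg \<Longrightarrow> presc (Aff (z, w)) = 0"
proof (rule presc_off)
  assume z: "z \<notin> seg"
  then show "z \<notin> of_real ` ends" using ends_bounds by (auto simp: seg_def)
  fix j assume j: "j \<in> {1..<N}"
  then have "b j \<in> ends" "a (j + 1) \<in> ends" by (auto simp: ends_def)
  then have "pole j \<in> {a 1..b N}"
    using P_eq(2,3)[OF j] ends_bounds[of "b j"] ends_bounds[of "a (j + 1)"] by auto
  then show "z \<noteq> of_real (pole j)" using z by (auto simp: seg_def)
qed

lemma pole_notin_cut:
  assumes "j \<in> {1..<N}" "k \<in> {1..N}"
  shows "pole j \<notin> {a k<..<b k}"
proof (cases "k \<le> j")
  case True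
  then have "b k \<le> b j" using assms ab[of j] b_less_a[of k j] by (cases "k = j") auto
  then show ?thesis using P_eq(2)[OF assms(1)] by auto
next
  case False
  then have "a (j + 1) \<le> a k"
    using assms ab[of "j + 1"] b_less_a[of "j + 1" k] by (cases "k = j + 1") auto
  then show ?thesis using P_eq(3)[OF assms(1)] by auto
qed

lemma presc_cut:
  assumes "k \<in> {1..N}" "a k < x" "x < b k"
  shows "presc (Aff (of_real x, w)) = 0"
proof (rule presc_off)
  show "complex_of_real x \<notin> of_real ` ends" using ends_cut[OF assms(1)] assms by auto
  show "complex_of_real x \<noteq> of_real (pole j)" if "j \<in> {1..<N}" for j
    using pole_notin_cut[OF that assms(1)] assms by auto
qed

lemma a_mono: "1 \<le> i \<Longrightarrow> i \<le> k \<Longrightarrow> k \<le> N \<Longrightarrow> a i \<le> a k"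
  using ab[of i] b_less_a[of i k] by (cases "i = k") auto

text \<open>A pole with another index lies in a closed gap that does not meet this open one, so
  \<open>P k\<close> is the only candidate; its second coordinate decides which of the two points
  over \<open>x\<close> it occupies.\<close>

lemma presc_gap:
  assumes "k \<in> {1..<N}" "b k < x" "x < a (k + 1)"
  shows "presc (Aff (of_real x, w)) = (if P k = (of_real x, w) then 1 else 0)"
proof -
  have "complex_of_real x \<notin> of_real ` ends" using ends_gap[OF assms(1)] assms by auto
  moreover have "P j \<noteq> (of_real x, w)" if j: "j \<in> {1..<N}" "j \<noteq> k" for j
  proof -
    have "a (j + 1) \<le> b k \<or> a (k + 1) \<le> b j"
      using j assms a_mono[of "j + 1" k] a_mono[of "k + 1" j] ab[of k] ab[of j]
      by (cases j k rule: linorder_cases) auto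
    then have "pole j \<noteq> x" using P_eq(2,3)[OF j(1)] assms by auto
    then show ?thesis using P_eq(1)[OF j(1)] by auto
  qed
  then have "(\<Sum>j\<in>{1..<N}. if P j = (of_real x, w) then 1 else 0) =
      (\<Sum>j\<in>{1..<N}. if j = k then (if P k = (of_real x, w) then 1 else 0) else (0::complex))"
    by (intro sum.cong) auto
  ultimately show ?thesis using assms(1) by (simp add: presc_Aff)
qed

text \<open>Off the branch points a holomorphic branch \<open>q\<close> of the root makes
  \<open>t \<mapsto> (z0 + t, q (z0 + t))\<close> a local parametrization with
  \<open>dz = dt\<close>. The conditions on the differential thereby become statements about
  \<open>f (z, q z)\<close> in the plane.\<close>

lemma local_form:
  assumes z0: "z0 \<notin> of_real ` ends" and q: "q analytic_on {z0}"
    and sq: "\<forall>\<^sub>F z in nhds z0. (q z)\<^sup>2 = curve_poly N a b z"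
  obtains h where "h analytic_on {z0}"
    "\<forall>\<^sub>F z in at z0. f (z, q z) = presc (Aff (z0, q z0)) / (z - z0) + h z"
    "presc (Aff (z0, q z0)) = 0 \<Longrightarrow> f (z0, q z0) = h z0"
proof -
  define R where "R = presc (Aff (z0, q z0))"
  define \<phi> where "\<phi> t = (z0 + t, q (z0 + t))" for t
  obtain e1 where e1: "e1 > 0" "q holomorphic_on ball z0 e1"
    using q by (auto simp: analytic_on_def)
  obtain e2 where e2: "e2 > 0" "\<And>z. z \<in> ball z0 e2 \<Longrightarrow> (q z)\<^sup>2 = curve_poly N a b z"
    using sq by (auto simp: eventually_nhds_metric dist_commute)
  define e where "e = min e1 e2"
  have sq0: "(q z0)\<^sup>2 = curve_poly N a b z0" using e2 by simp
  have fst\<phi>: "fst \<circ> \<phi> = (\<lambda>t. z0 + t)" by (auto simp: \<phi>_def)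
  have "(snd \<circ> \<phi>) holomorphic_on ball 0 e"
  proof -
    have "(q \<circ> (\<lambda>t. z0 + t)) holomorphic_on ball 0 e"
      by (rule holomorphic_on_compose_gen[OF _ e1(2)])
         (auto simp: e_def dist_norm intro!: holomorphic_intros)
    moreover have "snd \<circ> \<phi> = q \<circ> (\<lambda>t. z0 + t)" by (auto simp: \<phi>_def)
    ultimately show ?thesis by simp
  qed
  moreover have "\<phi> ` ball 0 e \<subseteq> affine_curve N a b"
    using e2(2) by (auto simp: \<phi>_def affine_curve_def e_def dist_norm)
  moreover have "e > 0" using e1 e2 by (simp add: e_def)
  ultimately have lp: "local_param N a b (Aff (z0, q z0)) \<phi>"
    by (auto simp: fst\<phi> intro!: exI[of _ e] holomorphic_intros inj_onI) (auto simp: \<phi>_def)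
  have pb: "pullback f \<phi> t = f (z0 + t, q (z0 + t))" for t
  proof -
    have "((\<lambda>t. z0 + t) has_field_derivative 1) (at t)" by (auto intro!: derivative_eq_intros)
    then have "deriv (fst \<circ> \<phi>) t = 1" unfolding fst\<phi> by (rule DERIV_imp_deriv)
    then show ?thesis by (simp add: pullback_def \<phi>_def)
  qed
  have nb: "Aff (z0, q z0) \<in> range Aff - branch_points N a b"
    using z0 by (simp add: branch_points_iff)
  \<comment> \<open>The residue condition says nothing about the value at the point itself; when the
    residue vanishes, this value comes from the holomorphy condition instead.\<close>
  have "\<exists>h. h analytic_on {0} \<and> (\<forall>\<^sub>F t in at 0. pullback f \<phi> t = R / t + h t)
      \<and> (R = 0 \<longrightarrow> pullback f \<phi> 0 = h 0)"
  proof (cases "R = 0")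
    case True
    then have "holomorphic_diff_at N a b f (Aff (z0, q z0))"
      using residue_at(2)[OF sq0] by (simp add: R_def)
    then show ?thesis
      using lp nb True unfolding holomorphic_diff_at_def by auto
  next
    case False
    then show ?thesis
      using residue_at(1)[OF sq0] lp unfolding simple_residue_at_def R_def by blast
  qed
  then obtain h where h: "h analytic_on {0}" "\<forall>\<^sub>F t in at 0. pullback f \<phi> t = R / t + h t"
    "R = 0 \<longrightarrow> pullback f \<phi> 0 = h 0" by blast
  show ?thesis
  proof (rule that)
    have "(h \<circ> (\<lambda>z. z - z0)) analytic_on {z0}"
      using h(1) by (intro analytic_on_compose) (auto intro!: analytic_intros)
    then show "(\<lambda>z. h (z - z0)) analytic_on {z0}" by (simp add: o_def)
    show "\<forall>\<^sub>F z in at z0. f (z, q z) = presc (Aff (z0, q z0)) / (z - z0) + h (z - z0)"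
      using h(2) unfolding eventually_at_to_0[of _ z0] by (simp add: pb R_def add.commute)
    show "presc (Aff (z0, q z0)) = 0 \<Longrightarrow> f (z0, q z0) = h (z0 - z0)"
      using h(3) by (simp add: pb R_def)
  qed
qed

lemma local_regular:
  assumes "z0 \<notin> of_real ` ends" "q analytic_on {z0}"
    "\<forall>\<^sub>F z in nhds z0. (q z)\<^sup>2 = curve_poly N a b z" "presc (Aff (z0, q z0)) = 0"
  shows "(\<lambda>z. f (z, q z)) analytic_on {z0}"
proof -
  obtain h where h: "h analytic_on {z0}"
    "\<forall>\<^sub>F z in at z0. f (z, q z) = presc (Aff (z0, q z0)) / (z - z0) + h z"
    "presc (Aff (z0, q z0)) = 0 \<Longrightarrow> f (z0, q z0) = h z0"
    using local_form[OF assms(1-3)] by blast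
  have "\<forall>\<^sub>F z in nhds z0. f (z, q z) = h z"
    using h(2,3) assms(4) by (auto simp: eventually_at_filter elim: eventually_mono)
  from analytic_at_cong[OF this refl] show ?thesis using h(1) by simp
qed

lemma interval_primitive:
  assumes lr: "l < p" "p < r" "{l<..<r} \<inter> ends = {}" and \<sigma>: "\<sigma> = 1 \<or> \<sigma> = -1"
    and res: "\<And>x. l < x \<Longrightarrow> x < r \<Longrightarrow>
      presc (Aff (of_real x, \<sigma> * through_root p (of_real x))) = (if x = p then m else 0)"
  obtains F where "F holomorphic_on slit l r"
    "\<And>z. Im z \<noteq> 0 \<Longrightarrow> (F has_field_derivative f (z, \<sigma> * through_root p z) - m / (z - of_real p)) (at z)"
proof -
  define q where "q z = \<sigma> * through_root p z" for z
  define k where "k z = f (z, q z) - m / (z - of_real p)" for z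
  have "q holomorphic_on slit l r"
    unfolding q_def by (intro holomorphic_intros through_root_holomorphic lr)
  then have qan: "q analytic_on {z}" if "z \<in> slit l r" for z
    using that open_slit analytic_on_subset[of q "slit l r" "{z}"] by (simp add: analytic_on_open)
  have sq: "(q z)\<^sup>2 = curve_poly N a b z" for z
    using \<sigma> by (auto simp: q_def through_root_sq power_mult_distrib)
  have ends: "z \<notin> of_real ` ends" if "z \<in> slit l r" for z
    using that lr(3) by (auto simp: slit_def)
  have kan: "k analytic_on {z}" if z: "z \<in> slit l r" "z \<noteq> of_real p" for z
  proof -
    have "presc (Aff (z, q z)) = 0"
    proof (cases "Im z = 0")
      case True
      then have "z = of_real (Re z)" by (simp add: complex_eq_iff)
      then show ?thesis using res[of "Re z"] z True by (auto simp: slit_def q_def)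
    next
      case False
      then show ?thesis by (intro presc_off_seg) (auto simp: seg_def)
    qed
    then have "(\<lambda>z. f (z, q z)) analytic_on {z}"
      using ends[OF z(1)] qan[OF z(1)] sq by (intro local_regular) auto
    then show ?thesis
      unfolding k_def using z by (intro analytic_intros) auto
  qed
  have p: "of_real p \<in> slit l r" using lr by (auto simp: slit_def)
  obtain h where h: "h analytic_on {of_real p}"
    "\<forall>\<^sub>F z in at (of_real p). f (z, q z) = presc (Aff (of_real p, q (of_real p))) / (z - of_real p) + h z"
    using local_form[OF ends[OF p] qan[OF p]] sq by auto
  have "\<forall>\<^sub>F z in at (of_real p). k z = h z"
    using h(2) res[of p] lr by (auto simp: k_def q_def elim: eventually_mono)
  then have "remove_sings k analytic_on {of_real p}" using h(1) by (intro analytic_removable)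
  moreover have "remove_sings k analytic_on {z}" if "z \<in> slit l r" "z \<noteq> of_real p" for z
    using kan[OF that] by (rule remove_sings_analytic_on)
  ultimately have "remove_sings k analytic_on slit l r"
    unfolding analytic_on_analytic_at[of _ "slit l r"] by blast
  then have "remove_sings k holomorphic_on slit l r" by (rule analytic_imp_holomorphic)
  then obtain F where F: "F holomorphic_on slit l r"
    "\<And>z. z \<in> slit l r \<Longrightarrow> (F has_field_derivative remove_sings k z) (at z)"
    using slit_primitive[of l r "remove_sings k"] lr by auto
  show ?thesis
  proof (rule that[OF F(1)])
    fix z :: complex assume "Im z \<noteq> 0"
    then have z: "z \<in> slit l r" "z \<noteq> of_real p" by (auto simp: slit_def)
    show "(F has_field_derivative f (z, \<sigma> * through_root p z) - m / (z - of_real p)) (at z)"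
      using F(2)[OF z(1)] kan[OF z] by (simp add: k_def q_def)
  qed
qed

lemma root_analytic_off_seg:
  assumes "z \<notin> seg"
  shows "(\<lambda>z. \<sigma> * sr z) analytic_on {z}"
proof -
  have "(\<lambda>z. \<sigma> * sr z) holomorphic_on - seg"
    by (intro holomorphic_intros sheet_root_holomorphic)
  then show ?thesis
    using closed_seg assms by (metis ComplI analytic_on_open analytic_on_subset empty_subsetI insert_subset open_Compl)
qed

lemma f_analytic_off_seg:
  assumes "z \<notin> seg" "\<sigma> = 1 \<or> \<sigma> = -1"
  shows "(\<lambda>z. f (z, \<sigma> * sr z)) analytic_on {z}"
proof (rule local_regular)
  show "z \<notin> of_real ` ends" using assms(1) ends_bounds by (auto simp: seg_def)
  show "\<forall>\<^sub>F z in nhds z. (\<sigma> * sr z)\<^sup>2 = curve_poly N a b z"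
    using assms(2) by (auto simp: power_mult_distrib sheet_root_sq)
qed (use assms in \<open>auto intro: presc_off_seg root_analytic_off_seg\<close>)

section \<open>The chart at infinity\<close>

definition mid :: real where "mid = (a 1 + b N) / 2"
text \<open>The segment from \<open>a 1\<close> to \<open>b N\<close> has centre \<open>mid\<close>
  and half-length \<open>1 / rad\<close>. The inversion \<open>t = 1 / (z - mid)\<close> therefore
  carries its complement, completed by infinity, to the slit plane over the interval from
  \<open>- rad\<close> to \<open>rad\<close>, with infinity at \<open>t = 0\<close>.\<close>

definition rad :: real where "rad = 2 / (b N - a 1)"

lemma rad_pos: "rad > 0"
  using a1_bN by (simp add: rad_def)

lemma inv_notin_seg:
  assumes "t \<in> slit (-rad) rad" "t \<noteq> 0"
  shows "of_real mid + 1 / t \<notin> seg"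
proof (cases "Im t = 0")
  case False
  then have "Im (1 / t) \<noteq> 0" by (simp add: Im_divide)
  then show ?thesis by (simp add: notin_seg_iff)
next
  case True
  then obtain x where x: "t = of_real x" by (metis complex_is_Real_iff Reals_cases)
  have "\<bar>x\<bar> < rad" "x \<noteq> 0" using assms by (auto simp: x slit_def)
  then have "(b N - a 1) / 2 < \<bar>1 / x\<bar>"
    using a1_bN by (simp add: rad_def field_simps)
  then have "mid + 1 / x < a 1 \<or> b N < mid + 1 / x"
    by (auto simp: mid_def abs_if field_simps split: if_splits)
  then show ?thesis by (auto simp: notin_seg_iff x Re_divide power2_eq_square)
qed

lemma inv_in_slit:
  assumes "z \<notin> seg"
  shows "1 / (z - of_real mid) \<in> slit (-rad) rad" "z \<noteq> of_real mid"
proof -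
  have "of_real mid \<in> seg" unfolding seg_def mid_def using a1_bN by (intro imageI) auto
  then show nz: "z \<noteq> of_real mid" using assms by auto
  show "1 / (z - of_real mid) \<in> slit (-rad) rad"
  proof (cases "Im z = 0")
    case False
    then have "Im (1 / (z - of_real mid)) \<noteq> 0" by (simp add: Im_one_divide)
    then show ?thesis by (simp add: slit_def)
  next
    case True
    then obtain x where x: "z = of_real x" by (metis complex_is_Real_iff Reals_cases)
    have "x < a 1 \<or> b N < x" using assms by (simp add: x notin_seg_iff)
    then have "(b N - a 1) / 2 < \<bar>x - mid\<bar>" "x \<noteq> mid"
      using a1_bN by (auto simp: mid_def abs_if field_simps)
    then have y: "\<bar>1 / (x - mid)\<bar> < rad"
      using a1_bN by (simp add: rad_def field_simps)
    define y where "y = 1 / (x - mid)"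
    have "1 / (z - of_real mid) = of_real y" by (simp add: x y_def)
    then show ?thesis using y by (auto simp: slit_def simp flip: y_def)
  qed
qed

text \<open>The factor \<open>- 1 / t^2\<close> is \<open>dz / dt\<close> for
  \<open>z = mid + 1 / t\<close>; this map parametrizes a neighbourhood of infinity on the sheet
  with sign \<open>\<sigma>\<close>.\<close>

lemma form_at_infinity:
  assumes j: "j = 1 \<or> j = 2" and \<sigma>: "\<sigma> = (if j = 1 then 1 else -1)"
  obtains h where "h analytic_on {0}"
    "\<forall>\<^sub>F t in at 0. - f (of_real mid + 1 / t, \<sigma> * sr (of_real mid + 1 / t)) / t\<^sup>2
        = (if j = 3 - \<nu> then 1 else 0) / t + h t"
proof -
  define \<phi> where "\<phi> t = (of_real mid + 1 / t, \<sigma> * sr (of_real mid + 1 / t))" for t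
  have sub: "ball 0 rad - {0} \<subseteq> slit (- rad) rad - {0}"
  proof
    fix t :: complex assume "t \<in> ball 0 rad - {0}"
    then show "t \<in> slit (- rad) rad - {0}" using abs_Re_le_cmod[of t] by (auto simp: slit_def)
  qed
  have fst\<phi>: "fst \<circ> \<phi> = (\<lambda>t. of_real mid + 1 / t)" by (auto simp: \<phi>_def)
  have "(snd \<circ> \<phi>) holomorphic_on ball 0 rad - {0}"
  proof -
    have "((\<lambda>z. \<sigma> * sr z) \<circ> (\<lambda>t. of_real mid + 1 / t)) holomorphic_on ball 0 rad - {0}"
      by (rule holomorphic_on_compose_gen[where t = "- seg"])
         (use sub inv_notin_seg in \<open>auto intro!: holomorphic_intros sheet_root_holomorphic\<close>)
    moreover have "snd \<circ> \<phi> = (\<lambda>z. \<sigma> * sr z) \<circ> (\<lambda>t. of_real mid + 1 / t)" by (auto simp: \<phi>_def)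
    ultimately show ?thesis by simp
  qed
  moreover have "\<phi> ` (ball 0 rad - {0}) \<subseteq> sheet N a b j"
  proof
    fix x assume "x \<in> \<phi> ` (ball 0 rad - {0})"
    then obtain t where t: "t \<in> ball 0 rad - {0}" "x = \<phi> t" by blast
    then have "of_real mid + 1 / t \<notin> seg" using sub inv_notin_seg by blast
    then have "of_real mid + 1 / t \<notin> cuts N a b" using cuts_subset_seg by blast
    then show "x \<in> sheet N a b j" using j \<sigma> t
      by (auto simp: sheet_def sheet_pt_def \<phi>_def)
  qed
  moreover have "filterlim (\<lambda>t. complex_of_real mid + 1 / t) at_infinity (at 0)"
    by (intro tendsto_add_filterlim_at_infinity[OF tendsto_const])
       (simp add: filterlim_inverse_at_infinity flip: inverse_eq_divide)
  ultimately have lp: "local_param N a b (Infty j) \<phi>"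
    using rad_pos unfolding local_param.simps fst\<phi>
    by (intro conjI exI[of _ rad]) (auto intro!: holomorphic_intros inj_onI simp: \<phi>_def)
  have pb: "pullback f \<phi> t = - f (of_real mid + 1 / t, \<sigma> * sr (of_real mid + 1 / t)) / t\<^sup>2"
    if "t \<noteq> 0" for t
  proof -
    have "((\<lambda>t. of_real mid + 1 / t) has_field_derivative - (1 / t\<^sup>2)) (at t)"
      using that by (auto intro!: derivative_eq_intros simp: power2_eq_square)
    then have "deriv (fst \<circ> \<phi>) t = - (1 / t\<^sup>2)" unfolding fst\<phi> by (rule DERIV_imp_deriv)
    then show ?thesis by (simp add: pullback_def \<phi>_def)
  qed
  have "presc (Infty j) = (if j = 3 - \<nu> then 1 else 0)"
    by (auto simp: prescribed_residue_def branch_points_def)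
  moreover have "simple_residue_at N a b f (Infty j) (presc (Infty j))"
    using omega j unfolding is_omega_def surface_def by auto
  ultimately have res: "simple_residue_at N a b f (Infty j) (if j = 3 - \<nu> then 1 else 0)" by simp
  obtain h where h: "h analytic_on {0}"
    "\<forall>\<^sub>F t in at 0. pullback f \<phi> t = (if j = 3 - \<nu> then 1 else 0) / t + h t"
    using res[unfolded simple_residue_at_def, rule_format, OF lp] by blast
  have "\<forall>\<^sub>F t in at 0. - f (of_real mid + 1 / t, \<sigma> * sr (of_real mid + 1 / t)) / t\<^sup>2
        = (if j = 3 - \<nu> then 1 else 0) / t + h t"
    using h(2) eventually_neq_at_within[of 0] by eventually_elim (simp add: pb)
  then show ?thesis using h(1) that by blast
qed

definition sg :: complex where "sg = (if \<nu> = 1 then 1 else -1)"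

lemma sg: "sg = 1 \<or> sg = -1"
  by (simp add: sg_def)

text \<open>The residue 1 at infinity sits on the other sheet, so on sheet \<open>\<nu>\<close> the
  pulled-back coefficient is regular at \<open>t = 0\<close>. Since the image of the inversion is
  star-shaped, one primitive lives on the whole complement of the segment, across both outer rays,
  and can be normalized at infinity.\<close>

lemma primitive_at_infinity:
  obtains H where "H holomorphic_on slit (-rad) rad" "H 0 = 0"
    "\<And>z. z \<notin> seg \<Longrightarrow> ((\<lambda>z. H (1 / (z - of_real mid))) has_field_derivative f (z, sg * sr z)) (at z)"
proof -
  define k where "k t = - f (of_real mid + 1 / t, sg * sr (of_real mid + 1 / t)) / t\<^sup>2" for t
  have \<nu>3: "\<nu> \<noteq> 3 - \<nu>" using \<nu> by auto
  obtain h where h: "h analytic_on {0}" "\<forall>\<^sub>F t in at 0. k t = h t"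
    using form_at_infinity[OF \<nu> sg_def] \<nu>3 unfolding k_def by auto
  have kan: "k analytic_on {t}" if t: "t \<in> slit (-rad) rad" "t \<noteq> 0" for t
  proof -
    have "((\<lambda>z. f (z, sg * sr z)) \<circ> (\<lambda>t. of_real mid + 1 / t)) analytic_on {t}"
    proof (rule analytic_on_compose)
      show "(\<lambda>t. of_real mid + 1 / t) analytic_on {t}"
        using t by (intro analytic_intros) auto
      show "(\<lambda>z. f (z, sg * sr z)) analytic_on (\<lambda>t. of_real mid + 1 / t) ` {t}"
        using f_analytic_off_seg[OF inv_notin_seg[OF t] sg] by simp
    qed
    then show ?thesis unfolding k_def o_def using t by (intro analytic_intros) auto
  qed
  have "remove_sings k analytic_on {0}" using h by (intro analytic_removable)
  moreover have "remove_sings k analytic_on {t}" if "t \<in> slit (-rad) rad" "t \<noteq> 0" for t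
    using kan[OF that] by (rule remove_sings_analytic_on)
  ultimately have "remove_sings k analytic_on slit (-rad) rad"
    unfolding analytic_on_analytic_at[of _ "slit (-rad) rad"] by blast
  then have "remove_sings k holomorphic_on slit (-rad) rad" by (rule analytic_imp_holomorphic)
  then obtain F where F: "F holomorphic_on slit (-rad) rad"
    "\<And>t. t \<in> slit (-rad) rad \<Longrightarrow> (F has_field_derivative remove_sings k t) (at t)"
    using slit_primitive[of "-rad" rad "remove_sings k"] rad_pos by auto
  show ?thesis
  proof (rule that[of "\<lambda>t. F t - F 0"])
    show "(\<lambda>t. F t - F 0) holomorphic_on slit (-rad) rad"
      by (intro holomorphic_intros F)
    fix z assume z: "z \<notin> seg"
    define t where "t = 1 / (z - of_real mid)"
    have t: "t \<in> slit (-rad) rad" "t \<noteq> 0" using inv_in_slit[OF z] by (auto simp: t_def)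
    have z_eq: "z = of_real mid + 1 / t" using inv_in_slit[OF z] by (simp add: t_def)
    have "(F has_field_derivative k t) (at t)"
      using F(2)[OF t(1)] kan[OF t] by simp
    moreover have "((\<lambda>z. 1 / (z - of_real mid)) has_field_derivative - (t\<^sup>2)) (at z)"
      using inv_in_slit[OF z]
      by (auto intro!: derivative_eq_intros simp: t_def power2_eq_square field_simps)
    ultimately have "((\<lambda>z. F (1 / (z - of_real mid))) has_field_derivative k t * - (t\<^sup>2)) (at z)"
      unfolding t_def by (rule DERIV_chain2)
    moreover have "k t * - (t\<^sup>2) = f (z, sg * sr z)"
      using t(2) by (simp add: k_def flip: z_eq)
    ultimately show "((\<lambda>z. F (1 / (z - of_real mid)) - F 0) has_field_derivative f (z, sg * sr z)) (at z)"
      by (auto intro!: derivative_eq_intros)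
  qed simp
qed

end


section \<open>Branch points\<close>

context cut_differential
begin

text \<open>Under \<open>z = c + t^2\<close> a root of the polynomial is
  \<open>t * branch_factor c t\<close>: the factor of \<open>c\<close> itself becomes
  \<open>t\<close>, the others depend on \<open>t^2\<close> only and do not vanish near 0. Hence
  \<open>t\<close> is a local parameter at the branch point, and \<open>t \<mapsto> - t\<close>
  exchanges the sheets.\<close>

definition branch_factor :: "real \<Rightarrow> complex \<Rightarrow> complex" where
  "branch_factor c t = (\<Prod>c'\<in>ends - {c}. if c' < c then csqrt (of_real (c - c') + t\<^sup>2)
     else \<i> * csqrt (of_real (c' - c) - t\<^sup>2))"

lemma branch_factor_minus [simp]: "branch_factor c (- t) = branch_factor c t"
  unfolding branch_factor_def power2_minus ..

lemma branch_factor_sq: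
  assumes "c \<in> ends"
  shows "(t * branch_factor c t)\<^sup>2 = curve_poly N a b (of_real c + t\<^sup>2)"
proof -
  have "(branch_factor c t)\<^sup>2 = (\<Prod>c'\<in>ends - {c}. of_real c + t\<^sup>2 - of_real c')"
    unfolding branch_factor_def prod_power_distrib
    by (rule prod.cong) (auto simp: power_mult_distrib)
  then show ?thesis
    unfolding curve_poly_ends
    by (subst prod.remove[OF finite_ends assms]) (simp add: power_mult_distrib)
qed

text \<open>For \<open>cmod t < d\<close> the point \<open>c + t^2\<close> is nearer to
  \<open>c\<close> than any other end point is. The bound \<open>d < 1\<close> is for the growth
  estimate, where it makes \<open>ln (cmod t)\<close> nonpositive.\<close>

lemma branch_disc:
  obtains d where "d > 0" "d < 1" "\<And>c'. c' \<in> ends - {c} \<Longrightarrow> \<bar>c' - c\<bar> > d\<^sup>2"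
proof -
  obtain e where e: "e > 0" "\<forall>x\<in>ends. x \<noteq> c \<longrightarrow> e \<le> dist c x"
    using finite_set_avoid[OF finite_ends, of c] by auto
  define d where "d = min (1 / 2) (e / 2)"
  have "d\<^sup>2 < e"
  proof -
    have "d * d \<le> 1 * d" by (intro mult_right_mono) (use e in \<open>auto simp: d_def\<close>)
    also have "\<dots> < e" using e by (auto simp: d_def)
    finally show ?thesis by (simp add: power2_eq_square)
  qed
  then show ?thesis
    using e by (intro that[of d]) (force simp: d_def dist_real_def)+
qed

context
  fixes c d :: real
  assumes c: "c \<in> ends" and d: "d > 0" "d < 1" "\<And>c'. c' \<in> ends - {c} \<Longrightarrow> \<bar>c' - c\<bar> > d\<^sup>2"
begin

lemma Re_sq_less: "t \<in> ball 0 d \<Longrightarrow> \<bar>Re (t\<^sup>2)\<bar> < d\<^sup>2"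
proof -
  assume "t \<in> ball 0 d"
  then have "(cmod t)\<^sup>2 < d\<^sup>2" by (intro power_strict_mono) auto
  then show ?thesis using abs_Re_le_cmod[of "t\<^sup>2"] by (simp add: norm_power)
qed

lemma branch_factor_holomorphic: "branch_factor c holomorphic_on ball 0 d"
proof -
  have "(\<lambda>t. if c' < c then csqrt (of_real (c - c') + t\<^sup>2) else \<i> * csqrt (of_real (c' - c) - t\<^sup>2))
      holomorphic_on ball 0 d" if c': "c' \<in> ends - {c}" for c'
  proof (cases "c' < c")
    case True
    have "of_real (c - c') + t\<^sup>2 \<notin> \<real>\<^sub>\<le>\<^sub>0" if "t \<in> ball 0 d" for t :: complex
      using Re_sq_less[OF that] d(3)[OF c'] True by (auto simp: complex_nonpos_Reals_iff)
    then show ?thesis using True by (auto intro!: holomorphic_intros)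
  next
    case False
    have "of_real (c' - c) - t\<^sup>2 \<notin> \<real>\<^sub>\<le>\<^sub>0" if "t \<in> ball 0 d" for t :: complex
      using Re_sq_less[OF that] d(3)[OF c'] False by (auto simp: complex_nonpos_Reals_iff)
    then show ?thesis using False by (auto intro!: holomorphic_intros)
  qed
  then show ?thesis unfolding branch_factor_def by (intro holomorphic_intros) auto
qed

lemma branch_factor_nonzero: "t \<in> ball 0 d \<Longrightarrow> branch_factor c t \<noteq> 0"
proof -
  assume t: "t \<in> ball 0 d"
  have "(if c' < c then csqrt (of_real (c - c') + t\<^sup>2) else \<i> * csqrt (of_real (c' - c) - t\<^sup>2)) \<noteq> 0"
    if c': "c' \<in> ends - {c}" for c'
  proof (cases "c' < c")
    case True
    then have "Re (of_real (c - c') + t\<^sup>2) > 0" using Re_sq_less[OF t] d(3)[OF c'] by auto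
    then have "of_real (c - c') + t\<^sup>2 \<noteq> 0" by (metis less_irrefl zero_complex.sel(1))
    then show ?thesis using True by simp
  next
    case False
    then have "Re (of_real (c' - c) - t\<^sup>2) > 0" using Re_sq_less[OF t] d(3)[OF c'] by auto
    then have "of_real (c' - c) - t\<^sup>2 \<noteq> 0" by (metis less_irrefl zero_complex.sel(1))
    then show ?thesis using False by simp
  qed
  then show ?thesis unfolding branch_factor_def using finite_ends by (auto simp: prod_zero_iff)
qed

text \<open>In the quadrant given by \<open>Re t > 0\<close> and \<open>s * Im t > 0\<close> the
  point \<open>c + t^2\<close> stays in one half-plane and \<open>csqrt (t^2) = t\<close>. The
  principal root and the root written in \<open>t\<close> then differ by a constant sign.\<close>

lemma sheet_root_branch:
  obtains \<tau> where "\<tau> = 1 \<or> \<tau> = -1"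
    "\<And>t. t \<in> ball 0 d \<Longrightarrow> Re t > 0 \<Longrightarrow> s * Im t > 0 \<Longrightarrow> sr (of_real c + t\<^sup>2) = \<tau> * (t * branch_factor c t)"
proof -
  \<comment> \<open>The crossing point lies just right of \<open>c\<close>, closer to it than every
    other end point. So \<open>through_root\<close> uses \<open>csqrt (z - c)\<close> for
    \<open>c\<close> and sorts the other end points as \<open>branch_factor\<close> does.\<close>
  define x0 where "x0 = c + d\<^sup>2"
  define q where "q = through_root x0"
  have q: "q (of_real c + t\<^sup>2) = t * branch_factor c t" if t: "t \<in> ball 0 d" "Re t > 0" for t
  proof -
    have 1: "csqrt (t\<^sup>2) = t" using t by (intro csqrt_square) auto
    have 2: "(if c' < x0 then csqrt (of_real c + t\<^sup>2 - of_real c') else \<i> * csqrt (of_real c' - (of_real c + t\<^sup>2)))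
      = (if c' < c then csqrt (of_real (c - c') + t\<^sup>2) else \<i> * csqrt (of_real (c' - c) - t\<^sup>2))"
      if c': "c' \<in> ends - {c}" for c'
    proof -
      have "c' < x0 \<longleftrightarrow> c' < c"
        using d(3)[OF c'] zero_le_power2[of d] unfolding x0_def by linarith
      then show ?thesis by (simp add: algebra_simps)
    qed
    have 3: "(\<Prod>c'\<in>ends - {c}. if c' < x0 then csqrt (of_real c + t\<^sup>2 - of_real c')
        else \<i> * csqrt (of_real c' - (of_real c + t\<^sup>2))) = branch_factor c t"
      unfolding branch_factor_def by (rule prod.cong[OF refl 2])
    have "c < x0" using d by (simp add: x0_def)
    have "q (of_real c + t\<^sup>2) = (if c < x0 then csqrt (of_real c + t\<^sup>2 - of_real c)
        else \<i> * csqrt (of_real c - (of_real c + t\<^sup>2))) * branch_factor c t"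
      unfolding q_def through_root_def 3[symmetric]
      by (rule prod.remove[OF finite_ends c])
    then show ?thesis using 1 \<open>c < x0\<close> by simp
  qed
  have cs: "crossing_sign x0 = 1 \<or> crossing_sign x0 = -1"
  proof -
    have "(crossing_sign x0)\<^sup>2 = 1"
      unfolding crossing_sign_def prod_power_distrib by (rule prod.neutral) auto
    then show ?thesis by (simp add: power2_eq_1_iff)
  qed
  have Im2: "Im (t\<^sup>2) = 2 * (Re t * Im t)" for t :: complex by (simp add: power2_eq_square)
  show ?thesis
  proof (rule that[of "if s > 0 then 1 else crossing_sign x0"])
    fix t assume t: "t \<in> ball 0 d" "Re t > 0" "s * Im t > 0"
    show "sr (of_real c + t\<^sup>2) = (if s > 0 then 1 else crossing_sign x0) * (t * branch_factor c t)"
    proof (cases "s > 0")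
      case True
      then have "Im (of_real c + t\<^sup>2) > 0" using t by (simp add: Im2 zero_less_mult_iff)
      then show ?thesis using q[OF t(1,2)] True by (simp add: q_def through_root_upper)
    next
      case False
      then have "Im (of_real c + t\<^sup>2) < 0" using t by (simp add: Im2 zero_less_mult_iff mult_less_0_iff)
      then have "q (of_real c + t\<^sup>2) = crossing_sign x0 * sr (of_real c + t\<^sup>2)"
        by (simp add: q_def through_root_lower)
      then show ?thesis using q[OF t(1,2)] False cs by auto
    qed
  qed (use cs in auto)
qed

lemma form_at_branch:
  obtains h where "h analytic_on {0}"
    "\<forall>\<^sub>F t in at 0. f (of_real c + t\<^sup>2, t * branch_factor c t) * (2 * t) = presc (Aff (of_real c, 0)) / t + h t"
proof -
  define \<phi> where "\<phi> t = (of_real c + t\<^sup>2, t * branch_factor c t)" for t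
  have fst\<phi>: "fst \<circ> \<phi> = (\<lambda>t. of_real c + t\<^sup>2)" by (auto simp: \<phi>_def)
  have snd\<phi>: "snd \<circ> \<phi> = (\<lambda>t. t * branch_factor c t)" by (auto simp: \<phi>_def)
  have "inj_on \<phi> (ball 0 d)"
  proof (rule inj_onI)
    fix t u assume tu: "t \<in> ball 0 d" "u \<in> ball 0 d" "\<phi> t = \<phi> u"
    then have "t = u \<or> t = - u" by (simp add: \<phi>_def power2_eq_iff)
    then show "t = u" using tu branch_factor_nonzero[OF tu(1)] by (auto simp: \<phi>_def)
  qed
  moreover have "\<phi> ` ball 0 d \<subseteq> affine_curve N a b"
    using branch_factor_sq[OF c] by (auto simp: \<phi>_def affine_curve_def)
  moreover have "\<phi> 0 = (of_real c, 0)" by (simp add: \<phi>_def)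
  ultimately have lp: "local_param N a b (Aff (of_real c, 0)) \<phi>"
    unfolding local_param.simps fst\<phi> snd\<phi> using d(1)
    by (intro conjI exI[of _ d]) (auto intro!: holomorphic_intros branch_factor_holomorphic)
  have "0 = curve_poly N a b (of_real c)" using c curve_poly_eq_0_iff by auto
  then have res: "simple_residue_at N a b f (Aff (of_real c, 0)) (presc (Aff (of_real c, 0)))"
    by (intro residue_at) simp
  obtain h where h: "h analytic_on {0}"
    "\<forall>\<^sub>F t in at 0. pullback f \<phi> t = presc (Aff (of_real c, 0)) / t + h t"
    using res[unfolded simple_residue_at_def, rule_format, OF lp] by blast
  have "pullback f \<phi> t = f (of_real c + t\<^sup>2, t * branch_factor c t) * (2 * t)" for t
  proof -
    have "((\<lambda>t. of_real c + t\<^sup>2) has_field_derivative 2 * t) (at t)"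
      by (auto intro!: derivative_eq_intros)
    then have "deriv (fst \<circ> \<phi>) t = 2 * t" unfolding fst\<phi> by (rule DERIV_imp_deriv)
    then show ?thesis by (simp add: pullback_def \<phi>_def)
  qed
  then show ?thesis using h that by simp
qed

end

text \<open>Over a branch point the curve has a single point, so each pole over \<open>c\<close> is
  that point and adds 1 to the prescribed -1/2. The extremal case -1/2 is the origin of the
  fourth-root singularity.\<close>

lemma presc_branch:
  assumes "c \<in> ends"
  obtains \<rho> where "presc (Aff (of_real c, 0)) = of_real \<rho>" "\<rho> \<ge> - 1 / 2"
    "\<rho> = - 1 / 2 + (\<Sum>j\<in>{1..<N}. if pole j = c then 1 else 0)"
proof -
  have "curve_poly N a b (of_real c) = 0" using assms curve_poly_eq_0_iff by blast
  then have P_iff: "P j = (of_real c, 0) \<longleftrightarrow> pole j = c" if "j \<in> {1..<N}" for j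
    using P_eq(1,4)[OF that] by (auto simp: prod_eq_iff)
  define n where "n = (\<Sum>j\<in>{1..<N}. if pole j = c then 1 else (0::real))"
  have "(\<Sum>j\<in>{1..<N}. if P j = (of_real c, 0) then 1 else (0::complex)) = of_real n"
    unfolding n_def of_real_sum by (rule sum.cong) (auto simp: P_iff)
  moreover have "n \<ge> 0" unfolding n_def by (rule sum_nonneg) auto
  ultimately show ?thesis
    using assms by (intro that[of "- 1 / 2 + n"]) (auto simp: presc_Aff n_def)
qed

text \<open>Since \<open>cmod t\<close> is the square root of \<open>cmod (z - c)\<close>, an
  exponent of at least -1/2 for \<open>t\<close> becomes -1/4 for \<open>z - c\<close>. The estimate
  treats one half-plane and one sheet at a time, because primitives on different half-planes differ
  by unrelated constants.\<close>

lemma exp_primitive_bound: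
  assumes c: "c \<in> ends" and s: "s = 1 \<or> s = -1" and \<sigma>: "\<sigma> = 1 \<or> \<sigma> = -1"
    and U: "\<And>z. z \<in> hp s \<Longrightarrow> (U has_field_derivative f (z, \<sigma> * sr z)) (at z)"
  obtains K e where "e > 0"
    "\<And>z. z \<in> hp s \<Longrightarrow> dist z (of_real c) < e \<Longrightarrow> cmod (exp (U z)) \<le> K * cmod (z - of_real c) powr (-1/4)"
proof -
  obtain d where d: "d > 0" "d < 1" "\<And>c'. c' \<in> ends - {c} \<Longrightarrow> \<bar>c' - c\<bar> > d\<^sup>2"
    using branch_disc[of c] by blast
  obtain \<rho> where \<rho>: "presc (Aff (of_real c, 0)) = of_real \<rho>" "\<rho> \<ge> - 1 / 2"
    using presc_branch[OF c] by blast
  obtain \<tau> where \<tau>: "\<tau> = 1 \<or> \<tau> = -1"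
    "\<And>t. t \<in> ball 0 d \<Longrightarrow> Re t > 0 \<Longrightarrow> s * Im t > 0 \<Longrightarrow> sr (of_real c + t\<^sup>2) = \<tau> * (t * branch_factor c t)"
    using sheet_root_branch[OF c d] by blast
  obtain h where h: "h analytic_on {0}"
    "\<forall>\<^sub>F t in at 0. f (of_real c + t\<^sup>2, t * branch_factor c t) * (2 * t) = of_real \<rho> / t + h t"
    using form_at_branch[OF c d] unfolding \<rho> by blast
  obtain e1 where e1: "e1 > 0" "h holomorphic_on ball 0 e1" using h(1) by (auto simp: analytic_on_def)
  obtain e2 where e2: "e2 > 0" "\<And>t. t \<in> ball 0 e2 \<Longrightarrow> t \<noteq> 0 \<Longrightarrow>
      f (of_real c + t\<^sup>2, t * branch_factor c t) * (2 * t) = of_real \<rho> / t + h t"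
    using h(2) by (auto simp: eventually_at dist_commute)
  define e where "e = min d (min e1 e2)"
  have e: "e > 0" "e \<le> d" "e \<le> e1" "e \<le> e2" "e < 1" using d e1 e2 by (auto simp: e_def)
  obtain H where H: "\<And>t. t \<in> ball 0 e \<Longrightarrow> (H has_field_derivative h t) (at t)"
  proof -
    have "h holomorphic_on ball 0 e" using e1 e by (auto intro: holomorphic_on_subset)
    then obtain H where "\<And>t. t \<in> ball 0 e \<Longrightarrow> (H has_field_derivative h t) (at t within ball 0 e)"
      using holomorphic_convex_primitive'[OF convex_ball open_ball] by metis
    then have "(H has_field_derivative h t) (at t)" if "t \<in> ball 0 e" for t
      using that by (metis at_within_open open_ball)
    then show ?thesis using that by blast
  qed
  \<comment> \<open>On the chosen sheet the point over \<open>c + t^2\<close> has parameter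
    \<open>t\<close> or \<open>- t\<close>, according to this product of signs. As
    \<open>branch_factor\<close> is even, replacing \<open>t\<close> by
    \<open>\<sigma>\<tau> * t\<close> accounts for the sheet.\<close>
  define \<sigma>\<tau> where "\<sigma>\<tau> = \<sigma> * \<tau>"
  have \<sigma>\<tau>: "\<sigma>\<tau> = 1 \<or> \<sigma>\<tau> = -1" using \<sigma> \<tau>(1) by (auto simp: \<sigma>\<tau>_def)
  \<comment> \<open>The principal root of \<open>z - c\<close> takes points of the half-plane near
    \<open>c\<close> into this region. It is convex, so a vanishing derivative makes
    \<open>W\<close> constant on it.\<close>
  define D where "D = {t. Re t > 0} \<inter> hp s \<inter> ball 0 e"
  have "convex D" unfolding D_def
    by (intro convex_Int convex_hp convex_ball) (simp add: convex_halfspace_Re_gt)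
  have Im2: "s * Im (t\<^sup>2) = 2 * Re t * (s * Im t)" for t :: complex by (simp add: power2_eq_square)
  have D_hp: "of_real c + t\<^sup>2 \<in> hp s" if "t \<in> D" for t
  proof -
    have "0 < 2 * Re t * (s * Im t)" using that by (auto simp: D_def hp_def intro!: mult_pos_pos)
    then show ?thesis unfolding Im2[symmetric] by (simp add: hp_def)
  qed
  define W where "W t = U (of_real c + t\<^sup>2) - (of_real \<rho> * ln t + H (\<sigma>\<tau> * t))" for t
  have "(W has_field_derivative 0) (at t)" if t: "t \<in> D" for t
  proof -
    have t': "t \<in> ball 0 d" "Re t > 0" "s * Im t > 0" "t \<in> ball 0 e" "t \<noteq> 0"
      using t e by (auto simp: D_def hp_def)
    have st: "\<sigma>\<tau> * t \<in> ball 0 e" "\<sigma>\<tau> * t \<noteq> 0" using t' \<sigma>\<tau> by auto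
    have "f (of_real c + t\<^sup>2, \<sigma> * sr (of_real c + t\<^sup>2)) * (2 * t)
        = \<sigma>\<tau> * (f (of_real c + (\<sigma>\<tau> * t)\<^sup>2, (\<sigma>\<tau> * t) * branch_factor c (\<sigma>\<tau> * t)) * (2 * (\<sigma>\<tau> * t)))"
    proof -
      have "\<sigma> * sr (of_real c + t\<^sup>2) = \<sigma>\<tau> * (t * branch_factor c t)"
        using \<tau>(2)[OF t'(1-3)] by (simp add: \<sigma>\<tau>_def mult.assoc)
      then show ?thesis using \<sigma>\<tau> by auto
    qed
    also have "\<dots> = \<sigma>\<tau> * (of_real \<rho> / (\<sigma>\<tau> * t) + h (\<sigma>\<tau> * t))"
      using e2(2)[of "\<sigma>\<tau> * t"] st e by (subst e2(2)) auto
    also have "\<dots> = of_real \<rho> / t + \<sigma>\<tau> * h (\<sigma>\<tau> * t)"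
      using \<sigma>\<tau> by auto
    finally have eq: "f (of_real c + t\<^sup>2, \<sigma> * sr (of_real c + t\<^sup>2)) * (2 * t)
        = of_real \<rho> / t + \<sigma>\<tau> * h (\<sigma>\<tau> * t)" .
    have "((\<lambda>t. of_real c + t\<^sup>2) has_field_derivative 2 * t) (at t)"
      by (auto intro!: derivative_eq_intros)
    from DERIV_chain2[OF U[OF D_hp[OF t]] this]
    have 1: "((\<lambda>t. U (of_real c + t\<^sup>2)) has_field_derivative of_real \<rho> / t + \<sigma>\<tau> * h (\<sigma>\<tau> * t)) (at t)"
      by (simp add: eq)
    have "((\<lambda>t. \<sigma>\<tau> * t) has_field_derivative \<sigma>\<tau>) (at t)"
      by (auto intro!: derivative_eq_intros)
    from DERIV_chain2[OF H[OF st(1)] this]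
    have 2: "((\<lambda>t. H (\<sigma>\<tau> * t)) has_field_derivative h (\<sigma>\<tau> * t) * \<sigma>\<tau>) (at t)" .
    have "t \<notin> \<real>\<^sub>\<le>\<^sub>0" using t' by (auto simp: complex_nonpos_Reals_iff)
    then have 3: "((\<lambda>t. of_real \<rho> * ln t) has_field_derivative of_real \<rho> / t) (at t)"
      by (auto intro!: derivative_eq_intros simp: divide_inverse mult.commute)
    show ?thesis unfolding W_def
      using DERIV_diff[OF 1 DERIV_add[OF 3 2]] by (simp add: algebra_simps)
  qed
  then have "\<exists>C. \<forall>t\<in>D. W t = C"
    using \<open>convex D\<close> by (intro has_field_derivative_zero_constant) (auto intro: has_field_derivative_at_within)
  then obtain C where C: "\<And>t. t \<in> D \<Longrightarrow> W t = C" by blast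
  have "continuous_on (cball 0 (e / 2)) H"
  proof (intro continuous_at_imp_continuous_on ballI)
    fix t :: complex assume "t \<in> cball 0 (e / 2)"
    then show "isCont H t" using e by (intro DERIV_isCont[OF H]) auto
  qed
  then have "bounded (H ` cball 0 (e / 2))"
    by (intro compact_imp_bounded compact_continuous_image) auto
  then obtain B where B: "\<And>t. t \<in> cball 0 (e / 2) \<Longrightarrow> cmod (H t) \<le> B"
    unfolding bounded_iff by blast
  show ?thesis
  proof (rule that[of "(e / 2)\<^sup>2" "exp (Re C + B)"])
    show "0 < (e / 2)\<^sup>2" using e by simp
    fix z assume z: "z \<in> hp s" "dist z (of_real c) < (e / 2)\<^sup>2"
    define t where "t = csqrt (z - of_real c)"
    have z_eq: "z = of_real c + t\<^sup>2" by (simp add: t_def)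
    have "(cmod t)\<^sup>2 = dist z (of_real c)" by (simp add: t_def dist_norm flip: norm_power)
    then have "(cmod t)\<^sup>2 < (e / 2)\<^sup>2" using z(2) by simp
    then have t_less: "cmod t < e / 2" using e by (intro power_less_imp_less_base[of "cmod t" 2 "e / 2"]) auto
    have Im_t: "2 * Re t * (s * Im t) > 0"
      using z(1) unfolding Im2[symmetric] z_eq by (simp add: hp_def)
    have "Re t \<ge> 0" unfolding t_def using csqrt_principal by (metis less_eq_real_def)
    then have tD: "t \<in> D"
      using Im_t t_less e by (auto simp: D_def hp_def zero_less_mult_iff)
    then have t0: "t \<noteq> 0" by (auto simp: D_def)
    have "U z = of_real \<rho> * ln t + H (\<sigma>\<tau> * t) + C" using C[OF tD] by (simp add: W_def z_eq algebra_simps)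
    then have "cmod (exp (U z)) = exp (\<rho> * ln (cmod t) + Re (H (\<sigma>\<tau> * t)) + Re C)"
      using t0 by (simp add: Re_exp)
    also have "\<dots> \<le> exp (- (1 / 2) * ln (cmod t) + B + Re C)"
    proof -
      \<comment> \<open>The radius is below 1; multiplying by the nonpositive logarithm turns the
        lower bound on \<open>\<rho>\<close> into an upper bound.\<close>
      have "ln (cmod t) \<le> 0" using t_less e t0 by simp
      then have "\<rho> * ln (cmod t) \<le> - (1 / 2) * ln (cmod t)"
        using \<rho>(2) by (intro mult_right_mono_neg) auto
      moreover have "\<sigma>\<tau> * t \<in> cball 0 (e / 2)" using t_less \<sigma>\<tau> by auto
      then have "Re (H (\<sigma>\<tau> * t)) \<le> B" using B complex_Re_le_cmod order_trans by blast
      ultimately show ?thesis by simp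
    qed
    also have "\<dots> = exp (Re C + B) * cmod t powr (- 1 / 2)"
      using t0 by (simp add: powr_def exp_add[symmetric])
    also have "cmod t powr (- 1 / 2) = cmod (z - of_real c) powr (- 1 / 4)"
    proof -
      have "cmod (z - of_real c) = cmod t powr 2" using t0 by (simp add: z_eq norm_power)
      then show ?thesis by (simp only: powr_powr) simp
    qed
    finally show "cmod (exp (U z)) \<le> exp (Re C + B) * cmod (z - of_real c) powr (- 1 / 4)" .
  qed
qed

end


section \<open>The sum over the two sheets\<close>

context cut_differential
begin

text \<open>The coefficient of the trace of the differential from the surface to the plane. The
  other choice of root only swaps the summands, so the jump of the root on the cuts does not
  show.\<close>

definition sheet_sum :: "complex \<Rightarrow> complex" where
  "sheet_sum z = f (z, sr z) + f (z, - sr z)"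

text \<open>The principal parts of the trace. At a branch point \<open>t\<close> and
  \<open>- t\<close> each contribute \<open>\<rho> / (2 * t^2)\<close>, which makes the residue in
  the plane equal to the residue \<open>\<rho>\<close> on the surface.\<close>

definition pole_sum :: "complex \<Rightarrow> complex" where
  "pole_sum z = - (1 / 2) * (\<Sum>c\<in>ends. 1 / (z - of_real c)) + (\<Sum>j\<in>{1..<N}. 1 / (z - of_real (pole j)))"

definition sing :: "complex set" where
  "sing = of_real ` ends \<union> (\<lambda>j. of_real (pole j)) ` {1..<N}"

lemma finite_sing: "finite sing"
  by (simp add: sing_def finite_ends)

lemma sheet_sum_eq:
  assumes "w\<^sup>2 = curve_poly N a b z"
  shows "sheet_sum z = f (z, w) + f (z, - w)"
proof -
  have "w = sr z \<or> w = - sr z" using assms sheet_root_sq[of z] by (metis power2_eq_iff)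
  then show ?thesis by (auto simp: sheet_sum_def)
qed

text \<open>The principal root jumps on the cuts; a branch continued through a suitable interval
  supplies a holomorphic root around every point that is not an end point.\<close>

lemma local_root:
  assumes "z0 \<notin> of_real ` ends"
  obtains x0 where "through_root x0 analytic_on {z0}"
proof -
  obtain l r x0 where lr: "l < x0" "x0 < r" "{l<..<r} \<inter> ends = {}" "z0 \<in> slit l r"
  proof (cases "Im z0 = 0")
    case False
    then show ?thesis using ends_bounds
      by (intro that[of "b N" "b N + 1" "b N + 2"]) (force simp: slit_def)+
  next
    case True
    define x where "x = Re z0"
    have z0: "z0 = of_real x" using True by (simp add: x_def complex_eq_iff)
    have x: "x \<notin> ends" using assms by (auto simp: z0)
    obtain e where e: "e > 0" "\<forall>c\<in>ends. c \<noteq> x \<longrightarrow> e \<le> dist x c"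
      using finite_set_avoid[OF finite_ends] by blast
    have "c \<notin> {x - e<..<x + e}" if "c \<in> ends" for c
      using e(2) x that by (force simp: dist_real_def)
    then show ?thesis using e(1)
      by (intro that[of "x - e" x "x + e"]) (auto simp: slit_def z0)
  qed
  have "through_root x0 analytic_on slit l r"
    using through_root_holomorphic[OF lr(1-3)] open_slit by (simp add: analytic_on_open)
  then show ?thesis using that lr(4) analytic_on_subset[of _ "slit l r" "{z0}"] by blast
qed

definition pole_rest :: "complex \<Rightarrow> complex \<Rightarrow> complex" where
  "pole_rest z0 z = - (1 / 2) * (\<Sum>c\<in>ends. if of_real c = z0 then 0 else 1 / (z - of_real c))
     + (\<Sum>j\<in>{1..<N}. if of_real (pole j) = z0 then 0 else 1 / (z - of_real (pole j)))"

lemma pole_rest_analytic: "pole_rest z0 analytic_on {z0}"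
proof -
  have "(\<lambda>z. if of_real x = z0 then 0 else 1 / (z - of_real x)) analytic_on {z0}" for x
    by (cases "of_real x = z0") (auto intro!: analytic_intros)
  then show ?thesis unfolding pole_rest_def by (intro analytic_intros) auto
qed

lemma pole_sum_split:
  "pole_sum z = (- (1 / 2) * (\<Sum>c\<in>ends. if of_real c = z0 then 1 else 0)
      + (\<Sum>j\<in>{1..<N}. if of_real (pole j) = z0 then 1 else 0)) / (z - z0) + pole_rest z0 z"
proof -
  have "1 / (z - of_real x) = (if of_real x = z0 then 1 else 0) / (z - z0)
      + (if of_real x = z0 then 0 else 1 / (z - of_real x))" for x by auto
  note split = this
  have "(\<Sum>c\<in>ends. 1 / (z - of_real c)) = (\<Sum>c\<in>ends. if of_real c = z0 then 1 else 0) / (z - z0)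
      + (\<Sum>c\<in>ends. if of_real c = z0 then 0 else 1 / (z - of_real c))"
    unfolding sum_divide_distrib sum.distrib[symmetric] by (rule sum.cong[OF refl split])
  moreover have "(\<Sum>j\<in>{1..<N}. 1 / (z - of_real (pole j)))
      = (\<Sum>j\<in>{1..<N}. if of_real (pole j) = z0 then 1 else 0) / (z - z0)
      + (\<Sum>j\<in>{1..<N}. if of_real (pole j) = z0 then 0 else 1 / (z - of_real (pole j)))"
    unfolding sum_divide_distrib sum.distrib[symmetric] by (rule sum.cong[OF refl split])
  moreover have "- (1 / 2) * (A / D + A') + (B / D + B') = (- (1 / 2) * A + B) / D + (- (1 / 2) * A' + B')"
    for A A' B B' D :: complex
    by (simp add: add_divide_distrib diff_divide_distrib algebra_simps)
  ultimately show ?thesis unfolding pole_sum_def pole_rest_def by simp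
qed

text \<open>Off the branch points the two roots differ, so each pole is exactly one of the two
  points over its projection. The residues of both sheets at \<open>z0\<close> thus add up to the
  number \<open>n\<close> of poles over it, which is the residue of \<open>pole_sum\<close>.\<close>

lemma sheet_sum_regular:
  assumes z0: "z0 \<notin> of_real ` ends"
  obtains h where "h analytic_on {z0}" "\<forall>\<^sub>F z in at z0. sheet_sum z - pole_sum z = h z"
    "z0 \<notin> sing \<Longrightarrow> sheet_sum z0 - pole_sum z0 = h z0"
proof -
  obtain x0 where q: "through_root x0 analytic_on {z0}" using local_root[OF z0] by blast
  define q where "q = through_root x0"
  define n where "n = (\<Sum>j\<in>{1..<N}. if of_real (pole j) = z0 then 1 else (0::complex))"
  have sq: "(q z)\<^sup>2 = curve_poly N a b z" "(- q z)\<^sup>2 = curve_poly N a b z" for z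
    by (auto simp: q_def through_root_sq)
  have an: "q analytic_on {z0}" "(\<lambda>z. - q z) analytic_on {z0}"
    using q by (auto simp: q_def intro!: analytic_intros)
  obtain h1 where h1: "h1 analytic_on {z0}"
    "\<forall>\<^sub>F z in at z0. f (z, q z) = presc (Aff (z0, q z0)) / (z - z0) + h1 z"
    "presc (Aff (z0, q z0)) = 0 \<Longrightarrow> f (z0, q z0) = h1 z0"
    using local_form[OF z0 an(1)] sq by auto
  obtain h2 where h2: "h2 analytic_on {z0}"
    "\<forall>\<^sub>F z in at z0. f (z, - q z) = presc (Aff (z0, - q z0)) / (z - z0) + h2 z"
    "presc (Aff (z0, - q z0)) = 0 \<Longrightarrow> f (z0, - q z0) = h2 z0"
    using local_form[OF z0 an(2)] sq by auto
  have q0: "q z0 \<noteq> 0" unfolding q_def by (rule through_root_eq_0[OF z0])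
  have "(if P j = (z0, q z0) then 1 else 0) + (if P j = (z0, - q z0) then 1 else 0)
      = (if of_real (pole j) = z0 then 1 else (0::complex))" if j: "j \<in> {1..<N}" for j
  proof (cases "of_real (pole j) = z0")
    case True
    then have "(snd (P j))\<^sup>2 = (q z0)\<^sup>2" using P_eq(4)[OF j] by (simp add: sq)
    then have "snd (P j) = q z0 \<or> snd (P j) = - q z0" by (simp add: power2_eq_iff)
    then show ?thesis using True P_eq(1)[OF j] q0 by (auto simp: prod_eq_iff)
  next
    case False
    then show ?thesis using P_eq(1)[OF j] by (auto simp: prod_eq_iff)
  qed
  then have R: "presc (Aff (z0, q z0)) + presc (Aff (z0, - q z0)) = n"
    using z0 by (simp add: presc_Aff n_def flip: sum.distrib)
  have ends0: "(\<Sum>c\<in>ends. if of_real c = z0 then 1 else (0::complex)) = 0"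
    using z0 by (intro sum.neutral) auto
  have split: "pole_sum z = n / (z - z0) + pole_rest z0 z" for z
    unfolding pole_sum_split[of z z0] ends0 n_def by simp
  show ?thesis
  proof (rule that[of "\<lambda>z. h1 z + h2 z - pole_rest z0 z"])
    show "(\<lambda>z. h1 z + h2 z - pole_rest z0 z) analytic_on {z0}"
      by (intro analytic_intros h1 h2 pole_rest_analytic)
    show "\<forall>\<^sub>F z in at z0. sheet_sum z - pole_sum z = h1 z + h2 z - pole_rest z0 z"
      using h1(2) h2(2)
    proof eventually_elim
      case (elim z)
      then have "sheet_sum z = n / (z - z0) + h1 z + h2 z"
        unfolding sheet_sum_eq[OF sq(1)] R[symmetric] by (simp add: add_divide_distrib)
      then show ?case by (simp add: split)
    qed
    assume ns: "z0 \<notin> sing"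
    then have "presc (Aff (z0, w)) = 0" for w
      by (intro presc_off) (auto simp: sing_def)
    then show "sheet_sum z0 - pole_sum z0 = h1 z0 + h2 z0 - pole_rest z0 z0"
      unfolding sheet_sum_eq[OF sq(1)[of z0]] split using h1(3) h2(3) by simp
  qed
qed

lemma sheet_sum_analytic:
  assumes "z0 \<notin> sing"
  shows "(\<lambda>z. sheet_sum z - pole_sum z) analytic_on {z0}"
proof -
  obtain h where h: "h analytic_on {z0}" "\<forall>\<^sub>F z in at z0. sheet_sum z - pole_sum z = h z"
    "sheet_sum z0 - pole_sum z0 = h z0"
    using sheet_sum_regular[of z0] assms by (auto simp: sing_def)
  then have "\<forall>\<^sub>F z in nhds z0. sheet_sum z - pole_sum z = h z"
    by (auto simp: eventually_at_filter elim: eventually_mono)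
  from analytic_at_cong[OF this refl] show ?thesis using h(1) by simp
qed

lemma filterlim_csqrt_at: "filterlim (\<lambda>z. csqrt (z - c)) (at 0) (at c)"
proof -
  have "((\<lambda>z. sqrt (cmod (z - c))) \<longlongrightarrow> sqrt (cmod (c - c))) (at c)"
    by (intro tendsto_intros)
  then have "((\<lambda>z. cmod (csqrt (z - c))) \<longlongrightarrow> 0) (at c)" by (simp add: norm_csqrt)
  then have "((\<lambda>z. csqrt (z - c)) \<longlongrightarrow> 0) (at c)" by (rule tendsto_norm_zero_cancel)
  then show ?thesis
    unfolding filterlim_at by (auto simp: eventually_at_filter)
qed

text \<open>Adding the local forms at \<open>t\<close> and \<open>- t\<close> leaves, besides the
  principal part, \<open>(h t - h (- t)) / (2 * t)\<close>, a difference quotient with limit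
  \<open>deriv h 0\<close>. The return from \<open>t\<close> to \<open>z\<close> uses only that
  \<open>csqrt (z - c)\<close> tends to 0.\<close>

lemma sheet_sum_branch:
  assumes c: "c \<in> ends"
  obtains L where "(\<lambda>z. sheet_sum z - pole_sum z) \<midarrow>(of_real c)\<rightarrow> L"
proof -
  obtain d where d: "d > 0" "d < 1" "\<And>c'. c' \<in> ends - {c} \<Longrightarrow> \<bar>c' - c\<bar> > d\<^sup>2"
    using branch_disc[of c] by blast
  obtain \<rho> where \<rho>: "presc (Aff (of_real c, 0)) = of_real \<rho>"
    "\<rho> = - 1 / 2 + (\<Sum>j\<in>{1..<N}. if pole j = c then 1 else 0)"
    using presc_branch[OF c] by blast
  obtain h where h: "h analytic_on {0}"
    "\<forall>\<^sub>F t in at 0. f (of_real c + t\<^sup>2, t * branch_factor c t) * (2 * t) = of_real \<rho> / t + h t"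
    using form_at_branch[OF c d] unfolding \<rho>(1) by blast
  have split: "pole_sum z = of_real \<rho> / (z - of_real c) + pole_rest (of_real c) z" for z
  proof -
    have "(\<Sum>x\<in>ends. if complex_of_real x = of_real c then 1 else 0) = (1::complex)"
      using c finite_ends by simp
    then have "- (1 / 2) * (\<Sum>x\<in>ends. if of_real x = complex_of_real c then 1 else 0)
      + (\<Sum>j\<in>{1..<N}. if of_real (pole j) = complex_of_real c then 1 else 0) = (of_real \<rho> :: complex)"
      by (simp add: \<rho>(2) if_distrib cong: if_cong)
    then show ?thesis unfolding pole_sum_split[of z "of_real c"] by simp
  qed
  have h': "(h has_field_derivative deriv h 0) (at 0)"
    using h(1) analytic_on_imp_differentiable_at DERIV_deriv_iff_field_differentiable by blast
  have "((\<lambda>t. h (- t)) has_field_derivative - deriv h 0) (at 0)"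
  proof -
    have "(uminus has_field_derivative -1) (at (0::complex))"
      by (auto intro!: derivative_eq_intros)
    then show ?thesis using DERIV_chain2[of h "deriv h 0" uminus 0 "-1"] h' by simp
  qed
  then have "((\<lambda>t. h t - h (- t)) has_field_derivative 2 * deriv h 0) (at 0)"
    using DERIV_diff[OF h'] by fastforce
  then have "(\<lambda>t. (h t - h (- t)) / t) \<midarrow>0\<rightarrow> 2 * deriv h 0"
    by (simp add: has_field_derivative_iff)
  from tendsto_mult_left[OF this, of "1 / 2"]
  have lim0: "(\<lambda>t. (h t - h (- t)) / (2 * t)) \<midarrow>0\<rightarrow> deriv h 0" by simp
  define g where "g z = (\<lambda>t. (h t - h (- t)) / (2 * t)) (csqrt (z - of_real c)) - pole_rest (of_real c) z" for z
  have "g \<midarrow>(of_real c)\<rightarrow> deriv h 0 - pole_rest (of_real c) (of_real c)"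
    unfolding g_def
    by (intro tendsto_diff filterlim_compose[OF lim0 filterlim_csqrt_at]
        analytic_at_imp_isCont[OF pole_rest_analytic, unfolded isCont_def])
  moreover have "\<forall>\<^sub>F z in at (of_real c). g z = sheet_sum z - pole_sum z"
  proof -
    have "\<forall>\<^sub>F t in at (0::complex). f (of_real c + (- t)\<^sup>2, - t * branch_factor c (- t)) * (2 * - t) = of_real \<rho> / - t + h (- t)"
    proof -
      have "filterlim uminus (at 0) (at (0::complex))"
        by (auto simp: filterlim_at eventually_at_filter intro!: tendsto_eq_intros)
      then show ?thesis using h(2) unfolding filterlim_iff by blast
    qed
    with h(2) have "\<forall>\<^sub>F t in at 0. t \<noteq> 0 \<longrightarrow>
        sheet_sum (of_real c + t\<^sup>2) - of_real \<rho> / t\<^sup>2 = (h t - h (- t)) / (2 * t)"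
    proof eventually_elim
      case (elim t)
      show ?case
      proof
        assume t: "t \<noteq> 0"
        have "sheet_sum (of_real c + t\<^sup>2) * (2 * t) = 2 * (of_real \<rho> / t) + (h t - h (- t))"
          using elim(1) arg_cong[OF elim(2), of uminus]
          by (simp add: sheet_sum_eq[OF branch_factor_sq[OF c]] ring_distribs)
        then show "sheet_sum (of_real c + t\<^sup>2) - of_real \<rho> / t\<^sup>2 = (h t - h (- t)) / (2 * t)"
        proof -
          have "S - R / t\<^sup>2 = Y / (2 * t)" if "S * (2 * t) = 2 * (R / t) + Y" for S R Y
          proof -
            have "S = (2 * (R / t) + Y) / (2 * t)" using that t by (simp add: eq_divide_eq)
            then show ?thesis by (simp add: add_divide_distrib power2_eq_square)
          qed
          then show "sheet_sum (of_real c + t\<^sup>2) * (2 * t) = 2 * (of_real \<rho> / t) + (h t - h (- t)) \<Longrightarrow> ?thesis" .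
        qed
      qed
    qed
    then have "\<forall>\<^sub>F z in at (of_real c). csqrt (z - of_real c) \<noteq> 0 \<longrightarrow>
        sheet_sum (of_real c + (csqrt (z - of_real c))\<^sup>2) - of_real \<rho> / (csqrt (z - of_real c))\<^sup>2
          = (h (csqrt (z - of_real c)) - h (- csqrt (z - of_real c))) / (2 * csqrt (z - of_real c))"
      using filterlim_csqrt_at[of "of_real c"] unfolding filterlim_iff by blast
    then show ?thesis
      using eventually_neq_at_within[of "of_real c"]
      by eventually_elim (auto simp: g_def split)
  qed
  ultimately have "(\<lambda>z. sheet_sum z - pole_sum z) \<midarrow>(of_real c)\<rightarrow> deriv h 0 - pole_rest (of_real c) (of_real c)"
    by (rule Lim_transform_eventually)
  then show ?thesis using that by blast
qed

lemma sheet_sum_removable: "remove_sings (\<lambda>z. sheet_sum z - pole_sum z) analytic_on {z0}"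
proof (cases "z0 \<in> of_real ` ends")
  case False
  then show ?thesis using sheet_sum_regular analytic_removable(1) by metis
next
  case True
  then obtain c where c: "c \<in> ends" "z0 = of_real c" by blast
  obtain e where e: "e > 0" "\<forall>x\<in>sing. x \<noteq> z0 \<longrightarrow> e \<le> dist z0 x"
    using finite_set_avoid[OF finite_sing] by blast
  have "(\<lambda>z. sheet_sum z - pole_sum z) analytic_on ball z0 e - {z0}"
    unfolding analytic_on_analytic_at[of _ "ball z0 e - {z0}"]
    using e by (auto intro!: sheet_sum_analytic)
  then have "isolated_singularity_at (\<lambda>z. sheet_sum z - pole_sum z) z0"
    using e(1) unfolding isolated_singularity_at_def by blast
  then show ?thesis
    using sheet_sum_branch[OF c(1)] c(2) remove_sings_analytic_at by metis
qed

lemma filterlim_inv_mid: "filterlim (\<lambda>z. 1 / (z - complex_of_real mid)) (at 0) at_infinity"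
proof -
  have "filterlim (\<lambda>z. - of_real mid + z) at_infinity (at_infinity :: complex filter)"
    by (intro tendsto_add_filterlim_at_infinity[OF tendsto_const] filterlim_ident)
  then have "filterlim (\<lambda>z. z - of_real mid) at_infinity (at_infinity :: complex filter)" by simp
  then show ?thesis
    by (simp add: filterlim_inverse_at_iff flip: inverse_eq_divide)
qed

text \<open>Solved for the coefficient, the form at infinity reads
  \<open>- R * t - t^2 * h t\<close>; even with a simple pole there, the coefficient with respect to
  \<open>dz\<close> tends to 0. This feeds Liouville's theorem for the trace.\<close>

lemma f_at_infinity:
  assumes "\<sigma> = 1 \<or> \<sigma> = -1"
  shows "((\<lambda>z. f (z, \<sigma> * sr z)) \<longlongrightarrow> 0) at_infinity"
proof -
  obtain j :: nat where j: "j = 1 \<or> j = 2" "\<sigma> = (if j = 1 then 1 else -1)"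
    using assms that[of 1] that[of 2] by auto
  define R where "R = (if j = 3 - \<nu> then 1 else (0::complex))"
  obtain h where h: "h analytic_on {0}"
    "\<forall>\<^sub>F t in at 0. - f (of_real mid + 1 / t, \<sigma> * sr (of_real mid + 1 / t)) / t\<^sup>2 = R / t + h t"
    using form_at_infinity[OF j] unfolding R_def by blast
  have "(\<lambda>t. - (R * t) - t\<^sup>2 * h t) \<midarrow>0\<rightarrow> - (R * 0) - 0\<^sup>2 * h 0"
    using analytic_at_imp_isCont[OF h(1)] by (intro tendsto_intros) (simp add: isCont_def)
  then have lim: "(\<lambda>t. - (R * t) - t\<^sup>2 * h t) \<midarrow>0\<rightarrow> 0" by simp
  have "\<forall>\<^sub>F t in at 0. - (R * t) - t\<^sup>2 * h t = f (of_real mid + 1 / t, \<sigma> * sr (of_real mid + 1 / t))"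
    using h(2) eventually_neq_at_within[of 0]
  proof eventually_elim
    case (elim t)
    have "X = - (t\<^sup>2 * Y)" if "- X / t\<^sup>2 = Y" for X Y
      using that elim(2) by auto
    from this[OF elim(1)] show ?case using elim(2) by (simp add: algebra_simps power2_eq_square)
  qed
  then have "(\<lambda>t. f (of_real mid + 1 / t, \<sigma> * sr (of_real mid + 1 / t))) \<midarrow>0\<rightarrow> 0"
    using lim by (rule Lim_transform_eventually[rotated])
  from filterlim_compose[OF this filterlim_inv_mid] show ?thesis by simp
qed

lemma sheet_sum_eq_pole_sum:
  assumes "z \<notin> sing"
  shows "sheet_sum z = pole_sum z"
proof -
  let ?E = "\<lambda>z. sheet_sum z - pole_sum z"
  have "remove_sings ?E holomorphic_on UNIV"
    using sheet_sum_removable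
    by (intro analytic_imp_holomorphic) (simp add: analytic_on_analytic_at[of _ UNIV])
  moreover have "(remove_sings ?E \<longlongrightarrow> 0) at_infinity"
  proof (rule Lim_transform_eventually)
    have inv: "((\<lambda>z. 1 / (z - c)) \<longlongrightarrow> 0) at_infinity" for c :: complex
    proof -
      have "filterlim (\<lambda>z. - c + z) at_infinity (at_infinity :: complex filter)"
        by (intro tendsto_add_filterlim_at_infinity[OF tendsto_const] filterlim_ident)
      then have "filterlim (\<lambda>z. z - c) at_infinity (at_infinity :: complex filter)" by simp
      then show ?thesis using tendsto_inverse_0 filterlim_compose by (fastforce simp: inverse_eq_divide)
    qed
    have "(pole_sum \<longlongrightarrow> - (1 / 2) * (\<Sum>c\<in>ends. 0) + (\<Sum>j\<in>{1..<N}. 0)) at_infinity"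
      unfolding pole_sum_def by (intro tendsto_intros inv)
    moreover have "(sheet_sum \<longlongrightarrow> 0 + 0) at_infinity"
      unfolding sheet_sum_def
      using tendsto_add[OF f_at_infinity[of 1] f_at_infinity[of "-1"]] by simp
    ultimately show "(?E \<longlongrightarrow> 0) at_infinity" using tendsto_diff by fastforce
    have "finite sing" by (rule finite_sing)
    then have "bounded sing" by (rule finite_imp_bounded)
    then obtain B where B: "\<And>x. x \<in> sing \<Longrightarrow> cmod x \<le> B" by (auto simp: bounded_iff)
    have "?E w = remove_sings ?E w" if "w \<notin> sing" for w
      using sheet_sum_analytic[OF that] by simp
    then show "\<forall>\<^sub>F w in at_infinity. ?E w = remove_sings ?E w"
      unfolding eventually_at_infinity using B by (intro exI[of _ "B + 1"]) fastforce
  qed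
  ultimately have "remove_sings ?E z = 0" by (rule Liouville_weak_0)
  then show ?thesis using sheet_sum_analytic[OF assms] by simp
qed

end


section \<open>Primitives and the A-periods\<close>

lemma hp_scale: "\<rho> > 0 \<Longrightarrow> hp \<rho> = hp 1" "\<rho> > 0 \<Longrightarrow> hp (- \<rho>) = hp (-1)"
  by (auto simp: hp_def zero_less_mult_iff mult_less_0_iff)

text \<open>A negative radius starts the parametrization at the left crossing point, where an
  A-cycle begins. Moving the base point by half a turn returns to the usual circle.\<close>

lemma shiftpath_circlepath: "shiftpath (1 / 2) (circlepath z (- r)) = circlepath z r"
proof
  fix x :: real
  have "exp (2 * of_real pi * \<i> * (1 / 2 + of_real x)) = - exp (2 * of_real pi * \<i> * of_real x)"
    by (simp add: ring_distribs exp_add)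
  moreover have "exp (2 * of_real pi * \<i> * (1 / 2 + of_real x - 1)) = - exp (2 * of_real pi * \<i> * of_real x)"
    by (simp add: ring_distribs exp_add exp_diff)
  ultimately show "shiftpath (1 / 2) (circlepath z (- r)) x = circlepath z r x"
    by (simp add: shiftpath_def circlepath add.commute)
qed

context cut_differential
begin

lemma sum_ends:
  fixes g :: "real \<Rightarrow> 'x::comm_monoid_add"
  shows "(\<Sum>c\<in>ends. g c) = (\<Sum>k=1..N. g (a k) + g (b k))"
proof -
  have "(\<Sum>c\<in>ends. g c) = (\<Sum>c\<in>a ` {1..N}. g c) + (\<Sum>c\<in>b ` {1..N}. g c)"
    unfolding ends_def
  proof (rule sum.union_disjoint)
    show "a ` {1..N} \<inter> b ` {1..N} = {}" using a_neq_b by blast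
  qed auto
  then show ?thesis
    by (simp add: sum.reindex[OF inj_a] sum.reindex[OF inj_b] sum.distrib del: One_nat_def)
qed

definition cut_mid :: "nat \<Rightarrow> real" where
  "cut_mid k = (a k + b k) / 2"

lemma cut_mid: "k \<in> {1..N} \<Longrightarrow> a k < cut_mid k \<and> cut_mid k < b k"
  using ab[of k] by (auto simp: cut_mid_def)

text \<open>Poles lie over closed gaps, so an open cut carries none and the residue is taken as 0.
  The crossing sign is -1, which is why the primitive belongs to opposite roots above and
  below.\<close>

lemma cut_primitive:
  assumes k: "k \<in> {1..N}" and \<sigma>: "\<sigma> = 1 \<or> \<sigma> = -1"
  obtains F where "F holomorphic_on slit (a k) (b k)"
    "\<And>z. z \<in> hp 1 \<Longrightarrow> (F has_field_derivative f (z, \<sigma> * sr z)) (at z)"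
    "\<And>z. z \<in> hp (-1) \<Longrightarrow> (F has_field_derivative f (z, - \<sigma> * sr z)) (at z)"
proof -
  have res: "presc (Aff (of_real x, \<sigma> * through_root (cut_mid k) (of_real x))) = (if x = cut_mid k then 0 else 0)"
    if "a k < x" "x < b k" for x using presc_cut[OF k that] by simp
  obtain F where F: "F holomorphic_on slit (a k) (b k)"
    "\<And>z. Im z \<noteq> 0 \<Longrightarrow> (F has_field_derivative f (z, \<sigma> * through_root (cut_mid k) z) - 0 / (z - of_real (cut_mid k))) (at z)"
    using interval_primitive[OF _ _ ends_cut[OF k] \<sigma> res] cut_mid[OF k] by blast
  show ?thesis
  proof (rule that[OF F(1)])
    show "(F has_field_derivative f (z, \<sigma> * sr z)) (at z)" if "z \<in> hp 1" for z
      using F(2)[of z] that by (simp add: hp_def through_root_upper)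
    show "(F has_field_derivative f (z, - \<sigma> * sr z)) (at z)" if "z \<in> hp (-1)" for z
      using F(2)[of z] that crossing_sign_cut[OF k] cut_mid[OF k] by (simp add: hp_def through_root_lower)
  qed
qed

text \<open>The root on the upper half-plane of the first sheet, continued through the cuts to the lower
  half-plane of the second sheet.  On the cuts the value is right because \<open>csqrt\<close> takes its
  boundary value from above.\<close>

definition glued_root :: "complex \<Rightarrow> complex" where
  "glued_root z = (if Im z \<ge> 0 then sr z else - sr z)"

lemma glued_root_sq: "(glued_root z)\<^sup>2 = curve_poly N a b z"
  by (simp add: glued_root_def sheet_root_sq)

lemma glued_root_cut:
  assumes k: "k \<in> {1..N}" and z: "z \<in> slit (a k) (b k)"
  shows "glued_root z = through_root (cut_mid k) z"
proof -
  consider "Im z > 0" | "Im z < 0" | "Im z = 0" by linarith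
  then show ?thesis
  proof cases
    case 2
    then show ?thesis using crossing_sign_cut[OF k] cut_mid[OF k]
      by (simp add: glued_root_def through_root_lower)
  next
    case 3
    then obtain x where x: "z = of_real x" "a k < x" "x < b k"
      using z by (intro that[of "Re z"]) (auto simp: complex_eq_iff slit_def)
    have sub: "{min (cut_mid k) x..max (cut_mid k) x} \<subseteq> {a k<..<b k}"
      using cut_mid[OF k] x(2,3) by auto
    have "through_root (cut_mid k) (of_real x) = sr (of_real x)"
    proof (rule through_root_real)
      show "{min (cut_mid k) x..max (cut_mid k) x} \<inter> ends = {}" using sub ends_cut[OF k] by blast
      have "x \<in> {a k<..<b k}" using x(2,3) by simp
      then show "x \<notin> ends" using ends_cut[OF k] by blast
    qed
    then show ?thesis by (simp add: glued_root_def x(1))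
  qed (simp add: glued_root_def through_root_upper)
qed

lemma isCont_glued_root:
  assumes k: "k \<in> {1..N}" and z: "z \<in> slit (a k) (b k)"
  shows "isCont glued_root z"
proof -
  have "isCont (through_root (cut_mid k)) z"
    using through_root_holomorphic cut_mid[OF k] ends_cut[OF k] z by (intro isCont_slit) auto
  moreover have "\<forall>\<^sub>F w in nhds z. glued_root w = through_root (cut_mid k) w"
    using eventually_nhds_in_open[OF open_slit z] by eventually_elim (rule glued_root_cut[OF k])
  ultimately show ?thesis using isCont_cong by fastforce
qed

section \<open>Circles around one gap\<close>

context
  fixes k :: nat
  assumes k: "k \<in> {1..<N}"
begin

text \<open>The circle crosses the axis at the midpoints of two neighbouring cuts, away from all end
  points and poles. Of the end points it encloses only \<open>b k\<close> and
  \<open>a (k + 1)\<close>.\<close>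

definition circ_c :: real where "circ_c = (cut_mid k + cut_mid (k + 1)) / 2"
definition circ_r :: real where "circ_r = (cut_mid (k + 1) - cut_mid k) / 2"

lemma circ: "circ_r > 0" "circ_c - circ_r = cut_mid k" "circ_c + circ_r = cut_mid (k + 1)"
  using cut_mid[of k] cut_mid[of "k + 1"] b_less_a[of k "k + 1"] k
  by (auto simp: circ_c_def circ_r_def field_simps)

text \<open>An A-cycle leaves cut \<open>k\<close> through the upper half-plane, hence clockwise
  around the gap. So \<open>w\<close> is a circle started at its left point and reversed; lifted by
  \<open>glued_root\<close> it runs on sheet 1 above and on sheet 2 below. Reversal and a new base
  point preserve the value 0.\<close>

lemma A_cycle_integral: "((\<lambda>z. f (z, glued_root z)) has_contour_integral 0) (circlepath circ_c circ_r)"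
proof -
  define w where "w = reversepath (circlepath (complex_of_real circ_c) (- circ_r))"
  define \<gamma> where "\<gamma> t = (w t, glued_root (w t))" for t
  have w: "w t = of_real circ_c - of_real circ_r * cis (- 2 * pi * t)" for t
  proof -
    have "exp (2 * of_real pi * \<i> * of_real (1 - t)) = exp (\<i> * of_real (- 2 * pi * t))"
      by (simp add: ring_distribs exp_diff exp_minus field_simps)
    then show ?thesis by (simp add: w_def reversepath_def circlepath cis_conv_exp)
  qed
  have Im_w: "Im (w t) = circ_r * sin (2 * pi * t)" for t by (simp add: w)
  have w0: "w 0 = of_real (cut_mid k)" "w 1 = of_real (cut_mid k)" "w (1 / 2) = of_real (cut_mid (k + 1))"
    using circ by (auto simp: w complex_eq_iff)
  have up: "Im (w t) > 0" if "t \<in> {0<..<1 / 2}" for t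
    using that circ(1) by (auto simp: Im_w intro!: mult_pos_pos sin_gt_zero)
  have lo: "Im (w t) < 0" if "t \<in> {1 / 2<..<1}" for t
    using that circ(1) by (auto simp: Im_w intro!: mult_pos_neg sin_lt_zero)
  have k1: "k \<in> {1..N}" "k + 1 \<in> {1..N}" using k by auto
  have in_slit: "\<exists>i\<in>{1..N}. w t \<in> slit (a i) (b i)" if t01: "t \<in> {0..1}" for t
  proof -
    consider "t = 0 \<or> t = 1" | "t = 1 / 2" | "t \<in> {0<..<1 / 2}" | "t \<in> {1 / 2<..<1}"
      using t01 unfolding atLeastAtMost_iff greaterThanLessThan_iff by linarith
    then show ?thesis
    proof cases
      case 1
      then show ?thesis using k1 cut_mid[OF k1(1)] w0 by (intro bexI[of _ k]) (auto simp: slit_def)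
    next
      case 2
      then have "w t = of_real (cut_mid (k + 1))" using w0(3) by (simp only:)
      then show ?thesis using k1 cut_mid[OF k1(2)] by (intro bexI[of _ "k + 1"]) (auto simp: slit_def)
    next
      case 3
      then show ?thesis using up[of t] k1 by (intro bexI[of _ k]) (auto simp: slit_def)
    next
      case 4
      then show ?thesis using lo[of t] k1 by (intro bexI[of _ k]) (auto simp: slit_def)
    qed
  qed
  have vw: "valid_path w" unfolding w_def by simp
  have "continuous_on {0..1} w" using valid_path_imp_path[OF vw] by (simp add: path_def)
  moreover have "continuous_on {0..1} (\<lambda>t. glued_root (w t))"
  proof (rule continuous_on_compose2[OF _ \<open>continuous_on {0..1} w\<close> order_refl])
    show "continuous_on (w ` {0..1}) glued_root"
      using in_slit isCont_glued_root by (intro continuous_at_imp_continuous_on) blast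
  qed
  ultimately have "path \<gamma>" unfolding path_def \<gamma>_def by (intro continuous_intros)
  moreover have "path_image \<gamma> \<subseteq> affine_curve N a b"
    using glued_root_sq by (auto simp: path_image_def \<gamma>_def affine_curve_def)
  moreover have fst\<gamma>: "fst \<circ> \<gamma> = w" by (auto simp: \<gamma>_def)
  ultimately have "surface_path N a b \<gamma>" using vw by (simp add: surface_path_def)
  moreover have "pathfinish \<gamma> = pathstart \<gamma>" by (simp add: pathfinish_def pathstart_def \<gamma>_def w0)
  moreover have "\<gamma> t \<in> sheet N a b 1" if "t \<in> {0<..<1 / 2}" for t
    using up[OF that] nonreal_notin_cuts[of "w t"]
    by (auto simp: sheet_def sheet_pt_def \<gamma>_def glued_root_def)
  moreover have "\<gamma> t \<in> sheet N a b 2" if "t \<in> {1 / 2<..<1}" for t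
    using lo[OF that] nonreal_notin_cuts[of "w t"]
    by (auto simp: sheet_def sheet_pt_def \<gamma>_def glued_root_def)
  ultimately have "A_cycle N a b k \<gamma>"
    unfolding A_cycle_def using cut_mid[OF k1(1)] cut_mid[OF k1(2)] up lo
    by (auto simp: w0 \<gamma>_def intro!: bexI[of _ "1 / 2"])
  then have "has_surface_integral f 0 \<gamma>" using omega k unfolding is_omega_def by blast
  then have "((\<lambda>z. f (z, glued_root z)) has_contour_integral 0) w"
    by (simp add: has_surface_integral_def has_contour_integral_def fst\<gamma>) (simp add: \<gamma>_def)
  from has_contour_integral_reversepath[OF vw this]
  have "((\<lambda>z. f (z, glued_root z)) has_contour_integral 0) (circlepath (of_real circ_c) (- circ_r))"
    by (simp add: w_def)
  from has_contour_integral_shiftpath[OF this, of "1 / 2"] show ?thesis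
    by (simp add: shiftpath_circlepath)
qed

text \<open>Two end points with residue -1/2 lie inside, together with the pole of gap
  \<open>k\<close>, of residue 1, wherever it sits in the closed gap. The total residue is
  0.\<close>

lemma pole_sum_integral: "(pole_sum has_contour_integral 0) (circlepath circ_c circ_r)"
proof -
  define \<gamma> where "\<gamma> = circlepath (complex_of_real circ_c) circ_r"
  define ind where "ind x = (if cut_mid k < x \<and> x < cut_mid (k + 1) then 1 else (0::complex))" for x
  have k1: "k \<in> {1..N}" "k + 1 \<in> {1..N}" using k by auto
  have int: "((\<lambda>z. 1 / (z - of_real x)) has_contour_integral (2 * pi * \<i> * ind x)) \<gamma>"
    if x: "x \<noteq> cut_mid k" "x \<noteq> cut_mid (k + 1)" for x
  proof -
    have norm: "cmod (of_real x - of_real circ_c) = \<bar>x - circ_c\<bar>" by (metis norm_of_real of_real_diff)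
    have ne: "\<bar>x - circ_c\<bar> \<noteq> circ_r" using x circ by (auto simp: abs_if)
    have "of_real x \<notin> path_image \<gamma>"
      using ne circ(1) norm by (auto simp: \<gamma>_def path_image_circlepath sphere_def dist_norm norm_minus_commute)
    then have "((\<lambda>z. 1 / (z - of_real x)) has_contour_integral (2 * pi * \<i> * winding_number \<gamma> (of_real x))) \<gamma>"
      unfolding \<gamma>_def by (intro has_contour_integral_winding_number) auto
    moreover have "winding_number \<gamma> (of_real x) = ind x"
    proof (cases "\<bar>x - circ_c\<bar> < circ_r")
      case True
      then have "cut_mid k < x \<and> x < cut_mid (k + 1)" using circ by (auto simp: abs_if split: if_splits)
      then show ?thesis using True norm unfolding \<gamma>_def ind_def by (simp add: winding_number_circlepath)
    next
      case False
      then have "\<not> (cut_mid k < x \<and> x < cut_mid (k + 1))" using circ by (auto simp: abs_if split: if_splits)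
      moreover have "winding_number \<gamma> (of_real x) = 0"
        using False ne norm circ(1) unfolding \<gamma>_def
        by (intro winding_number_zero_outside[of _ "cball (of_real circ_c) circ_r"])
           (auto simp: dist_norm norm_minus_commute path_image_circlepath sphere_def)
      ultimately show ?thesis by (simp add: ind_def)
    qed
    ultimately show ?thesis by simp
  qed
  have ends: "c \<noteq> cut_mid k" "c \<noteq> cut_mid (k + 1)" if "c \<in> ends" for c
    using ends_cut[OF k1(1)] ends_cut[OF k1(2)] cut_mid[OF k1(1)] cut_mid[OF k1(2)] that by auto
  have poles: "pole j \<noteq> cut_mid k" "pole j \<noteq> cut_mid (k + 1)" if "j \<in> {1..<N}" for j
    using pole_notin_cut[OF that k1(1)] pole_notin_cut[OF that k1(2)] cut_mid[OF k1(1)] cut_mid[OF k1(2)] by auto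
  have ind_ends: "ind (a i) + ind (b i) = (if i = k + 1 then 1 else 0) + (if i = k then 1 else 0)"
    if i: "i \<in> {1..N}" for i
  proof -
    consider "i < k" | "i = k" | "i = k + 1" | "i > k + 1" by linarith
    then show ?thesis
      using cut_mid[OF k1(1)] cut_mid[OF k1(2)] ab[OF i] k1 i b_less_a[of i k] b_less_a[of "k + 1" i]
        b_less_a[of k "k + 1"]
      by cases (auto simp: ind_def)
  qed
  have "(\<Sum>c\<in>ends. ind c) = 2"
  proof -
    have "(\<Sum>c\<in>ends. ind c) = (\<Sum>i=1..N. (if i = k + 1 then 1 else 0) + (if i = k then 1 else 0))"
      unfolding sum_ends by (rule sum.cong) (use ind_ends in auto)
    also have "\<dots> = 2" using k1 unfolding sum.distrib by simp
    finally show ?thesis .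
  qed
  moreover have "(\<Sum>j\<in>{1..<N}. ind (pole j)) = 1"
  proof -
    have "ind (pole j) = (if j = k then 1 else 0)" if j: "j \<in> {1..<N}" for j
    proof -
      consider "j < k" | "j = k" | "j > k" by linarith
      then show ?thesis
      proof cases
        case 1
        then have "a (j + 1) \<le> a k" using j k by (intro a_mono) auto
        then have "pole j < cut_mid k" using P_eq(3)[OF j] cut_mid[OF k1(1)] by linarith
        then show ?thesis using 1 by (simp add: ind_def)
      next
        case 2
        then show ?thesis using P_eq(2,3)[OF j] cut_mid[OF k1(1)] cut_mid[OF k1(2)] by (simp add: ind_def)
      next
        case 3
        then have "a (k + 1) \<le> a j" using j k by (intro a_mono) auto
        moreover have "b (k + 1) \<le> b j"
          using 3 j ab[of j] b_less_a[of "k + 1" j] by (cases "k + 1 = j") auto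
        ultimately have "cut_mid (k + 1) < pole j" using P_eq(2)[OF j] cut_mid[OF k1(2)] by linarith
        then show ?thesis using 3 by (simp add: ind_def)
      qed
    qed
    then have "(\<Sum>j\<in>{1..<N}. ind (pole j)) = (\<Sum>j\<in>{1..<N}. if j = k then 1 else 0)"
      by (intro sum.cong) auto
    then show ?thesis using k by simp
  qed
  moreover have "(pole_sum has_contour_integral
      (- (1 / 2) * (\<Sum>c\<in>ends. 2 * pi * \<i> * ind c) + (\<Sum>j\<in>{1..<N}. 2 * pi * \<i> * ind (pole j)))) \<gamma>"
    unfolding pole_sum_def
    by (intro has_contour_integral_add has_contour_integral_lmul has_contour_integral_sum int)
       (use ends poles finite_ends in auto)
  ultimately show ?thesis by (simp add: \<gamma>_def flip: sum_distrib_left)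
qed

text \<open>The circle avoids the singularities of the trace, so on it the coefficient along the
  opposite root is \<open>pole_sum z - f (z, glued_root z)\<close>, a difference of two coefficients
  with integral 0.\<close>

lemma swapped_cycle_integral:
  assumes "\<sigma> = 1 \<or> \<sigma> = -1"
  shows "((\<lambda>z. f (z, \<sigma> * glued_root z)) has_contour_integral 0) (circlepath circ_c circ_r)"
proof (cases "\<sigma> = 1")
  case True
  then show ?thesis using A_cycle_integral by simp
next
  case False
  have k1: "k \<in> {1..N}" "k + 1 \<in> {1..N}" using k by auto
  have "((\<lambda>z. pole_sum z - f (z, glued_root z)) has_contour_integral 0 - 0) (circlepath circ_c circ_r)"
    by (intro has_contour_integral_diff pole_sum_integral A_cycle_integral)
  moreover have "pole_sum z - f (z, glued_root z) = f (z, \<sigma> * glued_root z)"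
    if z: "z \<in> path_image (circlepath circ_c circ_r)" for z
  proof -
    have "z \<notin> sing"
    proof
      assume "z \<in> sing"
      then obtain x where x: "z = of_real x" "x \<in> ends \<or> (\<exists>j\<in>{1..<N}. x = pole j)"
        by (auto simp: sing_def)
      have "\<bar>x - circ_c\<bar> = circ_r"
        using z circ(1) by (simp add: x(1) path_image_circlepath dist_norm norm_minus_commute
            flip: of_real_diff)
      then have "x = cut_mid k \<or> x = cut_mid (k + 1)" using circ by (auto simp: abs_if split: if_splits)
      then show False
        using x(2) ends_cut[OF k1(1)] ends_cut[OF k1(2)] cut_mid[OF k1(1)] cut_mid[OF k1(2)]
          pole_notin_cut[OF _ k1(1)] pole_notin_cut[OF _ k1(2)] by fastforce
    qed
    then have "pole_sum z = f (z, glued_root z) + f (z, - glued_root z)"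
      using sheet_sum_eq_pole_sum[of z] sheet_sum_eq[OF glued_root_sq, of z] by simp
    then show ?thesis using False assms by auto
  qed
  ultimately show ?thesis using has_contour_integral_eq by fastforce
qed

text \<open>In the circle integral the values of \<open>F\<close> at the left crossing cancel, and
  so do those of \<open>G\<close> at the right one. What remains is \<open>c2 - c1\<close>, the
  discrepancy of the shifts that align \<open>G\<close> with \<open>U\<close> above and below; its
  vanishing carries the matching to the next cut.\<close>

lemma cut_match_step:
  assumes \<sigma>: "\<sigma> = 1 \<or> \<sigma> = -1"
    and U: "\<And>\<sigma> z. \<sigma> = 1 \<or> \<sigma> = -1 \<Longrightarrow> Im z \<noteq> 0 \<Longrightarrow> (U \<sigma> has_field_derivative f (z, \<sigma> * sr z)) (at z)"
    and F: "F holomorphic_on slit (a k) (b k)"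
      "\<And>z. z \<in> hp 1 \<Longrightarrow> F z = U \<sigma> z" "\<And>z. z \<in> hp (-1) \<Longrightarrow> F z = U (- \<sigma>) z"
  shows "\<exists>F. F holomorphic_on slit (a (k + 1)) (b (k + 1)) \<and>
      (\<forall>z\<in>hp 1. F z = U \<sigma> z) \<and> (\<forall>z\<in>hp (-1). F z = U (- \<sigma>) z)"
proof -
  have k1: "k \<in> {1..N}" "k + 1 \<in> {1..N}" using k by auto
  have m\<sigma>: "- \<sigma> = 1 \<or> - \<sigma> = -1" using \<sigma> by auto
  obtain G where G: "G holomorphic_on slit (a (k + 1)) (b (k + 1))"
    "\<And>z. z \<in> hp 1 \<Longrightarrow> (G has_field_derivative f (z, \<sigma> * sr z)) (at z)"
    "\<And>z. z \<in> hp (-1) \<Longrightarrow> (G has_field_derivative f (z, - \<sigma> * sr z)) (at z)"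
    using cut_primitive[OF k1(2) \<sigma>] by blast
  obtain c1 where c1: "\<And>z. z \<in> hp 1 \<Longrightarrow> U \<sigma> z = G z + c1"
    using DERIV_eq_on_hp[of 1 "U \<sigma>" "\<lambda>z. f (z, \<sigma> * sr z)" G] U[OF \<sigma>] G(2) by (auto simp: hp_def)
  obtain c2 where c2: "\<And>z. z \<in> hp (-1) \<Longrightarrow> U (- \<sigma>) z = G z + c2"
    using DERIV_eq_on_hp[of "-1" "U (- \<sigma>)" "\<lambda>z. f (z, - \<sigma> * sr z)" G] U[OF m\<sigma>] G(3) by (auto simp: hp_def)
  define V where "V z = (if Im z > 0 then U \<sigma> z else U (- \<sigma>) z)" for z
  have lim: "(V \<longlongrightarrow> w) (at x within hp s)" if "(W \<longlongrightarrow> w) (at x within hp s)" "\<And>z. z \<in> hp s \<Longrightarrow> V z = W z" for W w x s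
    using that(1) by (rule Lim_transform_eventually) (use that(2) in \<open>auto simp: eventually_at_filter\<close>)
  define x0 where "x0 = complex_of_real (cut_mid k)"
  define x1 where "x1 = complex_of_real (cut_mid (k + 1))"
  have x01: "x0 \<in> slit (a k) (b k)" "x1 \<in> slit (a (k + 1)) (b (k + 1))"
    using cut_mid[OF k1(1)] cut_mid[OF k1(2)] by (auto simp: x0_def x1_def slit_def)
  have "((\<lambda>z. f (z, \<sigma> * glued_root z)) has_contour_integral
      ((F x0 - (G x1 + c1)) + ((G x1 + c2) - F x0))) (circlepath circ_c circ_r)"
  proof (rule circlepath_integral_halves[where U = V])
    show "circ_r \<noteq> 0" using circ(1) by simp
    show "(V has_field_derivative f (z, \<sigma> * glued_root z)) (at z)" if "Im z \<noteq> 0" for z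
    proof (cases "Im z > 0")
      case True
      have "(V has_field_derivative f (z, \<sigma> * sr z)) (at z)"
        by (rule has_field_derivative_transform_within_open[OF U[OF \<sigma> that] open_hp[of 1]])
           (use True in \<open>auto simp: V_def hp_def\<close>)
      then show ?thesis using True by (simp add: glued_root_def)
    next
      case False
      have "(V has_field_derivative f (z, - \<sigma> * sr z)) (at z)"
        by (rule has_field_derivative_transform_within_open[OF U[OF m\<sigma> that] open_hp[of "-1"]])
           (use False that in \<open>auto simp: V_def hp_def\<close>)
      then show ?thesis using False that by (simp add: glued_root_def)
    qed
    show "(V \<longlongrightarrow> G x1 + c1) (at (of_real (circ_c + circ_r)) within hp circ_r)"
      unfolding circ hp_scale[OF circ(1)] x1_def[symmetric]
      by (rule lim[of "\<lambda>z. G z + c1"], intro tendsto_intros tendsto_slit[OF G(1) x01(2)])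
         (use c1 in \<open>auto simp: V_def hp_def\<close>)
    show "(V \<longlongrightarrow> G x1 + c2) (at (of_real (circ_c + circ_r)) within hp (- circ_r))"
      unfolding circ hp_scale[OF circ(1)] x1_def[symmetric]
      by (rule lim[of "\<lambda>z. G z + c2"], intro tendsto_intros tendsto_slit[OF G(1) x01(2)])
         (use c2 in \<open>auto simp: V_def hp_def\<close>)
    show "(V \<longlongrightarrow> F x0) (at (of_real (circ_c - circ_r)) within hp circ_r)"
      unfolding circ hp_scale[OF circ(1)] x0_def[symmetric]
      by (rule lim[OF tendsto_slit[OF F(1) x01(1)]]) (use F(2) in \<open>auto simp: V_def hp_def\<close>)
    show "(V \<longlongrightarrow> F x0) (at (of_real (circ_c - circ_r)) within hp (- circ_r))"
      unfolding circ hp_scale[OF circ(1)] x0_def[symmetric]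
      by (rule lim[OF tendsto_slit[OF F(1) x01(1)]]) (use F(3) in \<open>auto simp: V_def hp_def\<close>)
  qed
  from has_contour_integral_unique[OF this swapped_cycle_integral[OF \<sigma>]]
  have "c1 = c2" by simp
  moreover have "(\<lambda>z. G z + c2) holomorphic_on slit (a (k + 1)) (b (k + 1))"
    by (intro holomorphic_intros G(1))
  ultimately show ?thesis
    using c1 c2 by (intro exI[of _ "\<lambda>z. G z + c2"]) auto
qed

end

text \<open>Independence of the cut, expressed through primitives: the same pair of functions is
  continued into each other through every cut, with no additive constant left over.\<close>

definition cut_matched :: "(complex \<Rightarrow> complex \<Rightarrow> complex) \<Rightarrow> bool" where
  "cut_matched U \<longleftrightarrow> (\<forall>k\<in>{1..N}. \<forall>\<sigma>\<in>{1, -1}. \<exists>F. F holomorphic_on slit (a k) (b k) \<and>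
      (\<forall>z\<in>hp 1. F z = U \<sigma> z) \<and> (\<forall>z\<in>hp (-1). F z = U (- \<sigma>) z))"

text \<open>On the starting sheet the primitive is the one normalized at infinity. On the other
  sheet each half-plane is reached separately, from the opposite half-plane of the starting sheet
  through cut 1; the remaining cuts follow by induction.\<close>

lemma abelian_primitives:
  obtains U H where
    "\<And>\<sigma> z. \<sigma> = 1 \<or> \<sigma> = -1 \<Longrightarrow> Im z \<noteq> 0 \<Longrightarrow> (U \<sigma> has_field_derivative f (z, \<sigma> * sr z)) (at z)"
    "H holomorphic_on slit (-rad) rad" "H 0 = 0"
    "\<And>z. Im z \<noteq> 0 \<Longrightarrow> U sg z = H (1 / (z - of_real mid))"
    "cut_matched U"
proof -
  have N1: "1 \<in> {1..N}" using N by simp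
  obtain H where H: "H holomorphic_on slit (-rad) rad" "H 0 = 0"
    "\<And>z. z \<notin> seg \<Longrightarrow> ((\<lambda>z. H (1 / (z - of_real mid))) has_field_derivative f (z, sg * sr z)) (at z)"
    using primitive_at_infinity by blast
  define G where "G z = H (1 / (z - of_real mid))" for z
  have G: "(G has_field_derivative f (z, sg * sr z)) (at z)" if "z \<in> hp s" for z s
    unfolding G_def[abs_def] using that by (intro H(3)) (auto simp: notin_seg_iff hp_def)
  have msg: "- sg = 1 \<or> - sg = -1" using sg by auto
  obtain F1 where F1: "F1 holomorphic_on slit (a 1) (b 1)"
    "\<And>z. z \<in> hp 1 \<Longrightarrow> (F1 has_field_derivative f (z, sg * sr z)) (at z)"
    "\<And>z. z \<in> hp (-1) \<Longrightarrow> (F1 has_field_derivative f (z, - sg * sr z)) (at z)"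
    using cut_primitive[OF N1 sg] by blast
  obtain F2 where F2: "F2 holomorphic_on slit (a 1) (b 1)"
    "\<And>z. z \<in> hp 1 \<Longrightarrow> (F2 has_field_derivative f (z, - sg * sr z)) (at z)"
    "\<And>z. z \<in> hp (-1) \<Longrightarrow> (F2 has_field_derivative f (z, sg * sr z)) (at z)"
    using cut_primitive[OF N1 msg] by auto
  obtain c1 where c1: "\<And>z. z \<in> hp 1 \<Longrightarrow> G z = F1 z + c1"
    using DERIV_eq_on_hp[of 1 G "\<lambda>z. f (z, sg * sr z)" F1] G[of _ 1] F1(2) by blast
  obtain c2 where c2: "\<And>z. z \<in> hp (-1) \<Longrightarrow> G z = F2 z + c2"
    using DERIV_eq_on_hp[of "-1" G "\<lambda>z. f (z, sg * sr z)" F2] G[of _ "-1"] F2(3) by blast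
  \<comment> \<open>\<open>F1\<close> continues the upper half of the starting sheet downwards,
    \<open>F2\<close> its lower half upwards; the shifts \<open>c1\<close> and \<open>c2\<close>
    align both with the normalization at infinity.\<close>
  define U where "U \<sigma> z = (if \<sigma> = sg then G z else if Im z > 0 then F2 z + c2 else F1 z + c1)" for \<sigma> z
  have U1: "(U \<sigma> has_field_derivative f (z, \<sigma> * sr z)) (at z)" if \<sigma>: "\<sigma> = 1 \<or> \<sigma> = -1" and z: "Im z \<noteq> 0" for \<sigma> z
  proof (cases "\<sigma> = sg")
    case True
    have "U \<sigma> = G" by (auto simp: U_def True)
    moreover have "z \<in> hp (Im z)" using z by (simp add: hp_def zero_less_mult_iff) linarith
    ultimately show ?thesis using G[of z "Im z"] True by simp
  next
    case False
    then have \<sigma>_eq: "\<sigma> = - sg" using \<sigma> sg by auto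
    show ?thesis
    proof (cases "Im z > 0")
      case True
      have "((\<lambda>z. F2 z + c2) has_field_derivative f (z, \<sigma> * sr z)) (at z)"
        using F2(2)[of z] True by (auto simp: \<sigma>_eq hp_def intro!: derivative_eq_intros)
      then show ?thesis
        by (rule has_field_derivative_transform_within_open[OF _ open_hp[of 1]])
           (use True False in \<open>auto simp: U_def hp_def\<close>)
    next
      case F: False
      have "((\<lambda>z. F1 z + c1) has_field_derivative f (z, \<sigma> * sr z)) (at z)"
        using F1(3)[of z] F z by (auto simp: \<sigma>_eq hp_def intro!: derivative_eq_intros)
      then show ?thesis
        by (rule has_field_derivative_transform_within_open[OF _ open_hp[of "-1"]])
           (use F False z in \<open>auto simp: U_def hp_def\<close>)
    qed
  qed
  have match: "\<exists>F. F holomorphic_on slit (a k) (b k) \<and>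
      (\<forall>z\<in>hp 1. F z = U \<sigma> z) \<and> (\<forall>z\<in>hp (-1). F z = U (- \<sigma>) z)"
    if \<sigma>: "\<sigma> = 1 \<or> \<sigma> = -1" and "1 \<le> k" "k \<le> N" for \<sigma> k
    using that(2,3)
  proof (induction k rule: dec_induct)
    case base
    have sg0: "- sg \<noteq> sg" using sg by auto
    have hol: "(\<lambda>z. F1 z + c1) holomorphic_on slit (a 1) (b 1)"
      "(\<lambda>z. F2 z + c2) holomorphic_on slit (a 1) (b 1)"
      by (intro holomorphic_intros F1(1) F2(1))+
    show ?case
    proof (cases "\<sigma> = sg")
      case True
      then show ?thesis using sg0 c1 hol(1)
        by (intro exI[of _ "\<lambda>z. F1 z + c1"]) (auto simp: U_def hp_def)
    next
      case False
      then have "\<sigma> = - sg" using \<sigma> sg by auto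
      then show ?thesis using sg0 c2 hol(2)
        by (intro exI[of _ "\<lambda>z. F2 z + c2"]) (auto simp: U_def hp_def)
    qed
  next
    case (step i)
    then obtain F where F: "F holomorphic_on slit (a i) (b i)"
      "\<And>z. z \<in> hp 1 \<Longrightarrow> F z = U \<sigma> z" "\<And>z. z \<in> hp (-1) \<Longrightarrow> F z = U (- \<sigma>) z" by force
    have "i \<in> {1..<N}" using step by auto
    from cut_match_step[OF this \<sigma> U1 F] show ?case by simp
  qed
  show ?thesis
  proof (rule that[OF U1 H(1,2)])
    show "U sg z = H (1 / (z - of_real mid))" if "Im z \<noteq> 0" for z
      by (simp add: U_def G_def)
    show "cut_matched U" unfolding cut_matched_def using match by auto
  qed
qed

end


section \<open>Abelian integrals\<close>

text \<open>The finite set \<open>T\<close> receives the parameter at which a path crosses a cut; at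
  that parameter only continuity of the primitive is asked for.\<close>

lemma surface_integral_primitive:
  assumes vp: "valid_path (fst \<circ> \<delta>)" and T: "finite T"
    and cont: "\<And>t. t \<in> {0..1} \<Longrightarrow> isCont F (fst (\<delta> t))"
    and der: "\<And>t. t \<in> {0<..<1} - T \<Longrightarrow> (F has_field_derivative f (\<delta> t)) (at (fst (\<delta> t)))"
  shows "has_surface_integral f (F (fst (\<delta> 1)) - F (fst (\<delta> 0))) \<delta>"
proof -
  define w where "w = fst \<circ> \<delta>"
  obtain K where K: "finite K" "w C1_differentiable_on ({0..1} - K)" and cw: "continuous_on {0..1} w"
    using vp unfolding valid_path_def piecewise_C1_differentiable_on_def w_def by blast
  have "((\<lambda>t. f (\<delta> t) * vector_derivative w (at t within {0..1})) has_integral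
      ((F \<circ> w) 1 - (F \<circ> w) 0)) {0..1}"
  proof (rule fundamental_theorem_of_calculus_interior_strong[where S = "K \<union> T"])
    fix t :: real assume t: "t \<in> {0<..<1} - (K \<union> T)"
    then have "w differentiable at t" using K(2) by (auto simp: C1_differentiable_on_eq)
    then have "(w has_vector_derivative vector_derivative w (at t)) (at t)"
      by (simp add: vector_derivative_works)
    moreover have "(F has_field_derivative f (\<delta> t)) (at (w t))"
      using der t by (auto simp: w_def)
    ultimately have "((F \<circ> w) has_vector_derivative vector_derivative w (at t) * f (\<delta> t)) (at t)"
      by (rule field_vector_diff_chain_at)
    moreover have "at t within {0..1} = at t" using t by (intro at_within_Icc_at) auto
    ultimately show "((F \<circ> w) has_vector_derivative f (\<delta> t) * vector_derivative w (at t within {0..1})) (at t)"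
      by (simp add: mult.commute)
  next
    have "continuous_on (w ` {0..1}) F"
      using cont by (intro continuous_at_imp_continuous_on) (auto simp: w_def)
    then show "continuous_on {0..1} (F \<circ> w)" using cw by (intro continuous_on_compose)
  qed (use K T in auto)
  then show ?thesis by (simp add: has_surface_integral_def w_def)
qed

lemma affine_unit:
  fixes \<epsilon> u :: real
  assumes "\<epsilon> \<in> {0<..<1}" "u \<in> {0..1}"
  shows "(1 - \<epsilon>) * u + \<epsilon> \<in> {0<..1}"
proof -
  have "0 \<le> (1 - \<epsilon>) * u" "0 \<le> (1 - \<epsilon>) * (1 - u)" using assms by auto
  then show ?thesis using assms by (auto simp: algebra_simps)
qed

lemma surface_integral_from_infty_primitive:
  assumes vp: "\<And>\<epsilon>. \<epsilon> \<in> {0<..<1} \<Longrightarrow> valid_path (fst \<circ> subpath \<epsilon> 1 \<gamma>)" and T: "finite T"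
    and cont: "\<And>t. t \<in> {0<..1} \<Longrightarrow> isCont F (fst (\<gamma> t))"
    and der: "\<And>t. t \<in> {0<..1} - T \<Longrightarrow> (F has_field_derivative f (\<gamma> t)) (at (fst (\<gamma> t)))"
    and lim: "((\<lambda>t. F (fst (\<gamma> t))) \<longlongrightarrow> 0) (at_right 0)"
  shows "has_surface_integral_from_infty f (F (fst (\<gamma> 1))) \<gamma>"
  unfolding has_surface_integral_from_infty_def
proof (intro exI conjI ballI)
  fix \<epsilon> :: real assume \<epsilon>: "\<epsilon> \<in> {0<..<1}"
  define g where "g u = (1 - \<epsilon>) * u + \<epsilon>" for u
  have g: "subpath \<epsilon> 1 \<gamma> u = \<gamma> (g u)" for u by (simp add: subpath_def g_def)
  have g_range: "g u \<in> {0<..1}" if "u \<in> {0..1}" for u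
    using affine_unit[OF \<epsilon> that] by (simp add: g_def)
  have "inj g" using \<epsilon> by (auto simp: g_def inj_def)
  have "has_surface_integral f (F (fst (subpath \<epsilon> 1 \<gamma> 1)) - F (fst (subpath \<epsilon> 1 \<gamma> 0))) (subpath \<epsilon> 1 \<gamma>)"
  proof (rule surface_integral_primitive[where T = "g -` T"])
    show "finite (g -` T)" using T \<open>inj g\<close> by (rule finite_vimageI)
    show "isCont F (fst (subpath \<epsilon> 1 \<gamma> t))" if "t \<in> {0..1}" for t
      unfolding g using g_range[OF that] by (rule cont)
    show "(F has_field_derivative f (subpath \<epsilon> 1 \<gamma> t)) (at (fst (subpath \<epsilon> 1 \<gamma> t)))"
      if "t \<in> {0<..<1} - g -` T" for t
      unfolding g using g_range[of t] that by (intro der) auto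
  qed (rule vp[OF \<epsilon>])
  then show "has_surface_integral f (F (fst (\<gamma> 1)) - F (fst (\<gamma> \<epsilon>))) (subpath \<epsilon> 1 \<gamma>)"
    by (simp add: g g_def)
next
  have "((\<lambda>\<epsilon>. F (fst (\<gamma> 1)) - F (fst (\<gamma> \<epsilon>))) \<longlongrightarrow> F (fst (\<gamma> 1)) - 0) (at_right 0)"
    by (intro tendsto_intros lim)
  then show "((\<lambda>\<epsilon>. F (fst (\<gamma> 1)) - F (fst (\<gamma> \<epsilon>))) \<longlongrightarrow> F (fst (\<gamma> 1))) (at_right 0)" by simp
qed

lemma surface_integral_from_infty_unique:
  assumes "has_surface_integral_from_infty f I \<gamma>" "has_surface_integral_from_infty f I' \<gamma>"
  shows "I = I'"
proof -
  obtain J where J: "\<And>\<epsilon>. \<epsilon> \<in> {0<..<1} \<Longrightarrow> has_surface_integral f (J \<epsilon>) (subpath \<epsilon> 1 \<gamma>)" "(J \<longlongrightarrow> I) (at_right 0)"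
    using assms(1) unfolding has_surface_integral_from_infty_def by blast
  obtain J' where J': "\<And>\<epsilon>. \<epsilon> \<in> {0<..<1} \<Longrightarrow> has_surface_integral f (J' \<epsilon>) (subpath \<epsilon> 1 \<gamma>)" "(J' \<longlongrightarrow> I') (at_right 0)"
    using assms(2) unfolding has_surface_integral_from_infty_def by blast
  have "J \<epsilon> = J' \<epsilon>" if "\<epsilon> \<in> {0<..<1}" for \<epsilon>
    using J(1)[OF that] J'(1)[OF that] unfolding has_surface_integral_def by (rule has_integral_unique)
  then have "\<forall>\<^sub>F \<epsilon> in at_right 0. J \<epsilon> = J' \<epsilon>"
    unfolding eventually_at_right_field by (intro exI[of _ 1]) auto
  then have "(J' \<longlongrightarrow> I) (at_right 0)" using J(2) by (rule Lim_transform_eventually[rotated])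
  then show ?thesis using J'(2) tendsto_unique trivial_limit_at_right_real by blast
qed

text \<open>Both kinds of admissible paths are constructed on curves of the form \<open>p + q / t\<close>.\<close>

lemma valid_path_hyperbola:
  fixes p q :: complex
  assumes "\<epsilon> \<in> {0<..<1}"
  shows "valid_path (\<lambda>u. p + q * of_real (1 / ((1 - \<epsilon>) * u + \<epsilon>)))"
proof -
  define g where "g u = (1 - \<epsilon>) * u + \<epsilon>" for u
  have pos: "g u > 0" if "u \<in> {0..1}" for u
    using assms that by (auto simp: g_def intro!: add_nonneg_pos)
  have "(\<lambda>u. p + q * of_real (1 / g u)) C1_differentiable_on {0..1}"
    unfolding C1_differentiable_on_def
  proof (intro exI conjI ballI)
    fix u :: real assume u: "u \<in> {0..1}"
    have "((\<lambda>u. 1 / g u) has_real_derivative (\<epsilon> - 1) / (g u)\<^sup>2) (at u)"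
      using pos[OF u] unfolding g_def by (auto intro!: derivative_eq_intros simp: power2_eq_square)
    then show "((\<lambda>u. p + q * of_real (1 / g u)) has_vector_derivative
        0 + q * of_real ((\<epsilon> - 1) / (g u)\<^sup>2)) (at u)"
      by (intro has_vector_derivative_add has_vector_derivative_const has_vector_derivative_mult_right
          has_vector_derivative_of_real)
  next
    show "continuous_on {0..1} (\<lambda>u. 0 + q * of_real ((\<epsilon> - 1) / (g u)\<^sup>2))"
      using pos unfolding g_def by (intro continuous_intros) force
  qed
  then show ?thesis unfolding valid_path_def g_def by (rule C1_differentiable_imp_piecewise)
qed

lemma filterlim_hyperbola:
  fixes p q :: complex
  assumes "q \<noteq> 0"
  shows "filterlim (\<lambda>t. p + q * of_real (1 / t)) at_infinity (at_right 0)"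
proof -
  have "filterlim (\<lambda>t::real. 1 / t) at_top (at_right 0)"
    using filterlim_inverse_at_top_right by (simp add: inverse_eq_divide)
  then have "filterlim (\<lambda>t. complex_of_real (1 / t)) at_infinity (at_right 0)"
    by (rule filterlim_compose[OF filterlim_of_real_at_infinity])
  then show ?thesis
    using assms by (intro tendsto_add_filterlim_at_infinity[OF tendsto_const]
        tendsto_mult_filterlim_at_infinity[OF tendsto_const])
qed

context cut_differential
begin

lemma sheet_cases:
  assumes "x \<in> sheet N a b j"
  shows "x = (fst x, (if j = 1 then 1 else - 1) * sr (fst x))"
  using assms by (auto simp: sheet_def sheet_pt_def)

lemma sheetI:
  assumes "Im z \<noteq> 0" "w = (if j = 1 then 1 else - 1) * sr z"
  shows "(z, w) \<in> sheet N a b j"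
  using assms nonreal_notin_cuts[of z] by (auto simp: sheet_def sheet_pt_def)

lemma sheet_pt_eq: "sheet_pt N a b j z = (z, (if j = 1 then 1 else - 1) * sr z)"
  by (simp add: sheet_pt_def)

lemma surface_path_hyperbola:
  fixes p q :: complex
  assumes \<gamma>: "\<gamma> = (\<lambda>t. (p + q * of_real (1 / t), \<rho> (p + q * of_real (1 / t))))"
    and \<rho>: "\<And>z. (\<rho> z)\<^sup>2 = curve_poly N a b z"
    and cont: "\<And>t. t \<in> {0<..1} \<Longrightarrow> isCont \<rho> (p + q * of_real (1 / t))"
    and \<epsilon>: "\<epsilon> \<in> {0<..<1}"
  shows "surface_path N a b (subpath \<epsilon> 1 \<gamma>)"
proof -
  define w where "w t = p + q * of_real (1 / t)" for t
  have \<gamma>w: "\<gamma> = (\<lambda>t. (w t, \<rho> (w t)))" by (simp add: \<gamma> w_def)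
  have cw: "continuous_on {0<..1} w" unfolding w_def by (intro continuous_intros) auto
  have "continuous_on {0<..1} (\<lambda>t. \<rho> (w t))"
  proof (rule continuous_on_compose2[OF _ cw order_refl])
    show "continuous_on (w ` {0<..1}) \<rho>"
      using cont by (intro continuous_at_imp_continuous_on) (auto simp: w_def)
  qed
  then have c\<gamma>: "continuous_on {0<..1} \<gamma>" unfolding \<gamma>w by (intro continuous_intros cw)
  have sub: "(\<lambda>u. (1 - \<epsilon>) * u + \<epsilon>) ` {0..1} \<subseteq> {0<..1}"
    using affine_unit[OF \<epsilon>] by blast
  have "continuous_on {0..1} (\<lambda>u. (1 - \<epsilon>) * u + \<epsilon>)" by (intro continuous_intros)
  from continuous_on_compose2[OF c\<gamma> this sub]
  have "path (subpath \<epsilon> 1 \<gamma>)" by (simp add: path_def subpath_def)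
  moreover have "path_image (subpath \<epsilon> 1 \<gamma>) \<subseteq> affine_curve N a b"
    using \<rho> by (auto simp: path_image_def subpath_def \<gamma>w affine_curve_def)
  moreover have "fst \<circ> subpath \<epsilon> 1 \<gamma> = (\<lambda>u. p + q * of_real (1 / ((1 - \<epsilon>) * u + \<epsilon>)))"
    by (auto simp: subpath_def \<gamma>)
  ultimately show ?thesis using valid_path_hyperbola[OF \<epsilon>] by (simp add: surface_path_def)
qed

end

section \<open>Values and existence of admissible paths\<close>

locale abelian_integrals = cut_differential +
  fixes U :: "complex \<Rightarrow> complex \<Rightarrow> complex" and H :: "complex \<Rightarrow> complex"
  assumes U: "\<And>\<sigma> z. \<sigma> = 1 \<or> \<sigma> = -1 \<Longrightarrow> Im z \<noteq> 0 \<Longrightarrow> (U \<sigma> has_field_derivative f (z, \<sigma> * sr z)) (at z)"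
    and H: "H holomorphic_on slit (-rad) rad" "H 0 = 0"
    and UH: "\<And>z. Im z \<noteq> 0 \<Longrightarrow> U sg z = H (1 / (z - of_real mid))"
    and match: "cut_matched U"
begin

lemma H_tendsto: "((\<lambda>z. H (1 / (z - of_real mid))) \<longlongrightarrow> 0) at_infinity"
proof -
  have "isCont H 0" using H(1) rad_pos by (intro isCont_slit[of _ "-rad" rad]) (auto simp: slit_def)
  then have "(H \<longlongrightarrow> 0) (at 0)" using H(2) by (simp add: isCont_def)
  then show ?thesis using filterlim_inv_mid by (rule filterlim_compose)
qed

lemma abelian_path_value_same:
  assumes z: "Im z \<noteq> 0" and \<gamma>: "abelian_path N a b \<nu> \<nu> z \<gamma>"
  shows "has_surface_integral_from_infty f (U sg z) \<gamma>"
proof -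
  have \<gamma>1: "\<gamma> 1 = sheet_pt N a b \<nu> z" and inf: "filterlim (fst \<circ> \<gamma>) at_infinity (at_right 0)"
    and sp: "\<And>\<epsilon>. \<epsilon> \<in> {0<..<1} \<Longrightarrow> surface_path N a b (subpath \<epsilon> 1 \<gamma>)"
    and sh: "\<And>t. t \<in> {0<..1} \<Longrightarrow> \<gamma> t \<in> sheet N a b \<nu> \<and> Im (fst (\<gamma> t)) \<noteq> 0"
    using \<gamma> by (auto simp: abelian_path_def)
  have der: "(U sg has_field_derivative f (\<gamma> t)) (at (fst (\<gamma> t)))" if "t \<in> {0<..1}" for t
    using U[OF sg, of "fst (\<gamma> t)"] sh[OF that] sheet_cases[of "\<gamma> t" \<nu>] by (simp add: sg_def)
  have "has_surface_integral_from_infty f (U sg (fst (\<gamma> 1))) \<gamma>"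
  proof (rule surface_integral_from_infty_primitive[where T = "{}"])
    show "valid_path (fst \<circ> subpath \<epsilon> 1 \<gamma>)" if "\<epsilon> \<in> {0<..<1}" for \<epsilon>
      using sp[OF that] by (simp add: surface_path_def)
    show "isCont (U sg) (fst (\<gamma> t))" if "t \<in> {0<..1}" for t
      using der[OF that] by (rule DERIV_isCont)
    have "((\<lambda>t. H (1 / (fst (\<gamma> t) - of_real mid))) \<longlongrightarrow> 0) (at_right 0)"
      using filterlim_compose[OF H_tendsto inf] by (simp add: o_def)
    moreover have "\<forall>\<^sub>F t in at_right 0. H (1 / (fst (\<gamma> t) - of_real mid)) = U sg (fst (\<gamma> t))"
      unfolding eventually_at_right_field using sh UH by (intro exI[of _ 1]) auto
    ultimately show "((\<lambda>t. U sg (fst (\<gamma> t))) \<longlongrightarrow> 0) (at_right 0)"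
      by (rule Lim_transform_eventually)
  qed (use der in auto)
  then show ?thesis by (simp add: \<gamma>1 sheet_pt_def)
qed

lemma cut_match:
  assumes "k \<in> {1..N}" "\<sigma> = 1 \<or> \<sigma> = -1" "s = 1 \<or> s = -1"
  obtains F where "F holomorphic_on slit (a k) (b k)"
    "\<And>z. z \<in> hp s \<Longrightarrow> F z = U \<sigma> z" "\<And>z. z \<in> hp (-s) \<Longrightarrow> F z = U (- \<sigma>) z"
proof -
  define \<sigma>' where "\<sigma>' = (if s = 1 then \<sigma> else - \<sigma>)"
  have "\<sigma>' \<in> {1, -1}" using assms by (auto simp: \<sigma>'_def)
  then obtain F where F: "F holomorphic_on slit (a k) (b k)"
    "\<forall>z\<in>hp 1. F z = U \<sigma>' z" "\<forall>z\<in>hp (-1). F z = U (- \<sigma>') z"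
    using match assms(1) unfolding cut_matched_def by blast
  show ?thesis using assms(3) F by (intro that[of F]) (auto simp: \<sigma>'_def)
qed

text \<open>Whichever cut the path uses, matching supplies for that cut one function equal to
  \<open>U sg\<close> before the crossing and to \<open>U (- sg)\<close> after it. Its end value
  does not depend on the cut.\<close>

lemma abelian_path_value_other:
  assumes z: "Im z \<noteq> 0" and j: "j = 3 - \<nu>" and \<gamma>: "abelian_path N a b \<nu> j z \<gamma>"
  shows "has_surface_integral_from_infty f (U (- sg) z) \<gamma>"
proof -
  have j\<nu>: "j \<noteq> \<nu>" "(if j = 1 then 1 else - 1) = - sg" using \<nu> j by (auto simp: sg_def)
  \<comment> \<open>\<open>s0\<close> records the side of \<open>z\<close>; the path starts in
    \<open>hp (- s0)\<close> and ends in \<open>hp s0\<close>.\<close>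
  define s0 where "s0 = sgn (Im z)"
  have s0: "s0 = 1 \<or> s0 = -1" using z by (auto simp: s0_def sgn_if)
  have hp: "w \<in> hp s0 \<longleftrightarrow> Im w * Im z > 0" "w \<in> hp (- s0) \<longleftrightarrow> Im w * Im z < 0" for w
    using z by (auto simp: hp_def s0_def sgn_if zero_less_mult_iff mult_less_0_iff)
  have \<gamma>1: "\<gamma> 1 = sheet_pt N a b j z" and inf: "filterlim (fst \<circ> \<gamma>) at_infinity (at_right 0)"
    and sp: "\<And>\<epsilon>. \<epsilon> \<in> {0<..<1} \<Longrightarrow> surface_path N a b (subpath \<epsilon> 1 \<gamma>)"
    using \<gamma> by (auto simp: abelian_path_def)
  obtain s k where s: "s \<in> {0<..<1}" and k: "k \<in> {1..N}"
    and 1: "\<And>t. t \<in> {0<..<s} \<Longrightarrow> \<gamma> t \<in> sheet N a b \<nu> \<and> fst (\<gamma> t) \<in> hp (- s0)"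
    and 2: "fst (\<gamma> s) \<in> of_real ` {a k<..<b k}"
    and 3: "\<And>t. t \<in> {s<..1} \<Longrightarrow> \<gamma> t \<in> sheet N a b j \<and> fst (\<gamma> t) \<in> hp s0"
    using \<gamma> j\<nu> unfolding abelian_path_def hp by auto
  have msg: "- sg = 1 \<or> - sg = -1" using sg by auto
  obtain F where F: "F holomorphic_on slit (a k) (b k)"
    "\<And>z. z \<in> hp s0 \<Longrightarrow> F z = U (- sg) z" "\<And>z. z \<in> hp (- s0) \<Longrightarrow> F z = U sg z"
    using cut_match[OF k msg s0] unfolding minus_minus by blast
  have derF: "(F has_field_derivative f (w, \<sigma> * sr w)) (at w)"
    if "w \<in> hp s'" "s' = s0 \<and> \<sigma> = - sg \<or> s' = - s0 \<and> \<sigma> = sg" for w s' \<sigma>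
  proof -
    have "Im w \<noteq> 0" using that by (auto simp: hp_def)
    then have "(U \<sigma> has_field_derivative f (w, \<sigma> * sr w)) (at w)"
      using that(2) sg msg by (intro U) auto
    then show ?thesis
      by (rule has_field_derivative_transform_within_open[OF _ open_hp[of s'] that(1)])
         (use that(2) F(2,3) in auto)
  qed
  have "has_surface_integral_from_infty f (F (fst (\<gamma> 1))) \<gamma>"
  proof (rule surface_integral_from_infty_primitive[where T = "{s}"])
    show "valid_path (fst \<circ> subpath \<epsilon> 1 \<gamma>)" if "\<epsilon> \<in> {0<..<1}" for \<epsilon>
      using sp[OF that] by (simp add: surface_path_def)
    show "isCont F (fst (\<gamma> t))" if t: "t \<in> {0<..1}" for t
    proof (rule isCont_slit[OF F(1)])
      consider "t \<in> {0<..<s}" | "t = s" | "t \<in> {s<..1}" using t by fastforce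
      then show "fst (\<gamma> t) \<in> slit (a k) (b k)"
      proof cases
        case 2
        then show ?thesis using \<open>fst (\<gamma> s) \<in> _\<close> by (auto simp: slit_def)
      qed (use 1 3 hp_subset_slit in blast)+
    qed
    show "(F has_field_derivative f (\<gamma> t)) (at (fst (\<gamma> t)))" if t: "t \<in> {0<..1} - {s}" for t
    proof (cases "t < s")
      case True
      then have *: "\<gamma> t \<in> sheet N a b \<nu>" "fst (\<gamma> t) \<in> hp (- s0)" using 1 t by auto
      show ?thesis using derF[OF *(2), of sg] sheet_cases[OF *(1)] by (simp add: sg_def)
    next
      case False
      then have *: "\<gamma> t \<in> sheet N a b j" "fst (\<gamma> t) \<in> hp s0" using 3 t by auto
      show ?thesis using derF[OF *(2), of "- sg"] sheet_cases[OF *(1), unfolded j\<nu>] by simp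
    qed
    have "((\<lambda>t. H (1 / (fst (\<gamma> t) - of_real mid))) \<longlongrightarrow> 0) (at_right 0)"
      using filterlim_compose[OF H_tendsto inf] by (simp add: o_def)
    moreover have "\<forall>\<^sub>F t in at_right 0. H (1 / (fst (\<gamma> t) - of_real mid)) = F (fst (\<gamma> t))"
      unfolding eventually_at_right_field
    proof (intro exI[of _ s] conjI allI impI)
      fix t assume "0 < t" "t < s"
      then have *: "fst (\<gamma> t) \<in> hp (- s0)" using 1 by auto
      moreover have "Im (fst (\<gamma> t)) \<noteq> 0" using * by (auto simp: hp_def)
      ultimately show "H (1 / (fst (\<gamma> t) - of_real mid)) = F (fst (\<gamma> t))" using UH F(3) by simp
    qed (use s in auto)
    ultimately show "((\<lambda>t. F (fst (\<gamma> t))) \<longlongrightarrow> 0) (at_right 0)"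
      by (rule Lim_transform_eventually)
  qed simp
  moreover have "F (fst (\<gamma> 1)) = U (- sg) z"
    using F(2)[of z] 3[of 1] s by (simp add: \<gamma>1 sheet_pt_def)
  ultimately show ?thesis by simp
qed

lemma abelian_path_same_exists:
  assumes z: "Im z \<noteq> 0"
  shows "\<exists>\<gamma>. abelian_path N a b \<nu> \<nu> z \<gamma>"
proof -
  \<comment> \<open>The curve \<open>p + q / t\<close> is the vertical ray over \<open>Re z\<close>,
    coming from infinity and reaching \<open>z\<close> at \<open>t = 1\<close>.\<close>
  define p where "p = complex_of_real (Re z)"
  define q where "q = \<i> * complex_of_real (Im z)"
  define \<gamma> where "\<gamma> = (\<lambda>t::real. (p + q * of_real (1 / t), sg * sr (p + q * of_real (1 / t))))"
  have Imw: "Im (p + q * of_real (1 / t)) = Im z / t" "Im (p + q / of_real t) = Im z / t" for t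
    by (simp_all add: p_def q_def)
  have "abelian_path N a b \<nu> \<nu> z \<gamma>"
    unfolding abelian_path_def
  proof (intro conjI ballI)
    show "surface_path N a b (subpath \<epsilon> 1 \<gamma>)" if "\<epsilon> \<in> {0<..<1}" for \<epsilon>
    proof (rule surface_path_hyperbola[OF \<gamma>_def _ _ that])
      show "(sg * sr z)\<^sup>2 = curve_poly N a b z" for z
        using sg by (auto simp: power_mult_distrib sheet_root_sq)
      show "isCont (\<lambda>z. sg * sr z) (p + q * of_real (1 / t))" if "t \<in> {0<..1}" for t
      proof (intro analytic_at_imp_isCont root_analytic_off_seg)
        have "Im (p + q * of_real (1 / t)) \<noteq> 0" unfolding Imw using that z by simp
        then show "p + q * of_real (1 / t) \<notin> seg" unfolding notin_seg_iff by blast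
      qed
    qed
    show "filterlim (fst \<circ> \<gamma>) at_infinity (at_right 0)"
      using filterlim_hyperbola[of q p] z by (simp add: \<gamma>_def o_def q_def)
    have "p + q = z" by (simp add: p_def q_def complex_eq_iff)
    then show "\<gamma> 1 = sheet_pt N a b \<nu> z" by (simp add: \<gamma>_def sheet_pt_eq sg_def)
    show "if \<nu> = \<nu> then \<forall>t\<in>{0<..1}. \<gamma> t \<in> sheet N a b \<nu> \<and> Im (fst (\<gamma> t)) \<noteq> 0
      else \<exists>s\<in>{0<..<1}. \<exists>k\<in>{1..N}.
          (\<forall>t\<in>{0<..<s}. \<gamma> t \<in> sheet N a b \<nu> \<and> Im (fst (\<gamma> t)) * Im z < 0) \<and>
          fst (\<gamma> s) \<in> of_real ` {a k<..<b k} \<and>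
          (\<forall>t\<in>{s<..1}. \<gamma> t \<in> sheet N a b \<nu> \<and> Im (fst (\<gamma> t)) * Im z > 0)"
      using z by (auto simp: \<gamma>_def Imw sg_def simp del: plus_complex.sel intro!: sheetI)
  qed
  then show ?thesis by blast
qed

lemma abelian_path_other_exists:
  assumes z: "Im z \<noteq> 0" and j: "j = 3 - \<nu>"
  shows "\<exists>\<gamma>. abelian_path N a b \<nu> j z \<gamma>"
proof -
  have j\<nu>: "j \<noteq> \<nu>" "(if j = 1 then 1 else - 1) = - sg" using \<nu> j by (auto simp: sg_def)
  have N1: "1 \<in> {1..N}" using N by simp
  define x where "x = complex_of_real (cut_mid 1)"
  \<comment> \<open>The curve is \<open>x + (z - x) * (2 - 1 / t)\<close>, on the line through
    \<open>x\<close> and \<open>z\<close>: it comes from infinity in the opposite half-plane,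
    crosses cut 1 at its midpoint for \<open>t = 1 / 2\<close> and ends in \<open>z\<close> at
    \<open>t = 1\<close>.\<close>
  define p where "p = x + 2 * (z - x)"
  define q where "q = - (z - x)"
  define w where "w t = p + q * of_real (1 / t)" for t :: real
  \<comment> \<open>\<open>glued_root\<close> is on sheet 1 above the axis and on sheet 2 below it;
    this sign places the half-plane of \<open>z\<close> on sheet \<open>j\<close> and the opposite
    one on sheet \<open>\<nu>\<close>.\<close>
  define \<tau> where "\<tau> = (if Im z > 0 then - sg else sg)"
  have \<tau>: "\<tau> = 1 \<or> \<tau> = -1" using sg by (auto simp: \<tau>_def)
  define \<gamma> where "\<gamma> = (\<lambda>t::real. (p + q * of_real (1 / t), \<tau> * glued_root (p + q * of_real (1 / t))))"
  have \<gamma>w: "\<gamma> t = (w t, \<tau> * glued_root (w t))" for t by (simp add: \<gamma>_def w_def)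
  have Imw: "Im (w t) = Im z * (2 - 1 / t)" for t
    by (simp add: w_def p_def q_def x_def field_simps)
  have wh: "w (1 / 2) = x" by (simp add: w_def p_def q_def)
  have x: "x \<in> of_real ` {a 1<..<b 1}" using cut_mid[OF N1] by (auto simp: x_def)
  have neg: "(Im z * (2 - 1 / t)) * Im z < 0" if "t \<in> {0<..<1 / 2}" for t
  proof -
    have "2 - 1 / t < 0" using that by (simp add: field_simps)
    moreover have "Im z * Im z > 0" using z by (simp add: zero_less_mult_iff) linarith
    ultimately have "(Im z * Im z) * (2 - 1 / t) < 0" by (rule mult_pos_neg[rotated])
    then show ?thesis by (simp add: mult_ac)
  qed
  have pos: "(Im z * (2 - 1 / t)) * Im z > 0" if "t \<in> {1 / 2<..1}" for t
  proof -
    have "2 - 1 / t > 0" using that by (simp add: field_simps)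
    moreover have "Im z * Im z > 0" using z by (simp add: zero_less_mult_iff) linarith
    ultimately have "(Im z * Im z) * (2 - 1 / t) > 0" by simp
    then show ?thesis by (simp add: mult_ac)
  qed
  have low: "\<gamma> t \<in> sheet N a b \<nu>" if t: "t \<in> {0<..<1 / 2}" for t
  proof -
    have "Im (w t) * Im z < 0" using neg[OF t] by (simp add: Imw)
    then show ?thesis unfolding \<gamma>w
    proof (intro sheetI)
      assume *: "Im (w t) * Im z < 0"
      then show "Im (w t) \<noteq> 0" by auto
      show "\<tau> * glued_root (w t) = (if \<nu> = 1 then 1 else - 1) * sr (w t)"
        unfolding sg_def[symmetric] using * by (auto simp: glued_root_def \<tau>_def mult_less_0_iff)
    qed
  qed
  have high: "\<gamma> t \<in> sheet N a b j" if t: "t \<in> {1 / 2<..1}" for t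
  proof -
    have "Im (w t) * Im z > 0" using pos[OF t] by (simp add: Imw)
    then show ?thesis unfolding \<gamma>w
    proof (intro sheetI)
      assume *: "Im (w t) * Im z > 0"
      then show "Im (w t) \<noteq> 0" by auto
      show "\<tau> * glued_root (w t) = (if j = 1 then 1 else - 1) * sr (w t)"
        unfolding j\<nu> using * by (auto simp: glued_root_def \<tau>_def zero_less_mult_iff)
    qed
  qed
  have w_slit: "w t \<in> slit (a 1) (b 1)" if t: "t \<in> {0<..1}" for t
  proof (cases "t = 1 / 2")
    case True
    then have "w t = x" using wh by (simp only:)
    then show ?thesis using x by (auto simp: slit_def)
  next
    case False
    then have "2 - 1 / t \<noteq> 0" using t by (auto simp: field_simps)
    then show ?thesis using z by (simp add: slit_def Imw)
  qed
  have "abelian_path N a b \<nu> j z \<gamma>"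
    unfolding abelian_path_def
  proof (intro conjI ballI)
    show "surface_path N a b (subpath \<epsilon> 1 \<gamma>)" if "\<epsilon> \<in> {0<..<1}" for \<epsilon>
    proof (rule surface_path_hyperbola[OF \<gamma>_def _ _ that])
      show "(\<tau> * glued_root z)\<^sup>2 = curve_poly N a b z" for z
        using \<tau> by (auto simp: power_mult_distrib glued_root_sq)
      show "isCont (\<lambda>z. \<tau> * glued_root z) (p + q * of_real (1 / t))" if "t \<in> {0<..1}" for t
        using isCont_glued_root[OF N1 w_slit[OF that]] unfolding w_def by (intro continuous_intros)
    qed
    have "q \<noteq> 0" using z by (auto simp: q_def x_def complex_eq_iff)
    then show "filterlim (fst \<circ> \<gamma>) at_infinity (at_right 0)"
      using filterlim_hyperbola[of q p] by (simp add: \<gamma>_def o_def)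
    have "w 1 = z" by (simp add: w_def p_def q_def)
    then show "\<gamma> 1 = sheet_pt N a b j z"
      unfolding \<gamma>w sheet_pt_eq j\<nu> using z by (auto simp: glued_root_def \<tau>_def)
    show "if j = \<nu> then \<forall>t\<in>{0<..1}. \<gamma> t \<in> sheet N a b \<nu> \<and> Im (fst (\<gamma> t)) \<noteq> 0
      else \<exists>s\<in>{0<..<1}. \<exists>k\<in>{1..N}.
          (\<forall>t\<in>{0<..<s}. \<gamma> t \<in> sheet N a b \<nu> \<and> Im (fst (\<gamma> t)) * Im z < 0) \<and>
          fst (\<gamma> s) \<in> of_real ` {a k<..<b k} \<and>
          (\<forall>t\<in>{s<..1}. \<gamma> t \<in> sheet N a b j \<and> Im (fst (\<gamma> t)) * Im z > 0)"
      unfolding if_not_P[OF j\<nu>(1)]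
    proof (intro bexI[of _ "1 / 2"] bexI[of _ 1] conjI ballI)
      show "fst (\<gamma> (1 / 2)) \<in> of_real ` {a 1<..<b 1}" using x by (simp add: \<gamma>w wh)
      show "Im (fst (\<gamma> t)) * Im z < 0" if "t \<in> {0<..<1 / 2}" for t
        using neg[OF that] by (simp add: \<gamma>w Imw)
      show "Im (fst (\<gamma> t)) * Im z > 0" if "t \<in> {1 / 2<..1}" for t
        using pos[OF that] by (simp add: \<gamma>w Imw)
    qed (use N1 low high in auto)
  qed
  then show ?thesis by blast
qed

text \<open>The definite description needs two facts: an admissible path exists, and every
  admissible path has the stated integral. Uniqueness of the integral along one path then excludes
  any other value.\<close>

lemma abelian_u_eq:
  assumes z: "Im z \<noteq> 0" and j: "j = 1 \<or> j = 2"
  shows "abelian_u N a b f \<nu> j z = U (if j = 1 then 1 else - 1) z"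
proof -
  define \<sigma> where "\<sigma> = (if j = 1 then 1 else (- 1 :: complex))"
  have "(\<exists>\<gamma>. abelian_path N a b \<nu> j z \<gamma>) \<and>
      (\<forall>\<gamma>. abelian_path N a b \<nu> j z \<gamma> \<longrightarrow> has_surface_integral_from_infty f (U \<sigma> z) \<gamma>)"
  proof (cases "j = \<nu>")
    case True
    then have "\<sigma> = sg" by (simp add: \<sigma>_def sg_def)
    then show ?thesis using abelian_path_same_exists[OF z] abelian_path_value_same[OF z] True by simp
  next
    case False
    then have "j = 3 - \<nu>" "\<sigma> = - sg" using \<nu> j by (auto simp: \<sigma>_def sg_def)
    then show ?thesis using abelian_path_other_exists[OF z] abelian_path_value_other[OF z] by simp
  qed
  then show ?thesis
    unfolding abelian_u_def \<sigma>_def[symmetric]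
    by (intro the_equality) (blast dest: surface_integral_from_infty_unique)+
qed

end


section \<open>Products and asymptotics\<close>

lemma has_field_derivative_prod_log:
  fixes g :: "'i \<Rightarrow> complex \<Rightarrow> complex"
  assumes "finite A" "\<And>i. i \<in> A \<Longrightarrow> (g i has_field_derivative g i z * l i) (at z)"
  shows "((\<lambda>z. \<Prod>i\<in>A. g i z) has_field_derivative (\<Prod>i\<in>A. g i z) * (\<Sum>i\<in>A. l i)) (at z)"
  using assms
proof (induction A rule: finite_induct)
  case (insert i A)
  then have "((\<lambda>z. g i z * (\<Prod>i\<in>A. g i z)) has_field_derivative
      g i z * ((\<Prod>i\<in>A. g i z) * (\<Sum>i\<in>A. l i)) + g i z * l i * (\<Prod>i\<in>A. g i z)) (at z)"
    by (intro DERIV_mult') auto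
  then show ?case using insert.hyps by (simp add: algebra_simps)
qed simp

lemma DERIV_zero_on_hp:
  assumes "\<And>z. z \<in> hp s \<Longrightarrow> (F has_field_derivative 0) (at z)"
  obtains c where "\<And>z. z \<in> hp s \<Longrightarrow> F z = c"
proof -
  obtain c where "\<And>z. z \<in> hp s \<Longrightarrow> F z = 0 + c"
    using DERIV_eq_on_hp[OF assms DERIV_const] by blast
  then show ?thesis using that by simp
qed

lemma limit_eq_on_hp:
  fixes W :: "complex \<Rightarrow> complex"
  assumes "isCont W (of_real x)" "\<And>z. z \<in> hp s \<Longrightarrow> W z = c" "s \<noteq> 0"
  shows "W (of_real x) = c"
proof -
  have "(W \<longlongrightarrow> W (of_real x)) (at (of_real x) within hp s)"
    using assms(1) unfolding isCont_def by (rule tendsto_within_subset) simp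
  moreover have "(W \<longlongrightarrow> c) (at (of_real x) within hp s)"
    by (rule Lim_transform_eventually[OF tendsto_const])
       (use assms(2) in \<open>auto simp: eventually_at_filter\<close>)
  ultimately show ?thesis by (rule tendsto_unique[OF at_within_hp_neq_bot[OF assms(3)]])
qed

lemma tendsto_hp_cong:
  assumes "isCont W x" "\<And>z. z \<in> hp s \<Longrightarrow> V z = W z"
  shows "(V \<longlongrightarrow> W x) (at x within hp s)"
proof (rule Lim_transform_eventually)
  show "(W \<longlongrightarrow> W x) (at x within hp s)"
    using assms(1) unfolding isCont_def by (rule tendsto_within_subset) simp
qed (use assms(2) in \<open>auto simp: eventually_at_filter\<close>)

context cut_differential
begin

lemma sr_nonzero: "z \<notin> seg \<Longrightarrow> sr z \<noteq> 0"
  by (rule sheet_root_eq_0) (use ends_bounds in \<open>auto simp: seg_def\<close>)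

lemma isCont_off_seg: "g holomorphic_on - seg \<Longrightarrow> z \<notin> seg \<Longrightarrow> isCont g z"
  using closed_seg by (metis ComplI continuous_on_eq_continuous_at holomorphic_on_imp_continuous_on open_Compl)

end

context abelian_integrals
begin

text \<open>By the trace formula the logarithmic derivatives of the two exponentials, of the root
  and of the inverse pole factors add up to 0, so \<open>W\<close> is constant on each half-plane.
  The two constants are compared on a cut.\<close>

lemma sheet_product:
  obtains C where "C \<noteq> 0"
    "\<And>z. Im z \<noteq> 0 \<Longrightarrow> exp (U 1 z) * exp (U (-1) z) * sr z
        = (if Im z > 0 then C else - C) * (\<Prod>j\<in>{1..<N}. z - of_real (pole j))"
proof -
  define A where "A z = (\<Prod>c\<in>ends. csqrt (z - of_real c))" for z :: complex
  define B where "B z = (\<Prod>j\<in>{1..<N}. 1 / (z - of_real (pole j)))" for z :: complex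
  define W where "W z = exp (U 1 z + U (-1) z) * A z * B z" for z
  have srA: "sr z = A z" for z by (simp add: A_def sheet_root_ends)
  have nz: "z - of_real x \<noteq> 0" if "Im z \<noteq> 0" for x z using that by auto
  have der: "(W has_field_derivative 0) (at z)" if z: "Im z \<noteq> 0" for z
  proof -
    define S1 where "S1 = (\<Sum>c\<in>ends. 1 / (z - of_real c))"
    define S2 where "S2 = (\<Sum>j\<in>{1..<N}. 1 / (z - of_real (pole j)))"
    have "((\<lambda>z. csqrt (z - of_real c)) has_field_derivative
        csqrt (z - of_real c) * (1 / 2 * (1 / (z - of_real c)))) (at z)" for c
    proof -
      have "z - of_real c \<notin> \<real>\<^sub>\<le>\<^sub>0" using z by (auto simp: complex_nonpos_Reals_iff)
      then have "((\<lambda>z. csqrt (z - of_real c)) has_field_derivative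
          inverse (2 * csqrt (z - of_real c)) * (1 - 0)) (at z)"
        by (intro DERIV_chain2[OF has_field_derivative_csqrt]) (auto intro!: derivative_eq_intros)
      moreover have "csqrt (z - of_real c) * (1 / 2 * (1 / (z - of_real c)))
          = inverse (2 * csqrt (z - of_real c)) * (1 - 0)"
      proof -
        have "s * (1 / 2 * (1 / (s * s))) = inverse (2 * s)" if "s \<noteq> 0" for s :: complex
          using that by (simp add: field_simps)
        moreover have "csqrt (z - of_real c) * csqrt (z - of_real c) = z - of_real c"
          using power2_csqrt[of "z - of_real c"] by (simp add: power2_eq_square)
        moreover have "csqrt (z - of_real c) \<noteq> 0" using nz[OF z, of c] by simp
        ultimately show ?thesis by (metis diff_zero mult.right_neutral)
      qed
      ultimately show ?thesis by (simp only:)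
    qed
    then have "(A has_field_derivative A z * (\<Sum>c\<in>ends. 1 / 2 * (1 / (z - of_real c)))) (at z)"
      unfolding A_def by (intro has_field_derivative_prod_log finite_ends)
    then have dA: "(A has_field_derivative A z * (1 / 2 * S1)) (at z)"
      unfolding S1_def sum_distrib_left .
    have "((\<lambda>z. 1 / (z - of_real x)) has_field_derivative
        1 / (z - of_real x) * - (1 / (z - of_real x))) (at z)" for x
      using nz[OF z] by (auto intro!: derivative_eq_intros simp: power2_eq_square)
    then have "(B has_field_derivative B z * (\<Sum>j\<in>{1..<N}. - (1 / (z - of_real (pole j))))) (at z)"
      unfolding B_def by (intro has_field_derivative_prod_log) auto
    then have dB: "(B has_field_derivative B z * - S2) (at z)"
      unfolding S2_def sum_negf .
    have "((\<lambda>z. U 1 z + U (-1) z) has_field_derivative f (z, 1 * sr z) + f (z, - 1 * sr z)) (at z)"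
      using z by (intro DERIV_add U) auto
    moreover have "z \<notin> sing" using z by (auto simp: sing_def)
    then have "f (z, 1 * sr z) + f (z, - 1 * sr z) = pole_sum z"
      using sheet_sum_eq_pole_sum[of z] by (simp add: sheet_sum_def)
    ultimately have dU: "((\<lambda>z. U 1 z + U (-1) z) has_field_derivative pole_sum z) (at z)" by simp
    have ps: "pole_sum z = - (1 / 2) * S1 + S2" by (simp only: pole_sum_def S1_def S2_def)
    from DERIV_mult'[OF DERIV_mult'[OF DERIV_fun_exp[OF dU] dA] dB]
    show ?thesis unfolding W_def
      by (rule DERIV_cong) (simp add: ps algebra_simps)
  qed
  obtain C1 where C1: "\<And>z. z \<in> hp 1 \<Longrightarrow> W z = C1"
    using DERIV_zero_on_hp[of 1 W] der by (auto simp: hp_def)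
  obtain C2 where C2: "\<And>z. z \<in> hp (-1) \<Longrightarrow> W z = C2"
    using DERIV_zero_on_hp[of "-1" W] der by (auto simp: hp_def)
  have "C2 = - C1"
  proof -
    have N1: "1 \<in> {1..N}" using N by simp
    obtain F where F: "F holomorphic_on slit (a 1) (b 1)"
      "\<forall>z\<in>hp 1. F z = U 1 z" "\<forall>z\<in>hp (-1). F z = U (- 1) z"
      using match N1 unfolding cut_matched_def by blast
    obtain F' where F': "F' holomorphic_on slit (a 1) (b 1)"
      "\<forall>z\<in>hp 1. F' z = U (-1) z" "\<forall>z\<in>hp (-1). F' z = U (- (-1)) z"
      using match N1 unfolding cut_matched_def by blast
    define x where "x = cut_mid 1"
    \<comment> \<open>\<open>E\<close> continues \<open>W\<close> through cut 1. It equals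
      \<open>W\<close> above; below, the summands \<open>F z\<close> and \<open>F' z\<close> have
      changed places, which leaves their sum as it was, but the continued root is
      \<open>- sr z\<close>, so \<open>E\<close> equals \<open>- W\<close> there.\<close>
    define E where "E z = exp (F z + F' z) * through_root x z * B z" for z
    have x: "a 1 < x" "x < b 1" using cut_mid[OF N1] by (auto simp: x_def)
    then have xs: "of_real x \<in> slit (a 1) (b 1)" by (auto simp: slit_def)
    have "isCont (through_root x) (of_real x)"
      using x ends_cut[OF N1] xs through_root_holomorphic by (intro isCont_slit) auto
    moreover have "x \<noteq> pole j" if "j \<in> {1..<N}" for j using pole_notin_cut[OF that N1] x by auto
    then have "isCont B (of_real x)" unfolding B_def by (intro continuous_intros) auto
    ultimately have cont: "isCont E (of_real x)"
      unfolding E_def using isCont_slit[OF F(1) xs] isCont_slit[OF F'(1) xs] by (intro continuous_intros)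
    have "E (of_real x) = C1"
      by (rule limit_eq_on_hp[OF cont, of 1])
         (use C1 F F' in \<open>auto simp: E_def W_def srA hp_def through_root_upper\<close>)
    moreover have "E (of_real x) = - C2"
      using crossing_sign_cut[OF N1 x] C2 F F'
      by (intro limit_eq_on_hp[OF cont, of "-1"])
         (auto simp: E_def W_def srA hp_def through_root_lower add.commute)
    ultimately have "- C2 = C1" by simp
    from arg_cong[OF this, of uminus] show ?thesis by simp
  qed
  have mult: "B z * (\<Prod>j\<in>{1..<N}. z - of_real (pole j)) = 1" if "Im z \<noteq> 0" for z
    using nz[OF that] by (auto simp: B_def simp flip: prod.distrib intro!: prod.neutral)
  show ?thesis
  proof (rule that)
    have "W \<i> = C1" by (rule C1) (simp add: hp_def)
    moreover have "A \<i> \<noteq> 0" "B \<i> \<noteq> 0"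
      using nz[of \<i>] finite_ends by (auto simp: A_def B_def)
    ultimately show "C1 \<noteq> 0" by (auto simp: W_def)
    fix z :: complex assume z: "Im z \<noteq> 0"
    have Wz: "W z = (if Im z > 0 then C1 else - C1)"
      using C1 C2 \<open>C2 = - C1\<close> z by (auto simp: hp_def)
    have "exp (U 1 z) * exp (U (-1) z) * sr z
        = exp (U 1 z) * exp (U (-1) z) * sr z * (B z * (\<Prod>j\<in>{1..<N}. z - of_real (pole j)))"
      by (simp only: mult[OF z] mult_1_right)
    also have "\<dots> = W z * (\<Prod>j\<in>{1..<N}. z - of_real (pole j))"
      by (simp only: W_def exp_add srA mult.assoc)
    finally show "exp (U 1 z) * exp (U (-1) z) * sr z
        = (if Im z > 0 then C1 else - C1) * (\<Prod>j\<in>{1..<N}. z - of_real (pole j))" unfolding Wz .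
  qed
qed

text \<open>A pole on this sheet makes \<open>U \<sigma>\<close> logarithmic on the gap, but with
  residue 1 its exponential only gains the factor \<open>z - p\<close>. Both half-planes thus share
  one holomorphic \<open>X\<close>, and the whole jump is in the ratio of \<open>A1\<close> to
  \<open>A2\<close>.\<close>

lemma gap_factor:
  assumes k: "k \<in> {1..<N}" and \<sigma>: "\<sigma> = 1 \<or> \<sigma> = -1"
  obtains X A1 A2 where "X holomorphic_on slit (b k) (a (k + 1))" "A1 \<noteq> 0" "A2 \<noteq> 0"
    "\<And>z. z \<in> hp 1 \<Longrightarrow> exp (U \<sigma> z) = A1 * X z" "\<And>z. z \<in> hp (-1) \<Longrightarrow> exp (U \<sigma> z) = A2 * X z"
    "\<And>x. b k < x \<Longrightarrow> x < a (k + 1) \<Longrightarrow> x \<noteq> pole k \<Longrightarrow> X (of_real x) \<noteq> 0"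
proof -
  \<comment> \<open>If the pole is at an end of the gap, the open gap is free of poles and its
    midpoint serves as the crossing point.\<close>
  define p where "p = (if b k < pole k \<and> pole k < a (k + 1) then pole k else (b k + a (k + 1)) / 2)"
  have p: "b k < p" "p < a (k + 1)" using ba[OF k] by (auto simp: p_def)
  define m where "m = presc (Aff (of_real p, \<sigma> * through_root p (of_real p)))"
  have m: "m = 0 \<or> m = 1 \<and> p = pole k"
    using P_eq(1)[OF k] by (auto simp: m_def presc_gap[OF k p])
  have res: "presc (Aff (of_real x, \<sigma> * through_root p (of_real x))) = (if x = p then m else 0)"
    if x: "b k < x" "x < a (k + 1)" for x
  proof (cases "x = p")
    case False
    have "fst (P k) \<noteq> of_real x"
      using P_eq(1)[OF k] False x by (auto simp: p_def split: if_splits)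
    then have "P k \<noteq> (of_real x, w)" for w by auto
    then show ?thesis using False by (simp add: presc_gap[OF k x])
  qed (simp add: m_def)
  obtain F where F: "F holomorphic_on slit (b k) (a (k + 1))"
    "\<And>z. Im z \<noteq> 0 \<Longrightarrow> (F has_field_derivative f (z, \<sigma> * through_root p z) - m / (z - of_real p)) (at z)"
    using interval_primitive[OF p ends_gap[OF k] \<sigma> res] by blast
  have root: "through_root p z = sr z" if "Im z \<noteq> 0" for z
    using gap_notin_cut[OF k] p that by (intro through_root_gap[of "b k" _ "a (k + 1)"]) (auto simp: slit_def)
  define L where "L z = (if m = 0 then 1 else z - of_real p)" for z :: complex
  define X where "X z = L z * exp (F z)" for z
  have L0: "L z \<noteq> 0" if "Im z \<noteq> 0" for z using that by (auto simp: L_def)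
  have dL: "((\<lambda>z. 1 / L z) has_field_derivative - (m / (z - of_real p)) * (1 / L z)) (at z)" if "Im z \<noteq> 0" for z
    using m
  proof
    assume "m = 0"
    then show ?thesis by (simp add: L_def)
  next
    assume m1: "m = 1 \<and> p = pole k"
    have "z \<noteq> of_real p" using that by auto
    then show ?thesis using m1
      by (auto simp: L_def power2_eq_square intro!: derivative_eq_intros)
  qed
  define Y where "Y z = exp (U \<sigma> z - F z) * (1 / L z)" for z
  have dY: "(Y has_field_derivative 0) (at z)" if z: "Im z \<noteq> 0" for z
  proof -
    have "((\<lambda>z. U \<sigma> z - F z) has_field_derivative m / (z - of_real p)) (at z)"
      using DERIV_diff[OF U[OF \<sigma> z] F(2)[OF z]] by (simp add: root[OF z])
    from DERIV_mult'[OF DERIV_fun_exp[OF this] dL[OF z]] show ?thesis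
      unfolding Y_def by (rule DERIV_cong) (simp add: algebra_simps)
  qed
  obtain A1 where A1: "\<And>z. z \<in> hp 1 \<Longrightarrow> Y z = A1"
    using DERIV_zero_on_hp[of 1 Y] dY by (auto simp: hp_def)
  obtain A2 where A2: "\<And>z. z \<in> hp (-1) \<Longrightarrow> Y z = A2"
    using DERIV_zero_on_hp[of "-1" Y] dY by (auto simp: hp_def)
  have YX: "exp (U \<sigma> z) = Y z * X z" if "Im z \<noteq> 0" for z
    using L0[OF that] by (simp add: Y_def X_def exp_diff)
  have Y0: "Y z \<noteq> 0" if "Im z \<noteq> 0" for z using L0[OF that] by (simp add: Y_def)
  show ?thesis
  proof (rule that)
    show "X holomorphic_on slit (b k) (a (k + 1))"
      using F(1) unfolding X_def L_def by (cases "m = 0") (auto intro!: holomorphic_intros)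
    show "A1 \<noteq> 0" using Y0[of \<i>] A1[of \<i>] by (simp add: hp_def)
    show "A2 \<noteq> 0" using Y0[of "- \<i>"] A2[of "- \<i>"] by (simp add: hp_def)
    show "exp (U \<sigma> z) = A1 * X z" if "z \<in> hp 1" for z
      using YX[of z] A1[OF that] that by (simp add: hp_def)
    show "exp (U \<sigma> z) = A2 * X z" if "z \<in> hp (-1)" for z
      using YX[of z] A2[OF that] that by (simp add: hp_def)
    show "X (of_real x) \<noteq> 0" if "b k < x" "x < a (k + 1)" "x \<noteq> pole k" for x
      using that m by (auto simp: X_def L_def)
  qed
qed

text \<open>Unlike \<^term>\<open>exp (U \<sigma> z)\<close>, the Abelian integral itself has limits only away from the poles.\<close>

lemma U_boundary:
  assumes lr: "l < x" "x < r" and \<sigma>: "\<sigma> = 1 \<or> \<sigma> = -1"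
    and free: "\<And>x i. l < x \<Longrightarrow> x < r \<Longrightarrow> i \<in> {1..N} \<Longrightarrow> x \<notin> {a i..b i}"
    and res: "\<And>x. l < x \<Longrightarrow> x < r \<Longrightarrow> presc (Aff (of_real x, \<sigma> * through_root x (of_real x))) = 0"
  obtains u1 u2 where "(U \<sigma> \<longlongrightarrow> u1) (at (of_real x) within hp 1)"
    "(U \<sigma> \<longlongrightarrow> u2) (at (of_real x) within hp (-1))"
proof -
  have root: "through_root y z = sr z" if "l < y" "y < r" "z \<in> slit l r" for y z
    using that free by (intro through_root_gap)
  have res': "presc (Aff (of_real y, \<sigma> * through_root x (of_real y))) = (if y = x then 0 else 0)"
    if "l < y" "y < r" for y
    using res[OF that] root[OF that, of "of_real y"] root[OF lr, of "of_real y"] that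
    by (simp add: slit_def)
  obtain F where F: "F holomorphic_on slit l r"
    "\<And>z. Im z \<noteq> 0 \<Longrightarrow> (F has_field_derivative f (z, \<sigma> * through_root x z) - 0 / (z - of_real x)) (at z)"
    using interval_primitive[OF lr interval_free[OF free] \<sigma> res'] by blast
  have dF: "(F has_field_derivative f (z, \<sigma> * sr z)) (at z)" if "Im z \<noteq> 0" for z
    using F(2)[OF that] root[OF lr, of z] that by (simp add: slit_def)
  obtain c1 where c1: "\<And>z. z \<in> hp 1 \<Longrightarrow> U \<sigma> z = F z + c1"
    using DERIV_eq_on_hp[of 1 "U \<sigma>" "\<lambda>z. f (z, \<sigma> * sr z)" F] U[OF \<sigma>] dF by (auto simp: hp_def)
  obtain c2 where c2: "\<And>z. z \<in> hp (-1) \<Longrightarrow> U \<sigma> z = F z + c2"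
    using DERIV_eq_on_hp[of "-1" "U \<sigma>" "\<lambda>z. f (z, \<sigma> * sr z)" F] U[OF \<sigma>] dF by (auto simp: hp_def)
  have xs: "of_real x \<in> slit l r" using lr by (auto simp: slit_def)
  have "isCont (\<lambda>z. F z + c) (of_real x)" for c
    using isCont_slit[OF F(1) xs] by (intro continuous_intros)
  then show ?thesis using that tendsto_hp_cong c1 c2 by metis
qed

section \<open>The exponentials off the segment and their behaviour at infinity\<close>

definition same_sheet :: "complex \<Rightarrow> complex" where
  "same_sheet z = exp (H (1 / (z - of_real mid)))"

text \<open>The product formula solved for the exponential off the starting sheet, with the constant
  of the upper half-plane used everywhere. It is single-valued off the segment, while the
  exponential itself is its negative in the lower half-plane.\<close>

definition other_sheet :: "complex \<Rightarrow> complex \<Rightarrow> complex" where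
  "other_sheet C z = C * (\<Prod>j\<in>{1..<N}. z - of_real (pole j)) / (sr z * same_sheet z)"

lemma same_sheet_holomorphic: "same_sheet holomorphic_on - seg"
proof -
  have "(H \<circ> (\<lambda>z. 1 / (z - of_real mid))) holomorphic_on - seg"
    by (rule holomorphic_on_compose_gen[OF _ H(1)])
       (use inv_in_slit in \<open>auto intro!: holomorphic_intros\<close>)
  then show ?thesis unfolding same_sheet_def o_def by (intro holomorphic_intros)
qed

lemma other_sheet_holomorphic: "other_sheet C holomorphic_on - seg"
  unfolding other_sheet_def using sr_nonzero
  by (intro holomorphic_intros sheet_root_holomorphic same_sheet_holomorphic)
     (auto simp: same_sheet_def)

lemma inv_mid_bigo: "(\<lambda>z. 1 / (z - complex_of_real mid)) \<in> O[at_infinity](\<lambda>z. 1 / z)"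
proof -
  have "((\<lambda>z. z * (1 / (z - complex_of_real mid))) \<longlongrightarrow> 1) at_infinity"
  proof (rule Lim_transform_eventually)
    have "((\<lambda>z. 1 + complex_of_real mid * (1 / (z - of_real mid))) \<longlongrightarrow> 1 + of_real mid * 0) at_infinity"
      using filterlim_inv_mid by (intro tendsto_intros) (auto simp: filterlim_at)
    then show "((\<lambda>z. 1 + complex_of_real mid * (1 / (z - of_real mid))) \<longlongrightarrow> 1) at_infinity" by simp
    have "\<forall>\<^sub>F z in at_infinity. z \<noteq> complex_of_real mid"
      by (rule eventually_not_equal_at_infinity)
    then show "\<forall>\<^sub>F z in at_infinity. 1 + complex_of_real mid * (1 / (z - of_real mid)) = z * (1 / (z - of_real mid))"
      by eventually_elim (simp add: field_simps)
  qed
  then show ?thesis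
    by (intro bigoI_tendsto[where c = 1])
       (auto simp: eventually_not_equal_at_infinity field_simps)
qed

text \<open>As \<open>H\<close> vanishes at 0 and is differentiable there,
  \<open>exp (H t) - 1\<close> is of order \<open>t\<close>, and \<open>t = 1 / (z - mid)\<close> is
  of order \<open>1 / z\<close>.\<close>

lemma same_sheet_bigo: "(\<lambda>z. same_sheet z - 1) \<in> O[at_infinity](\<lambda>z. 1 / z)"
proof -
  have H0: "H analytic_on {0}"
    using H(1) open_slit[of "-rad" rad] rad_pos analytic_on_subset[of H "slit (-rad) rad" "{0}"]
    by (auto simp: analytic_on_open slit_def)
  then have "(\<lambda>t. exp (H t)) analytic_on {0}" by (intro analytic_intros)
  then have "((\<lambda>t. exp (H t)) has_field_derivative deriv (\<lambda>t. exp (H t)) 0) (at 0)"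
    using analytic_on_imp_differentiable_at DERIV_deriv_iff_field_differentiable by blast
  then have "(\<lambda>t. (exp (H t) - 1) / t) \<midarrow>0\<rightarrow> deriv (\<lambda>t. exp (H t)) 0"
    by (simp add: has_field_derivative_iff H(2))
  then have "(\<lambda>t. exp (H t) - 1) \<in> O[at 0](\<lambda>t. t)"
    by (rule bigoI_tendsto) (auto simp: eventually_at_filter)
  from landau_o.big.compose[OF this filterlim_inv_mid]
  have "(\<lambda>z. same_sheet z - 1) \<in> O[at_infinity](\<lambda>z. 1 / (z - of_real mid))"
    by (simp add: same_sheet_def)
  then show ?thesis using inv_mid_bigo by (rule landau_o.big_trans)
qed

text \<open>One power of \<open>1 / z\<close> remains from \<open>N - 1\<close> pole factors over a
  root of degree \<open>N\<close>. The quotient is squared before the limit is taken, which replaces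
  the root by the polynomial and avoids a choice of branch at infinity.\<close>

lemma other_sheet_bigo: "other_sheet C \<in> O[at_infinity](\<lambda>z. 1 / z)"
proof -
  define Q where "Q z = (\<Prod>j\<in>{1..<N}. z - complex_of_real (pole j))" for z
  have lim: "((\<lambda>z. (z - complex_of_real x) / z) \<longlongrightarrow> 1) at_infinity" for x
  proof (rule Lim_transform_eventually)
    have "((\<lambda>z. 1 - of_real x * inverse z) \<longlongrightarrow> 1 - complex_of_real x * 0) at_infinity"
      by (intro tendsto_intros tendsto_inverse_0)
    then show "((\<lambda>z. 1 - of_real x * inverse z) \<longlongrightarrow> (1::complex)) at_infinity" by simp
    have "\<forall>\<^sub>F z in at_infinity. z \<noteq> (0::complex)" by (rule eventually_not_equal_at_infinity)
    then show "\<forall>\<^sub>F z in at_infinity. 1 - of_real x * inverse z = (z - complex_of_real x) / z"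
      by eventually_elim (simp add: field_simps)
  qed
  have "((\<lambda>z. (\<Prod>j\<in>{1..<N}. (z - complex_of_real (pole j)) / z)\<^sup>2 /
      (\<Prod>k=1..N. ((z - of_real (a k)) / z) * ((z - of_real (b k)) / z))) \<longlongrightarrow>
      (\<Prod>j\<in>{1..<N}. 1)\<^sup>2 / (\<Prod>k=1..N. 1 * 1)) at_infinity"
    by (intro tendsto_intros lim) auto
  then have lim1: "((\<lambda>z. (\<Prod>j\<in>{1..<N}. (z - complex_of_real (pole j)) / z)\<^sup>2 /
      (\<Prod>k=1..N. ((z - of_real (a k)) / z) * ((z - of_real (b k)) / z))) \<longlongrightarrow> 1) at_infinity" by simp
  have "\<forall>\<^sub>F z in at_infinity. (z * (Q z / sr z))\<^sup>2 = (\<Prod>j\<in>{1..<N}. (z - complex_of_real (pole j)) / z)\<^sup>2 /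
      (\<Prod>k=1..N. ((z - of_real (a k)) / z) * ((z - of_real (b k)) / z))"
  proof -
    have "\<forall>\<^sub>F z in at_infinity. z \<noteq> (0::complex)" by (rule eventually_not_equal_at_infinity)
    then show ?thesis
    proof eventually_elim
      case (elim z)
      have 1: "(\<Prod>j\<in>{1..<N}. (z - complex_of_real (pole j)) / z) = Q z / z ^ (N - 1)"
        by (simp add: Q_def prod_dividef)
      have 2: "(\<Prod>k=1..N. ((z - of_real (a k)) / z) * ((z - of_real (b k)) / z)) = (sr z)\<^sup>2 / (z ^ N)\<^sup>2"
        unfolding sheet_root_sq curve_poly_def
        by (simp add: prod_dividef prod.distrib power2_eq_square power_mult_distrib)
      have "z ^ N = z * z ^ (N - 1)" using N by (simp flip: power_Suc)
      then show ?case
        unfolding 1 2 using elim by (simp add: power_mult_distrib power_divide)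
    qed
  qed
  then have "((\<lambda>z. (z * (Q z / sr z))\<^sup>2) \<longlongrightarrow> 1) at_infinity"
    using lim1 by (subst tendsto_cong)
  then have "((\<lambda>z. cmod ((z * (Q z / sr z))\<^sup>2)) \<longlongrightarrow> cmod 1) at_infinity" by (rule tendsto_norm)
  \<comment> \<open>The limit is 1, so 2 bounds the square eventually; since 2 is at most 4, it
    bounds the quotient as well.\<close>
  then have "\<forall>\<^sub>F z in at_infinity. cmod ((z * (Q z / sr z))\<^sup>2) < 2"
    by (rule order_tendstoD) simp
  then have "\<forall>\<^sub>F z in at_infinity. cmod (Q z / sr z) \<le> 2 * cmod (1 / z)"
    using eventually_not_equal_at_infinity[of "0::complex"]
  proof eventually_elim
    case (elim z)
    have "(cmod (z * (Q z / sr z)))\<^sup>2 < 2" using elim(1) by (simp only: norm_power)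
    then have "(cmod (z * (Q z / sr z)))\<^sup>2 \<le> 2\<^sup>2" by simp
    then have "cmod (z * (Q z / sr z)) \<le> 2" by (rule power2_le_imp_le) simp
    then have "cmod z * cmod (Q z / sr z) \<le> 2" by (simp only: norm_mult)
    then show ?case using elim by (simp add: norm_divide field_simps)
  qed
  then have big1: "(\<lambda>z. Q z / sr z) \<in> O[at_infinity](\<lambda>z. 1 / z)" by (rule bigoI)
  have "((\<lambda>z. exp (- H (1 / (z - of_real mid)))) \<longlongrightarrow> exp (- 0)) at_infinity"
    by (intro tendsto_intros H_tendsto)
  from tendsto_mult_left[OF this, of C]
  have "(\<lambda>z. C * exp (- H (1 / (z - of_real mid)))) \<in> O[at_infinity](\<lambda>_. 1)"
    by (intro bigoI_tendsto[where c = "C * exp (- 0)"]) auto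
  from landau_o.big.mult[OF this big1]
  have "(\<lambda>z. C * exp (- H (1 / (z - of_real mid))) * (Q z / sr z)) \<in> O[at_infinity](\<lambda>z. 1 / z)"
    by simp
  moreover have "(\<lambda>z. C * exp (- H (1 / (z - of_real mid))) * (Q z / sr z)) = other_sheet C"
    by (auto simp: other_sheet_def Q_def same_sheet_def exp_minus field_simps)
  ultimately show ?thesis by simp
qed

end


section \<open>Jumps on the gaps\<close>

context abelian_integrals
begin

lemma exp_U_eq:
  obtains C where
    "\<And>z. Im z \<noteq> 0 \<Longrightarrow> exp (U sg z) = same_sheet z"
    "\<And>z. Im z \<noteq> 0 \<Longrightarrow> exp (U (- sg) z) = (if Im z > 0 then 1 else - 1) * other_sheet C z"
proof -
  obtain C where C: "\<And>z. Im z \<noteq> 0 \<Longrightarrow> exp (U 1 z) * exp (U (-1) z) * sr z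
        = (if Im z > 0 then C else - C) * (\<Prod>j\<in>{1..<N}. z - of_real (pole j))"
    using sheet_product by blast
  have same: "exp (U sg z) = same_sheet z" if "Im z \<noteq> 0" for z
    using UH[OF that] same_sheet_def by simp
  show ?thesis
  proof (rule that[OF same])
    fix z :: complex assume z: "Im z \<noteq> 0"
    then have "z \<notin> seg" by (auto simp: notin_seg_iff)
    then have "sr z \<noteq> 0" by (rule sr_nonzero)
    moreover have "exp (U 1 z) * exp (U (-1) z) = same_sheet z * exp (U (- sg) z)"
      using same[OF z] sg by auto
    ultimately have "exp (U (- sg) z) = (if Im z > 0 then C else - C)
        * (\<Prod>j\<in>{1..<N}. z - of_real (pole j)) / (sr z * same_sheet z)"
      using C[OF z] same[OF z, symmetric] by (simp add: field_simps)
    then show "exp (U (- sg) z) = (if Im z > 0 then 1 else - 1) * other_sheet C z"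
      unfolding other_sheet_def by simp
  qed simp
qed

lemma exp_limit:
  assumes "(U \<sigma> \<longlongrightarrow> u) (at (of_real x) within hp s)" "s \<noteq> 0"
    and "isCont W (of_real x)" "\<And>z. z \<in> hp s \<Longrightarrow> exp (U \<sigma> z) = W z"
  shows "exp u = W (of_real x)"
proof -
  have "((\<lambda>z. exp (U \<sigma> z)) \<longlongrightarrow> exp u) (at (of_real x) within hp s)"
    by (intro tendsto_intros assms(1))
  moreover have "((\<lambda>z. exp (U \<sigma> z)) \<longlongrightarrow> W (of_real x)) (at (of_real x) within hp s)"
    by (rule tendsto_hp_cong[OF assms(3,4)])
  ultimately show ?thesis by (rule tendsto_unique[OF at_within_hp_neq_bot[OF assms(2)]])
qed

text \<open>The circle with diameter from \<open>y\<close> to \<open>x\<close> is symmetric about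
  the real axis and meets it in these two points only, one left of \<open>a 1\<close> and one in gap
  \<open>k\<close>.\<close>

lemma B_cycle_circle:
  assumes k: "k \<in> {1..<N}" and x: "b k < x" "x < a (k + 1)" and y: "y < a 1"
  shows "B_cycle a b k (circlepath (of_real ((x + y) / 2)) ((x - y) / 2))"
proof -
  define c where "c = (x + y) / 2"
  define \<rho> where "\<rho> = (x - y) / 2"
  have "a 1 \<le> b k" using ends_bounds[of "b k"] k by (auto simp: ends_def)
  then have \<rho>: "\<rho> > 0" using x y by (simp add: \<rho>_def)
  have pi: "path_image (circlepath (complex_of_real c) \<rho>) = sphere (of_real c) \<rho>"
    using \<rho> by (simp add: path_image_circlepath)
  have cn: "cmod (of_real c - cnj z) = cmod (of_real c - z)" for z
    by (metis complex_cnj_complex_of_real complex_cnj_diff complex_mod_cnj)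
  have "cnj ` sphere (of_real c) \<rho> = sphere (of_real c) \<rho>"
  proof (intro equalityI subsetI)
    fix z assume z: "z \<in> sphere (complex_of_real c) \<rho>"
    have "cnj z \<in> sphere (complex_of_real c) \<rho>" using z cn by (simp add: dist_norm)
    then show "z \<in> cnj ` sphere (complex_of_real c) \<rho>" by (metis complex_cnj_cnj image_eqI)
  qed (auto simp: dist_norm cn)
  moreover have "sphere (complex_of_real c) \<rho> \<inter> \<real> \<subseteq> of_real ` ({..<a 1} \<union> {b k<..<a (k + 1)})"
  proof
    fix z assume z: "z \<in> sphere (complex_of_real c) \<rho> \<inter> \<real>"
    then obtain t where t: "z = of_real t" by (auto elim: Reals_cases)
    then have "\<bar>c - t\<bar> = \<rho>" using z by (simp add: dist_norm flip: of_real_diff)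
    then have "t = x \<or> t = y" by (auto simp: c_def \<rho>_def abs_if field_simps split: if_splits)
    then show "z \<in> of_real ` ({..<a 1} \<union> {b k<..<a (k + 1)})" using x y t by auto
  qed
  moreover have "winding_number (circlepath (complex_of_real c) \<rho>) (of_real t) = 1" if "t \<in> {a 1..b k}" for t
  proof (rule winding_number_circlepath)
    have "\<bar>t - c\<bar> < \<rho>" using that x y by (auto simp: c_def \<rho>_def abs_if field_simps)
    then show "cmod (of_real t - of_real c) < \<rho>" by (simp flip: of_real_diff)
  qed
  ultimately have "B_cycle a b k (circlepath (of_real c) \<rho>)"
    unfolding B_cycle_def pi using \<rho> by (auto simp: simple_path_circlepath)
  then show ?thesis by (simp add: c_def \<rho>_def)
qed

text \<open>The period is a combination of boundary values of \<open>U 1\<close> at the two crossing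
  points. Taking exponentials removes the unknown integer: the crossing at \<open>x\<close>
  contributes \<open>A2 / A1\<close>, the crossing at \<open>y\<close> the sign
  \<open>sg\<close>.\<close>

lemma B_period_ratio:
  assumes k: "k \<in> {1..<N}" and B: "B_period_cong N a b P f k c"
    and X: "X holomorphic_on slit (b k) (a (k + 1))"
      "\<And>z. z \<in> hp 1 \<Longrightarrow> exp (U 1 z) = A1 * X z" "\<And>z. z \<in> hp (-1) \<Longrightarrow> exp (U 1 z) = A2 * X z"
    and x: "b k < x" "x < a (k + 1)" "x \<noteq> pole k" "X (of_real x) \<noteq> 0"
  shows "A1 = sg * exp (- (2 * of_real pi * \<i> * of_real c)) * A2"
proof -
  define y where "y = a 1 - 1"
  define m where "m = (x + y) / 2"
  define \<rho> where "\<rho> = (x - y) / 2"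
  define \<gamma> where "\<gamma> = circlepath (complex_of_real m) \<rho>"
  have b1: "a 1 \<le> b k" using ends_bounds[of "b k"] k by (auto simp: ends_def)
  have \<rho>: "\<rho> > 0" "m - \<rho> = y" "m + \<rho> = x" using x b1 by (auto simp: \<rho>_def m_def y_def field_simps)
  have "B_cycle a b k \<gamma>"
    using B_cycle_circle[OF k x(1,2), of y] by (simp add: \<gamma>_def m_def \<rho>_def y_def)
  moreover have "P k \<notin> sheet_pt N a b 1 ` path_image \<gamma>"
  proof
    assume "P k \<in> sheet_pt N a b 1 ` path_image \<gamma>"
    then have "fst (P k) \<in> sphere (of_real m) \<rho>"
      using \<rho>(1) by (auto simp: sheet_pt_def \<gamma>_def path_image_circlepath)
    then have "\<bar>m - pole k\<bar> = \<rho>"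
      using P_eq(1)[OF k] by (simp add: dist_norm flip: of_real_diff)
    then have "pole k = x \<or> pole k = y" using \<rho> by (auto simp: abs_if split: if_splits)
    then show False using x(3) P_eq(2)[OF k] b1 by (auto simp: y_def)
  qed
  ultimately obtain I n where I: "has_surface_integral f I (sheet_pt N a b 1 \<circ> \<gamma>)"
    and n: "1 / (2 * of_real pi * \<i>) * I = of_real c + of_int n"
    using B unfolding B_period_cong_def by blast
  have "fst \<circ> (sheet_pt N a b 1 \<circ> \<gamma>) = \<gamma>" by (auto simp: sheet_pt_def)
  then have I': "((\<lambda>z. f (z, sr z)) has_contour_integral I) \<gamma>"
    using I by (simp add: has_surface_integral_def has_contour_integral_def sheet_pt_def)
  \<comment> \<open>The gap is cut off at the pole, on whichever side of \<open>x\<close> it lies.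
    On the remaining interval around \<open>x\<close> there is no pole, and \<open>U 1\<close> has
    boundary values at \<open>x\<close>.\<close>
  define l where "l = (if pole k < x then pole k else b k)"
  define r where "r = (if pole k < x then a (k + 1) else pole k)"
  have lr: "l < x" "x < r" "b k \<le> l" "r \<le> a (k + 1)" "pole k \<le> l \<or> r \<le> pole k"
    using x P_eq(2,3)[OF k] by (auto simp: l_def r_def)
  have free: "t \<notin> {a i..b i}" if "l < t" "t < r" "i \<in> {1..N}" for t i
    using that lr by (intro gap_notin_cut[OF k]) auto
  have res: "presc (Aff (of_real t, 1 * through_root t (of_real t))) = 0" if t: "l < t" "t < r" for t
  proof -
    have "P k \<noteq> (of_real t, w)" for w using P_eq(1)[OF k] t lr by auto
    then show ?thesis using presc_gap[OF k, of t] t lr by simp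
  qed
  obtain u1 u2 where u: "(U 1 \<longlongrightarrow> u1) (at (of_real x) within hp 1)"
    "(U 1 \<longlongrightarrow> u2) (at (of_real x) within hp (-1))"
    using U_boundary[OF lr(1,2) _ free res] by blast
  have y: "y - 1 < y" "y < a 1" by (simp_all add: y_def)
  have freey: "t \<notin> {a i..b i}" if "y - 1 < t" "t < a 1" "i \<in> {1..N}" for t i
    using that by (intro outside_notin_cut) auto
  have resy: "presc (Aff (of_real t, 1 * through_root t (of_real t))) = 0" if "y - 1 < t" "t < a 1" for t
    using that by (intro presc_off_seg) (auto simp: notin_seg_iff)
  obtain v1 v2 where v: "(U 1 \<longlongrightarrow> v1) (at (of_real y) within hp 1)"
    "(U 1 \<longlongrightarrow> v2) (at (of_real y) within hp (-1))"
    using U_boundary[where l = "y - 1" and x = y and r = "a 1", OF y disjI1[OF refl] freey resy]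
    by blast
  have "((\<lambda>z. f (z, sr z)) has_contour_integral ((v1 - u1) + (u2 - v2))) \<gamma>"
    unfolding \<gamma>_def
  proof (rule circlepath_integral_halves[where U = "U 1"])
    show "(U 1 has_field_derivative f (z, sr z)) (at z)" if "Im z \<noteq> 0" for z
      using U[of 1, OF _ that] by simp
  qed (use \<rho> u v in \<open>auto simp: hp_scale[OF \<rho>(1)]\<close>)
  from has_contour_integral_unique[OF I' this] have I_eq: "I = (v1 - u1) + (u2 - v2)" .
  have xs: "of_real x \<in> slit (b k) (a (k + 1))" using x by (auto simp: slit_def)
  have contX: "isCont (\<lambda>z. A * X z) (of_real x)" for A
    using isCont_slit[OF X(1) xs] by (intro continuous_intros)
  have eu: "exp u1 = A1 * X (of_real x)" "exp u2 = A2 * X (of_real x)"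
    by (rule exp_limit[OF u(1) _ contX X(2)], simp_all)
       (rule exp_limit[OF u(2) _ contX X(3)], simp_all)
  have y_seg: "of_real y \<notin> seg" by (simp add: notin_seg_iff y_def)
  obtain C where C: "\<And>z. Im z \<noteq> 0 \<Longrightarrow> exp (U sg z) = same_sheet z"
    "\<And>z. Im z \<noteq> 0 \<Longrightarrow> exp (U (- sg) z) = (if Im z > 0 then 1 else - 1) * other_sheet C z"
    using exp_U_eq by blast
  \<comment> \<open>For \<open>\<nu> = 1\<close> the first sheet is the starting sheet and its
    exponential is continuous at \<open>y\<close>. For \<open>\<nu> = 2\<close> it is the other
    sheet, whose exponential has opposite signs above and below.\<close>
  have ev: "exp v1 = sg * exp v2"
  proof (cases "\<nu> = 1")
    case True
    then have sg1: "sg = 1" unfolding sg_def by simp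
    have cont: "isCont (same_sheet) (of_real y)"
      by (rule isCont_off_seg[OF same_sheet_holomorphic y_seg])
    have "exp v1 = same_sheet (of_real y)"
      by (rule exp_limit[OF v(1) _ cont]) (use C(1) sg1 in \<open>auto simp: hp_def\<close>)
    moreover have "exp v2 = same_sheet (of_real y)"
      by (rule exp_limit[OF v(2) _ cont]) (use C(1) sg1 in \<open>auto simp: hp_def\<close>)
    ultimately show ?thesis using sg1 by simp
  next
    case False
    then have sg1: "sg = -1" by (simp add: sg_def)
    have cont: "isCont (other_sheet C) (of_real y)"
      by (rule isCont_off_seg[OF other_sheet_holomorphic y_seg])
    then have cont': "isCont (\<lambda>z. - other_sheet C z) (of_real y)" by (intro continuous_intros)
    have "exp v1 = other_sheet C (of_real y)"
      by (rule exp_limit[OF v(1) _ cont]) (use C(2) sg1 in \<open>auto simp: hp_def\<close>)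
    moreover have "exp v2 = - other_sheet C (of_real y)"
      by (rule exp_limit[OF v(2) _ cont']) (use C(2) sg1 in \<open>auto simp: hp_def\<close>)
    ultimately show ?thesis using sg1 by simp
  qed
  have "I = 2 * of_real pi * \<i> * of_real c + 2 * of_real pi * \<i> * of_int n"
    using n by (simp add: field_simps)
  then have "exp I = exp (2 * of_real pi * \<i> * of_real c)"
    by (simp add: exp_add exp_integer_2pi mult.commute mult.left_commute)
  moreover have "exp I * exp u1 * exp v2 = exp v1 * exp u2"
    by (simp add: I_eq exp_diff exp_add)
  ultimately have "exp (2 * of_real pi * \<i> * of_real c) * (A1 * X (of_real x)) * exp v2
      = sg * exp v2 * (A2 * X (of_real x))" by (simp add: eu ev)
  then have "exp (2 * of_real pi * \<i> * of_real c) * A1 = sg * A2" using x(4) by simp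
  then show ?thesis by (simp add: exp_minus field_simps)
qed

text \<open>The period fixes the ratio on the first sheet. Comparing the product formula from above
  and from below at a point of the gap gives \<open>A1 * B1 = - (A2 * B2)\<close>, so the second
  sheet has the inverse ratio with an extra sign.\<close>

lemma exp_U_gap_limits:
  assumes k: "k \<in> {1..<N}" and B: "B_period_cong N a b P f k c"
    and x: "b k < x" "x < a (k + 1)"
  shows "\<exists>l1 l2. ((\<lambda>z. exp (U 1 z)) \<longlongrightarrow> sg * exp (- (2 * of_real pi * \<i> * of_real c)) * l1) (at (of_real x) within hp 1) \<and>
      ((\<lambda>z. exp (U 1 z)) \<longlongrightarrow> l1) (at (of_real x) within hp (-1)) \<and>
      ((\<lambda>z. exp (U (-1) z)) \<longlongrightarrow> - sg * exp (2 * of_real pi * \<i> * of_real c) * l2) (at (of_real x) within hp 1) \<and>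
      ((\<lambda>z. exp (U (-1) z)) \<longlongrightarrow> l2) (at (of_real x) within hp (-1))"
proof -
  define S where "S = slit (b k) (a (k + 1))"
  obtain X A1 A2 where X: "X holomorphic_on S" "A1 \<noteq> 0" "A2 \<noteq> 0"
    "\<And>z. z \<in> hp 1 \<Longrightarrow> exp (U 1 z) = A1 * X z" "\<And>z. z \<in> hp (-1) \<Longrightarrow> exp (U 1 z) = A2 * X z"
    "\<And>x. b k < x \<Longrightarrow> x < a (k + 1) \<Longrightarrow> x \<noteq> pole k \<Longrightarrow> X (of_real x) \<noteq> 0"
    using gap_factor[OF k, of 1] unfolding S_def by blast
  obtain Y B1 B2 where Y: "Y holomorphic_on S" "B1 \<noteq> 0" "B2 \<noteq> 0"
    "\<And>z. z \<in> hp 1 \<Longrightarrow> exp (U (-1) z) = B1 * Y z" "\<And>z. z \<in> hp (-1) \<Longrightarrow> exp (U (-1) z) = B2 * Y z"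
    "\<And>x. b k < x \<Longrightarrow> x < a (k + 1) \<Longrightarrow> x \<noteq> pole k \<Longrightarrow> Y (of_real x) \<noteq> 0"
    using gap_factor[OF k, of "-1"] unfolding S_def by blast
  obtain x0 where x0: "b k < x0" "x0 < a (k + 1)" "x0 \<noteq> pole k"
  proof (cases "pole k \<le> b k")
    case True
    then show ?thesis using dense[OF ba[OF k]] that by force
  next
    case False
    then obtain t where "b k < t" "t < pole k" using dense[of "b k" "pole k"] by auto
    then show ?thesis using that[of t] P_eq(3)[OF k] by auto
  qed
  define lam where "lam = exp (- (2 * of_real pi * \<i> * of_real c))"
  have lam: "lam * exp (2 * of_real pi * \<i> * of_real c) = 1" by (simp add: lam_def flip: exp_add)
  have A: "A1 = sg * lam * A2"
    unfolding lam_def by (rule B_period_ratio[OF k B X(1)[unfolded S_def] X(4,5) x0 X(6)[OF x0]])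
  obtain C where C: "\<And>z. Im z \<noteq> 0 \<Longrightarrow> exp (U 1 z) * exp (U (-1) z) * sr z
        = (if Im z > 0 then C else - C) * (\<Prod>j\<in>{1..<N}. z - of_real (pole j))"
    using sheet_product by blast
  define Q where "Q z = X z * Y z * sr z" for z
  define R where "R z = C * (\<Prod>j\<in>{1..<N}. z - of_real (pole j))" for z
  have x0S: "of_real x0 \<in> S" using x0 by (auto simp: S_def slit_def)
  have "sr holomorphic_on S"
    unfolding S_def using gap_notin_cut[OF k] by (intro sheet_root_holomorphic_gap ba[OF k]) auto
  then have Qhol: "Q holomorphic_on S" unfolding Q_def by (intro holomorphic_intros X(1) Y(1))
  have Rhol: "R holomorphic_on S" unfolding R_def by (intro holomorphic_intros)
  have Dcont: "isCont (\<lambda>z. B * Q z - D * R z) (of_real x0)" for B D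
    using Qhol Rhol x0S unfolding S_def by (intro continuous_intros isCont_slit) auto
  have "A1 * B1 * Q (of_real x0) - 1 * R (of_real x0) = 0"
  proof (rule limit_eq_on_hp[OF Dcont, of 1])
    fix z assume z: "z \<in> hp 1"
    have "A1 * X z * (B1 * Y z) * sr z = C * (\<Prod>j\<in>{1..<N}. z - of_real (pole j))"
      using C[of z] z unfolding X(4)[OF z] Y(4)[OF z] by (simp add: hp_def)
    then show "A1 * B1 * Q z - 1 * R z = 0" by (simp add: Q_def R_def mult_ac)
  qed simp
  moreover have "A2 * B2 * Q (of_real x0) - (-1) * R (of_real x0) = 0"
  proof (rule limit_eq_on_hp[OF Dcont, of "-1"])
    fix z assume z: "z \<in> hp (-1)"
    have "A2 * X z * (B2 * Y z) * sr z = - C * (\<Prod>j\<in>{1..<N}. z - of_real (pole j))"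
      using C[of z] z unfolding X(5)[OF z] Y(5)[OF z] by (simp add: hp_def)
    then show "A2 * B2 * Q z - (-1) * R z = 0" by (simp add: Q_def R_def mult_ac)
  qed simp
  moreover have "Q (of_real x0) \<noteq> 0"
  proof -
    have "x0 \<notin> ends" using ends_gap[OF k] x0 by auto
    then have "sr (of_real x0) \<noteq> 0" by (intro sheet_root_eq_0) auto
    then show ?thesis using X(6)[OF x0] Y(6)[OF x0] by (simp add: Q_def)
  qed
  ultimately have "A1 * B1 + A2 * B2 = 0"
  proof -
    assume q: "A1 * B1 * Q (of_real x0) - 1 * R (of_real x0) = 0"
      "A2 * B2 * Q (of_real x0) - (-1) * R (of_real x0) = 0" "Q (of_real x0) \<noteq> 0"
    have "(A1 * B1 + A2 * B2) * Q (of_real x0) = 0" using q(1,2) by (simp add: algebra_simps)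
    then show ?thesis using q(3) by simp
  qed
  then have "A2 * (sg * lam * B1 + B2) = 0" unfolding A by (simp add: algebra_simps)
  then have B2: "sg * lam * B1 = - B2" using X(3) by (simp add: eq_neg_iff_add_eq_0)
  have "sg * sg = 1" using sg by auto
  then have B1: "B1 = - sg * exp (2 * of_real pi * \<i> * of_real c) * B2"
  proof -
    assume "sg * sg = 1"
    then have "B1 = (sg * sg) * (lam * exp (2 * of_real pi * \<i> * of_real c)) * B1" by (simp add: lam)
    also have "\<dots> = sg * exp (2 * of_real pi * \<i> * of_real c) * (sg * lam * B1)" by (simp only: mult_ac)
    finally show ?thesis unfolding B2 by simp
  qed
  have xS: "of_real x \<in> S" using x by (auto simp: S_def slit_def)
  have lim: "((\<lambda>z. exp (U \<sigma> z)) \<longlongrightarrow> D * Z (of_real x)) (at (of_real x) within hp s)"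
    if "Z holomorphic_on S" "\<And>z. z \<in> hp s \<Longrightarrow> exp (U \<sigma> z) = D * Z z" for D Z \<sigma> s
  proof (rule tendsto_hp_cong[where W = "\<lambda>z. D * Z z"])
    show "isCont (\<lambda>z. D * Z z) (of_real x)"
      using that(1) xS unfolding S_def by (intro continuous_intros isCont_slit)
  qed (use that(2) in auto)
  show ?thesis
  proof (intro exI conjI)
    show "((\<lambda>z. exp (U 1 z)) \<longlongrightarrow> sg * exp (- (2 * of_real pi * \<i> * of_real c)) * (A2 * X (of_real x)))
        (at (of_real x) within hp 1)"
      using lim[OF X(1,4)] unfolding A lam_def by (simp only: mult.assoc)
    show "((\<lambda>z. exp (U 1 z)) \<longlongrightarrow> A2 * X (of_real x)) (at (of_real x) within hp (-1))"
      using lim[OF X(1,5)] .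
    show "((\<lambda>z. exp (U (-1) z)) \<longlongrightarrow> - sg * exp (2 * of_real pi * \<i> * of_real c) * (B2 * Y (of_real x)))
        (at (of_real x) within hp 1)"
      using lim[OF Y(1,4)] unfolding B1 by (simp only: mult.assoc)
    show "((\<lambda>z. exp (U (-1) z)) \<longlongrightarrow> B2 * Y (of_real x)) (at (of_real x) within hp (-1))"
      using lim[OF Y(1,5)] .
  qed
qed

end

definition cut_limits :: "(nat \<Rightarrow> complex \<Rightarrow> complex) \<Rightarrow> real \<Rightarrow> bool" where
  "cut_limits v x \<longleftrightarrow> (\<exists>l1 l2.
     (v 1 \<longlongrightarrow> l1) (at (of_real x) within hp 1) \<and> (v 2 \<longlongrightarrow> l1) (at (of_real x) within hp (-1)) \<and>
     (v 2 \<longlongrightarrow> l2) (at (of_real x) within hp 1) \<and> (v 1 \<longlongrightarrow> l2) (at (of_real x) within hp (-1)))"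

text \<open>\<open>s\<close> will be 1 if the paths start on sheet 1 and -1 if they start on sheet
  2, so that exactly the function off the starting sheet carries a minus sign. The signs in the
  matrix absorb it.\<close>

definition gap_limits :: "(nat \<Rightarrow> complex \<Rightarrow> complex) \<Rightarrow> complex \<Rightarrow> real \<Rightarrow> real \<Rightarrow> bool" where
  "gap_limits v s c x \<longleftrightarrow> (\<exists>l1 l2.
     (v 1 \<longlongrightarrow> s * exp (- (2 * of_real pi * \<i> * of_real c)) * l1) (at (of_real x) within hp 1) \<and>
     (v 1 \<longlongrightarrow> l1) (at (of_real x) within hp (-1)) \<and>
     (v 2 \<longlongrightarrow> - s * exp (2 * of_real pi * \<i> * of_real c) * l2) (at (of_real x) within hp 1) \<and>
     (v 2 \<longlongrightarrow> l2) (at (of_real x) within hp (-1)))"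

text \<open>What the Riemann-Hilbert problem requires of one row of the matrix; the functions \<open>e j\<close> are
  the entries up to sign, extended across the real axis outside the cuts.\<close>

definition (in cut_system) row_data ::
  "nat \<Rightarrow> (nat \<Rightarrow> real) \<Rightarrow> (nat \<Rightarrow> complex \<Rightarrow> complex) \<Rightarrow> (nat \<Rightarrow> complex \<Rightarrow> complex) \<Rightarrow> bool" where
  "row_data \<nu> c v e \<longleftrightarrow>
    (\<forall>j. j = 1 \<or> j = 2 \<longrightarrow> e j holomorphic_on - seg) \<and>
    (\<forall>j z. j = 1 \<or> j = 2 \<longrightarrow> Im z \<noteq> 0 \<longrightarrow> v j z = (if j = \<nu> \<or> Im z > 0 then 1 else - 1) * e j z) \<and>
    (\<forall>j. j = 1 \<or> j = 2 \<longrightarrow> (\<lambda>z. e j z - (if j = \<nu> then 1 else 0)) \<in> O[at_infinity](\<lambda>z. 1 / z)) \<and>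
    (\<forall>k x. k \<in> {1..N} \<longrightarrow> a k < x \<longrightarrow> x < b k \<longrightarrow> cut_limits v x) \<and>
    (\<forall>k x. k \<in> {1..<N} \<longrightarrow> b k < x \<longrightarrow> x < a (k + 1) \<longrightarrow> gap_limits v (if \<nu> = 1 then 1 else - 1) (c k) x) \<and>
    (\<forall>x j. x \<in> ends \<longrightarrow> j = 1 \<or> j = 2 \<longrightarrow> (\<exists>K r. r > 0 \<and> (\<forall>z. Im z \<noteq> 0 \<longrightarrow> dist z (of_real x) < r \<longrightarrow>
       cmod (v j z) \<le> K * cmod (z - of_real x) powr (- 1 / 4))))"

context cut_differential
begin

lemma abelian_v_row:
  assumes B: "\<And>k. k \<in> {1..<N} \<Longrightarrow> B_period_cong N a b P f k (c k)"
  shows "\<exists>e. row_data \<nu> c (abelian_v N a b f \<nu>) e"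
proof -
  obtain U H where U: "\<And>\<sigma> z. \<sigma> = 1 \<or> \<sigma> = -1 \<Longrightarrow> Im z \<noteq> 0 \<Longrightarrow> (U \<sigma> has_field_derivative f (z, \<sigma> * sr z)) (at z)"
    and H: "H holomorphic_on slit (-rad) rad" "H 0 = 0"
    and UH: "\<And>z. Im z \<noteq> 0 \<Longrightarrow> U sg z = H (1 / (z - of_real mid))"
    and match: "cut_matched U"
    using abelian_primitives by blast
  interpret abelian_integrals N a b \<nu> P f U H
    by unfold_locales (fact U H UH match)+
  obtain C where C: "\<And>z. Im z \<noteq> 0 \<Longrightarrow> exp (U sg z) = same_sheet z"
    "\<And>z. Im z \<noteq> 0 \<Longrightarrow> exp (U (- sg) z) = (if Im z > 0 then 1 else - 1) * other_sheet C z"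
    using exp_U_eq by blast
  define \<sigma> where "\<sigma> j = (if j = 1 then 1 else (- 1 :: complex))" for j :: nat
  have \<sigma>1: "\<sigma> j = 1 \<or> \<sigma> j = -1" for j by (simp add: \<sigma>_def)
  define e where "e j = (if j = \<nu> then same_sheet else other_sheet C)" for j
  have v: "abelian_v N a b f \<nu> j z = exp (U (\<sigma> j) z)" if "j = 1 \<or> j = 2" "Im z \<noteq> 0" for j z
    unfolding abelian_v_def abelian_u_eq[OF that(2,1)] \<sigma>_def ..
  have vlim: "(abelian_v N a b f \<nu> j \<longlongrightarrow> l) (at x within hp s)"
    if "((\<lambda>z. exp (U (\<sigma> j) z)) \<longlongrightarrow> l) (at x within hp s)" "j = 1 \<or> j = 2" for j l x s
    using that(1)
  proof (rule Lim_transform_eventually)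
    show "\<forall>\<^sub>F z in at x within hp s. exp (U (\<sigma> j) z) = abelian_v N a b f \<nu> j z"
      unfolding eventually_at_filter
    proof (intro always_eventually allI impI)
      fix z assume "z \<in> hp s"
      then have "Im z \<noteq> 0" by (auto simp: hp_def)
      then show "exp (U (\<sigma> j) z) = abelian_v N a b f \<nu> j z" using v[OF that(2)] by simp
    qed
  qed
  have "row_data \<nu> c (abelian_v N a b f \<nu>) e"
    unfolding row_data_def
  proof (intro conjI allI impI)
    fix j :: nat assume j: "j = 1 \<or> j = 2"
    show "e j holomorphic_on - seg"
      unfolding e_def using same_sheet_holomorphic other_sheet_holomorphic by simp
    show "(\<lambda>z. e j z - (if j = \<nu> then 1 else 0)) \<in> O[at_infinity](\<lambda>z. 1 / z)"
      unfolding e_def using same_sheet_bigo other_sheet_bigo by simp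
    fix z :: complex assume z: "Im z \<noteq> 0"
    show "abelian_v N a b f \<nu> j z = (if j = \<nu> \<or> Im z > 0 then 1 else - 1) * e j z"
    proof (cases "j = \<nu>")
      case True
      then have "\<sigma> j = sg" by (simp add: \<sigma>_def sg_def)
      then show ?thesis using v[OF j z] C(1)[OF z] True by (simp add: e_def)
    next
      case False
      then have "\<sigma> j = - sg" using j \<nu> by (auto simp: \<sigma>_def sg_def)
      then show ?thesis using v[OF j z] C(2)[OF z] False by (simp add: e_def)
    qed
  next
    fix k x assume k: "k \<in> {1..N}" and x: "a k < x" "x < b k"
    have "\<exists>l. ((\<lambda>z. exp (U s z)) \<longlongrightarrow> l) (at (of_real x) within hp 1) \<and>
        ((\<lambda>z. exp (U (- s) z)) \<longlongrightarrow> l) (at (of_real x) within hp (-1))" if s: "s \<in> {1, -1}" for s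
    proof -
      obtain F where F: "F holomorphic_on slit (a k) (b k)"
        "\<forall>z\<in>hp 1. F z = U s z" "\<forall>z\<in>hp (-1). F z = U (- s) z"
        using match k s unfolding cut_matched_def by blast
      have "of_real x \<in> slit (a k) (b k)" using x by (auto simp: slit_def)
      then have cont: "isCont (\<lambda>z. exp (F z)) (of_real x)"
        using F(1) by (intro continuous_intros isCont_slit)
      have "((\<lambda>z. exp (U s z)) \<longlongrightarrow> exp (F (of_real x))) (at (of_real x) within hp 1)"
        by (rule tendsto_hp_cong[OF cont]) (use F(2) in auto)
      moreover have "((\<lambda>z. exp (U (- s) z)) \<longlongrightarrow> exp (F (of_real x))) (at (of_real x) within hp (-1))"
        by (rule tendsto_hp_cong[OF cont]) (use F(3) in auto)
      ultimately show ?thesis by blast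
    qed
    from this[of 1] this[of "-1"] obtain l1 l2 where
      "((\<lambda>z. exp (U 1 z)) \<longlongrightarrow> l1) (at (of_real x) within hp 1)"
      "((\<lambda>z. exp (U (-1) z)) \<longlongrightarrow> l1) (at (of_real x) within hp (-1))"
      "((\<lambda>z. exp (U (-1) z)) \<longlongrightarrow> l2) (at (of_real x) within hp 1)"
      "((\<lambda>z. exp (U 1 z)) \<longlongrightarrow> l2) (at (of_real x) within hp (-1))" by auto
    then show "cut_limits (abelian_v N a b f \<nu>) x"
      unfolding cut_limits_def
      by (intro exI[of _ l1] exI[of _ l2] conjI vlim) (simp_all add: \<sigma>_def)
  next
    fix k x assume k: "k \<in> {1..<N}" and x: "b k < x" "x < a (k + 1)"
    show "gap_limits (abelian_v N a b f \<nu>) (if \<nu> = 1 then 1 else - 1) (c k) x"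
    proof -
      obtain l1 l2 where
        "((\<lambda>z. exp (U 1 z)) \<longlongrightarrow> sg * exp (- (2 * of_real pi * \<i> * of_real (c k))) * l1) (at (of_real x) within hp 1)"
        "((\<lambda>z. exp (U 1 z)) \<longlongrightarrow> l1) (at (of_real x) within hp (-1))"
        "((\<lambda>z. exp (U (-1) z)) \<longlongrightarrow> - sg * exp (2 * of_real pi * \<i> * of_real (c k)) * l2) (at (of_real x) within hp 1)"
        "((\<lambda>z. exp (U (-1) z)) \<longlongrightarrow> l2) (at (of_real x) within hp (-1))"
        using exp_U_gap_limits[OF k B[OF k] x] by blast
      then show ?thesis
        unfolding gap_limits_def sg_def[symmetric]
        by (intro exI[of _ l1] exI[of _ l2] conjI vlim) (simp_all add: \<sigma>_def)
    qed
  next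
    fix x and j :: nat assume x: "x \<in> ends" and j: "j = 1 \<or> j = 2"
    have Ub: "(U (\<sigma> j) has_field_derivative f (z, \<sigma> j * sr z)) (at z)" if "z \<in> hp s" for z s
      by (rule U[OF \<sigma>1]) (use that in \<open>auto simp: hp_def\<close>)
    obtain K1 r1 where 1: "r1 > 0" "\<And>z. z \<in> hp 1 \<Longrightarrow> dist z (of_real x) < r1 \<Longrightarrow>
        cmod (exp (U (\<sigma> j) z)) \<le> K1 * cmod (z - of_real x) powr (-1/4)"
      using exp_primitive_bound[OF x disjI1[OF refl] \<sigma>1[of j] Ub[of _ 1]] by blast
    obtain K2 r2 where 2: "r2 > 0" "\<And>z. z \<in> hp (-1) \<Longrightarrow> dist z (of_real x) < r2 \<Longrightarrow>
        cmod (exp (U (\<sigma> j) z)) \<le> K2 * cmod (z - of_real x) powr (-1/4)"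
      using exp_primitive_bound[OF x disjI2[OF refl] \<sigma>1[of j] Ub[of _ "-1"]] by blast
    show "\<exists>K r. r > 0 \<and> (\<forall>z. Im z \<noteq> 0 \<longrightarrow> dist z (of_real x) < r \<longrightarrow>
       cmod (abelian_v N a b f \<nu> j z) \<le> K * cmod (z - of_real x) powr (- 1 / 4))"
    proof (rule exI[of _ "max K1 K2"], rule exI[of _ "min r1 r2"], intro conjI allI impI)
      fix z :: complex assume z: "Im z \<noteq> 0" "dist z (of_real x) < min r1 r2"
      have "cmod (abelian_v N a b f \<nu> j z) \<le> K1 * cmod (z - of_real x) powr (- 1 / 4) \<or>
          cmod (abelian_v N a b f \<nu> j z) \<le> K2 * cmod (z - of_real x) powr (- 1 / 4)"
        using 1(2)[of z] 2(2)[of z] z by (cases "Im z > 0") (auto simp: v[OF j z(1)] hp_def)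
      moreover have "K1 * cmod (z - of_real x) powr (- 1 / 4) \<le> max K1 K2 * cmod (z - of_real x) powr (- 1 / 4)"
        "K2 * cmod (z - of_real x) powr (- 1 / 4) \<le> max K1 K2 * cmod (z - of_real x) powr (- 1 / 4)"
        by (intro mult_right_mono; simp)+
      ultimately show "cmod (abelian_v N a b f \<nu> j z) \<le> max K1 K2 * cmod (z - of_real x) powr (- 1 / 4)"
        by linarith
    qed (use 1 2 in auto)
  qed
  then show ?thesis by blast
qed

end


section \<open>The Riemann-Hilbert problem\<close>

definition idx :: "2 \<Rightarrow> nat" where
  "idx i = (if i = 1 then 1 else 2)"

lemma idx_cases: "idx i = 1 \<or> idx i = 2"
  by (simp add: idx_def)

lemma idx_eq_iff: "idx i = idx j \<longleftrightarrow> i = j"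
  using exhaust_2[of i] exhaust_2[of j] by (auto simp: idx_def)

definition up_sign :: "2 \<Rightarrow> 2 \<Rightarrow> complex" where
  "up_sign i j = (if i = 2 \<and> j = 1 then - 1 else 1)"

definition low_sign :: "2 \<Rightarrow> 2 \<Rightarrow> complex" where
  "low_sign i j = (if i = 1 \<and> j = 2 then - 1 else 1)"

lemma norm_sign [simp]: "cmod (up_sign i j) = 1" "cmod (low_sign i j) = 1"
  by (simp_all add: up_sign_def low_sign_def)

lemma M_nonreal_component:
  "M_nonreal N a b \<omega> z $ i $ j =
    (if Im z > 0 then up_sign i j else low_sign i j) * abelian_v N a b (\<omega> (idx i)) (idx i) (idx j) z"
  using exhaust_2[of i] exhaust_2[of j]
  by (auto simp: M_nonreal_def Let_def up_sign_def low_sign_def idx_def)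

context cut_system
begin

lemmas row_data_D =
  row_data_def[THEN iffD1, THEN conjunct1, rule_format]
  row_data_def[THEN iffD1, THEN conjunct2, THEN conjunct1, rule_format]
  row_data_def[THEN iffD1, THEN conjunct2, THEN conjunct2, THEN conjunct1, rule_format]
  row_data_def[THEN iffD1, THEN conjunct2, THEN conjunct2, THEN conjunct2, THEN conjunct1, rule_format]
  row_data_def[THEN iffD1, THEN conjunct2, THEN conjunct2, THEN conjunct2, THEN conjunct2, THEN conjunct1, rule_format]
  row_data_def[THEN iffD1, THEN conjunct2, THEN conjunct2, THEN conjunct2, THEN conjunct2, THEN conjunct2, rule_format]

context
  fixes \<omega> :: "nat \<Rightarrow> complex \<times> complex \<Rightarrow> complex" and e :: "nat \<Rightarrow> nat \<Rightarrow> complex \<Rightarrow> complex"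
    and \<alpha> :: "nat \<Rightarrow> real" and n :: int
  assumes row: "\<And>i. i = 1 \<or> i = 2 \<Longrightarrow>
    row_data i (\<lambda>k. of_int n * \<alpha> k) (abelian_v N a b (\<omega> i) i) (e i)"
begin

abbreviation "M \<equiv> M_model N a b \<omega>"

abbreviation "v i \<equiv> abelian_v N a b (\<omega> (idx i)) (idx i)"

definition entry :: "2 \<Rightarrow> 2 \<Rightarrow> complex \<Rightarrow> complex" where
  "entry i j z = up_sign i j * e (idx i) (idx j) z"

text \<open>Off the diagonal the sign patterns of the two half-planes differ by -1, and so does the
  exponential off the starting sheet. Hence a single function describes the entry in both
  half-planes.\<close>

lemma M_nonreal_entry:
  assumes "Im z \<noteq> 0"
  shows "M_nonreal N a b \<omega> z $ i $ j = entry i j z"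
  unfolding M_nonreal_component entry_def row_data_D(2)[OF row[OF idx_cases] idx_cases assms]
  using exhaust_2[of i] exhaust_2[of j] by (auto simp: idx_def up_sign_def low_sign_def)

lemma entry_holomorphic: "entry i j holomorphic_on - seg"
  unfolding entry_def by (intro holomorphic_intros row_data_D(1)[OF row[OF idx_cases] idx_cases])

lemma isCont_entry: "z \<notin> seg \<Longrightarrow> isCont (entry i j) z"
  using entry_holomorphic[of i j] closed_seg
  by (metis ComplI continuous_on_eq_continuous_at holomorphic_on_imp_continuous_on open_Compl)

text \<open>On the outer rays \<open>M_model\<close> is a limit over nonreal points. The entries
  there agree with functions continuous across the rays, so the limit exists and is their
  value.\<close>

lemma M_entry:
  assumes "z \<notin> seg"
  shows "M z $ i $ j = entry i j z"
proof (cases "Im z = 0")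
  case False
  then show ?thesis by (simp add: M_model_def M_nonreal_entry)
next
  case True
  then obtain x where x: "z = of_real x" by (metis complex_is_Real_iff Reals_cases)
  define T where "T = {y::complex. Im y \<noteq> 0}"
  have "at z within hp 1 \<le> at z within T" by (rule at_le) (auto simp: T_def hp_def)
  then have "at z within T \<noteq> bot"
    using at_within_hp_neq_bot[of 1 x] by (auto simp: x bot_unique)
  moreover have "(M_nonreal N a b \<omega> \<longlongrightarrow> (\<chi> i j. entry i j z)) (at z within T)"
  proof (intro vec_tendstoI)
    fix i j
    show "((\<lambda>z. M_nonreal N a b \<omega> z $ i $ j) \<longlongrightarrow> (\<chi> i j. entry i j z) $ i $ j) (at z within T)"
    proof (rule Lim_transform_eventually)
      have "(entry i j \<longlongrightarrow> entry i j z) (at z)"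
        using isCont_entry[OF assms] by (simp add: isCont_def)
      then show "(entry i j \<longlongrightarrow> (\<chi> i j. entry i j z) $ i $ j) (at z within T)"
        using tendsto_within_subset[of _ _ z UNIV T] by simp
      show "\<forall>\<^sub>F w in at z within T. entry i j w = M_nonreal N a b \<omega> w $ i $ j"
        unfolding eventually_at_filter
        by (rule always_eventually) (simp add: T_def M_nonreal_entry)
    qed
  qed
  ultimately have "Lim (at z within T) (M_nonreal N a b \<omega>) = (\<chi> i j. entry i j z)"
    by (rule tendsto_Lim)
  then show ?thesis using True by (simp add: M_model_def T_def)
qed

lemma M_analytic: "(\<lambda>z. M z $ i $ j) analytic_on - seg"
proof -
  have "(\<lambda>z. M z $ i $ j) holomorphic_on - seg"
    by (rule holomorphic_transform[OF entry_holomorphic]) (simp add: M_entry)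
  then show ?thesis using closed_seg by (simp add: analytic_on_open open_Compl)
qed

text \<open>\<open>up_sign\<close> is 1 on the diagonal, so multiplying the expansions of a row by
  it leaves the identity matrix as the limit.\<close>

lemma M_infinity: "(\<lambda>z. M z $ i $ j - mat 1 $ i $ j) \<in> O[at_infinity](\<lambda>z. 1 / z)"
proof -
  have "(\<lambda>z. up_sign i j * (e (idx i) (idx j) z - (if idx j = idx i then 1 else 0)))
      \<in> O[at_infinity](\<lambda>z. 1 / z)"
    using row_data_D(3)[OF row[OF idx_cases] idx_cases] by simp
  moreover have "\<forall>\<^sub>F z in at_infinity. M z $ i $ j - mat 1 $ i $ j =
      up_sign i j * (e (idx i) (idx j) z - (if idx j = idx i then 1 else 0))"
  proof -
    have "bounded seg" unfolding seg_def
      by (intro compact_imp_bounded compact_continuous_image continuous_intros) auto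
    then obtain B where B: "\<And>z. z \<in> seg \<Longrightarrow> cmod z \<le> B" by (auto simp: bounded_iff)
    have "M z $ i $ j - mat 1 $ i $ j =
      up_sign i j * (e (idx i) (idx j) z - (if idx j = idx i then 1 else 0))" if "cmod z \<ge> B + 1" for z
    proof -
      have "z \<notin> seg" using B that by force
      then show ?thesis
        by (auto simp: M_entry entry_def idx_eq_iff mat_def up_sign_def)
    qed
    then show ?thesis unfolding eventually_at_infinity by blast
  qed
  ultimately show ?thesis by (simp add: landau_o.big.in_cong)
qed

text \<open>The row data bound the entries at nonreal points. On the outer rays the inequality
  follows by passage to the limit from the upper half-plane, both sides being continuous away from
  the end point.\<close>

lemma M_endpoint:
  assumes x: "x \<in> ends"
  shows "(\<lambda>z. cmod (M z $ i $ j)) \<in> O[at (of_real x) within - seg](\<lambda>z. cmod (z - of_real x) powr (- 1 / 4))"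
proof -
  obtain K r where r: "r > 0" and K: "\<And>z. Im z \<noteq> 0 \<Longrightarrow> dist z (of_real x) < r \<Longrightarrow>
       cmod (v i (idx j) z) \<le> K * cmod (z - of_real x) powr (- 1 / 4)"
    using row_data_D(6)[OF row[OF idx_cases] x idx_cases] by blast
  have bound: "cmod (entry i j z) \<le> K * cmod (z - of_real x) powr (- 1 / 4)"
    if "Im z \<noteq> 0" "dist z (of_real x) < r" for z
    using K[OF that] unfolding M_nonreal_entry[OF that(1), symmetric] M_nonreal_component
    by (simp add: norm_mult)
  have "cmod (entry i j z) \<le> K * cmod (z - of_real x) powr (- 1 / 4)"
    if z: "z \<notin> seg" "dist z (of_real x) < r" for z
  proof (cases "Im z = 0")
    case True
    then obtain y where y: "z = of_real y" by (metis complex_is_Real_iff Reals_cases)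
    have "of_real x \<in> seg" using ends_bounds[OF x] by (auto simp: seg_def)
    then have zx: "z \<noteq> of_real x" using z by auto
    show ?thesis
    proof (rule tendsto_le)
      show "at z within hp 1 \<noteq> bot" unfolding y by (rule at_within_hp_neq_bot) simp
      have "isCont (\<lambda>z. K * cmod (z - of_real x) powr (- 1 / 4)) z"
        using zx by (intro continuous_intros) auto
      then show "((\<lambda>z. K * cmod (z - of_real x) powr (- 1 / 4)) \<longlongrightarrow> K * cmod (z - of_real x) powr (- 1 / 4))
          (at z within hp 1)"
        unfolding isCont_def by (rule tendsto_within_subset) simp
      have "isCont (\<lambda>z. cmod (entry i j z)) z"
        by (intro continuous_intros isCont_entry z)
      then show "((\<lambda>z. cmod (entry i j z)) \<longlongrightarrow> cmod (entry i j z)) (at z within hp 1)"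
        unfolding isCont_def by (rule tendsto_within_subset) simp
      have "\<forall>\<^sub>F w in nhds z. w \<in> ball (of_real x) r"
        using z(2) by (intro eventually_nhds_in_open) (auto simp: dist_commute)
      then show "\<forall>\<^sub>F w in at z within hp 1. cmod (entry i j w) \<le> K * cmod (w - of_real x) powr (- 1 / 4)"
        unfolding eventually_at_filter
      proof eventually_elim
        case (elim w)
        then show ?case using bound[of w] by (simp add: hp_def dist_commute)
      qed
    qed
  qed (use bound z in auto)
  then show ?thesis
    using r by (intro bigoI[where c = K]) (auto simp: eventually_at M_entry intro!: exI[of _ r])
qed

lemma has_jumpI:
  assumes up: "\<And>i j. (v i (idx j) \<longlongrightarrow> Lp i j) (at (of_real x) within hp 1)"
    and low: "\<And>i j. (v i (idx j) \<longlongrightarrow> Lm i j) (at (of_real x) within hp (-1))"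
    and J: "(\<chi> i j. up_sign i j * Lp i j) = (\<chi> i j. low_sign i j * Lm i j) ** J"
  shows "has_jump M x J"
  unfolding has_jump_def hp_1[symmetric] hp_m1[symmetric]
proof (intro exI conjI)
  have "((\<lambda>z. M z $ i $ j) \<longlongrightarrow> up_sign i j * Lp i j) (at (of_real x) within hp 1)" for i j
    by (rule Lim_transform_eventually[OF tendsto_mult_left[OF up]], unfold eventually_at_filter,
        rule always_eventually) (simp add: M_model_def M_nonreal_component hp_def)
  then show "(M \<longlongrightarrow> (\<chi> i j. up_sign i j * Lp i j)) (at (of_real x) within hp 1)"
    by (intro vec_tendstoI) simp
  have "((\<lambda>z. M z $ i $ j) \<longlongrightarrow> low_sign i j * Lm i j) (at (of_real x) within hp (-1))" for i j
    by (rule Lim_transform_eventually[OF tendsto_mult_left[OF low]], unfold eventually_at_filter,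
        rule always_eventually) (auto simp: M_model_def M_nonreal_component hp_def)
  then show "(M \<longlongrightarrow> (\<chi> i j. low_sign i j * Lm i j)) (at (of_real x) within hp (-1))"
    by (intro vec_tendstoI) simp
qed (rule J)

text \<open>Crossing the cut interchanges the two columns, and the differing off-diagonal signs of
  the half-planes supply the entry -1 of \<open>J_cut\<close>.\<close>

lemma jump_cut:
  assumes "k \<in> {1..N}" "a k < x" "x < b k"
  shows "has_jump M x J_cut"
proof -
  have "cut_limits (v i) x" for i
    by (rule row_data_D(4)[OF row[OF idx_cases] assms])
  then obtain l1 l2 where l: "\<And>i. (v i 1 \<longlongrightarrow> l1 i) (at (of_real x) within hp 1)"
    "\<And>i. (v i 2 \<longlongrightarrow> l1 i) (at (of_real x) within hp (-1))"
    "\<And>i. (v i 2 \<longlongrightarrow> l2 i) (at (of_real x) within hp 1)"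
    "\<And>i. (v i 1 \<longlongrightarrow> l2 i) (at (of_real x) within hp (-1))"
    unfolding cut_limits_def by metis
  show ?thesis
  proof (rule has_jumpI)
    show "(v i (idx j) \<longlongrightarrow> (if j = 1 then l1 i else l2 i))
        (at (of_real x) within hp 1)" for i j
      using l(1,3)[of i] by (simp add: idx_def[of j])
    show "(v i (idx j) \<longlongrightarrow> (if j = 1 then l2 i else l1 i))
        (at (of_real x) within hp (-1))" for i j
      using l(2,4)[of i] by (simp add: idx_def[of j])
  qed (simp add: vec_eq_iff forall_2 matrix_matrix_mult_def sum_2 J_cut_def up_sign_def low_sign_def)
qed

lemma jump_gap:
  assumes "k \<in> {1..<N}" "b k < x" "x < a (k + 1)"
  shows "has_jump M x (J_gap n (\<alpha> k))"
proof -
  define E where "E = exp (2 * of_real pi * \<i> * complex_of_real (of_int n * \<alpha> k))"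
  define E' where "E' = exp (- (2 * of_real pi * \<i> * complex_of_real (of_int n * \<alpha> k)))"
  define s where "s i = (if idx i = 1 then 1 else (- 1 :: complex))" for i
  have "gap_limits (v i) (s i) (of_int n * \<alpha> k) x" for i
    unfolding s_def by (rule row_data_D(5)[OF row[OF idx_cases] assms])
  then obtain l1 l2 where l:
    "\<And>i. (v i 1 \<longlongrightarrow> s i * E' * l1 i) (at (of_real x) within hp 1)"
    "\<And>i. (v i 1 \<longlongrightarrow> l1 i) (at (of_real x) within hp (-1))"
    "\<And>i. (v i 2 \<longlongrightarrow> - s i * E * l2 i) (at (of_real x) within hp 1)"
    "\<And>i. (v i 2 \<longlongrightarrow> l2 i) (at (of_real x) within hp (-1))"
    unfolding gap_limits_def E_def E'_def by metis
  have Jg: "J_gap n (\<alpha> k) = vector [vector [E', 0], vector [0, E]]"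
    by (simp add: J_gap_def E_def E'_def mult.assoc)
  show ?thesis
  proof (rule has_jumpI)
    show "(v i (idx j) \<longlongrightarrow> (if j = 1 then s i * E' * l1 i else - s i * E * l2 i))
        (at (of_real x) within hp 1)" for i j
      using l(1,3)[of i] by (simp add: idx_def[of j])
    show "(v i (idx j) \<longlongrightarrow> (if j = 1 then l1 i else l2 i))
        (at (of_real x) within hp (-1))" for i j
      using l(2,4)[of i] by (simp add: idx_def[of j])
  qed (simp add: vec_eq_iff forall_2 matrix_matrix_mult_def sum_2 Jg up_sign_def low_sign_def s_def idx_def)
qed

lemma M_model_RHP: "model_RHP N a b \<alpha> n M"
  unfolding model_RHP_def
  using M_analytic M_infinity M_endpoint jump_cut jump_gap
  unfolding seg_def ends_def by (intro conjI allI ballI) auto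

end

end

theorem theorem3p8:
  fixes N :: nat and a b \<alpha> :: "nat \<Rightarrow> real" and n :: int
    and P :: "nat \<Rightarrow> nat \<Rightarrow> complex \<times> complex"
    and \<omega> :: "nat \<Rightarrow> complex \<times> complex \<Rightarrow> complex"
  assumes "N \<ge> 1"
    and "\<forall>k\<in>{1..N}. a k < b k"
    and "\<forall>k\<in>{1..<N}. b k < a (k + 1)"
    and "\<forall>\<nu>\<in>{1, 2}. \<forall>j\<in>{1..<N}. P \<nu> j \<in> gap_circle N a b j"
    and "\<forall>\<nu>\<in>{1, 2}. is_omega N a b \<nu> (P \<nu>) (\<omega> \<nu>)"
    and "\<forall>\<nu>\<in>{1, 2}. \<forall>k\<in>{1..<N}. B_period_cong N a b (P \<nu>) (\<omega> \<nu>) k (of_int n * \<alpha> k)"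
  shows "model_RHP N a b \<alpha> n (M_model N a b \<omega>)"
proof -
  interpret cut_system N a b
    using assms(1-3) by unfold_locales auto
  have "\<exists>e. row_data i (\<lambda>k. of_int n * \<alpha> k) (abelian_v N a b (\<omega> i) i) e" if i: "i = 1 \<or> i = 2" for i
  proof -
    have i': "i \<in> {1, 2}" using i by simp
    interpret cut_differential N a b i "P i" "\<omega> i"
      by unfold_locales (use i' i assms(4,5) in auto)
    show ?thesis by (rule abelian_v_row) (use i' assms(6) in blast)
  qed
  then obtain e where "\<And>i. i = 1 \<or> i = 2 \<Longrightarrow>
      row_data i (\<lambda>k. of_int n * \<alpha> k) (abelian_v N a b (\<omega> i) i) (e i)" by metis
  then show ?thesis by (rule M_model_RHP)
qed


end
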